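(* For a holomorphic function $f$ on the upper half plane let $\mathrm{dwt}(f)\in\mathbb{Z}\cup\{\pm\infty\}$ be the largest integer $k$ such that $f$ satisfies a monic MLDE of weight $k$, with $\mathrm{dwt}(f)=\infty$ if there is no largest one and $\mathrm{dwt}(f)=-\infty$ if $f$ satisfies no monic MLDE of integral weight. Then for all such $f,g$: (1) $\mathrm{dwt}(fg)\ge\mathrm{dwt}(f)+\mathrm{dwt}(g)$, with the convention $\infty+(-\infty)=-\infty$; (2) if $\mathrm{dwt}(f)=\mathrm{dwt}(g)$, then $\mathrm{dwt}(f+g)\ge\mathrm{dwt}(g)$; (3) if $\mathrm{dwt}(f)>\mathrm{dwt}(g)$, then $\mathrm{dwt}(f+g)=\mathrm{dwt}(g)$; (4) if $f$ is a nonzero quasimodular form of weight $k$ and depth $s$, then $\mathrm{dwt}(f)=k-s$.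
   Context: $q=e^{2\pi iz}$, $f'=\frac{1}{2\pi i}\frac{df}{dz}$; $E_2,E_4,E_6$ are the Eisenstein series with constant term $1$, and $\mathcal{M}_w$ is the space of holomorphic modular forms of weight $w$ on $\mathrm{SL}(2,\mathbb{Z})$. For $k\in\mathbb{R}$, $D_kf=f'-\frac{k}{12}E_2f$, $D_k^{(0)}=\mathrm{id}$, $D_k^{(j)}=D_{k+2j-2}\circ\cdots\circ D_k$. A monic MLDE of weight $k$ is an equation $(D_k^{(n)}+g_1D_k^{(n-1)}+\cdots+g_n)f=0$ with $n\ge0$ and $g_i\in\mathcal{M}_{2i}$. A quasimodular form of weight $k$ is a homogeneous element of weight $k$ of $\mathbb{C}[E_2,E_4,E_6]$ (with $E_2,E_4,E_6$ of weights $2,4,6$); its depth is its degree in $E_2$. *)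

theory Defs
  imports "HOL-Analysis.Analysis" "HOL-Library.Extended_Real"
begin

definition uhp :: "complex set" where
  "uhp = {z. Im z > 0}"

definition divisor_sigma :: "nat \<Rightarrow> nat \<Rightarrow> nat" where
  "divisor_sigma m n = (\<Sum>d | d dvd n. d ^ m)"

definition qpar :: "complex \<Rightarrow> complex" where
  "qpar z = exp (2 * of_real pi * \<i> * z)"

definition E2 :: "complex \<Rightarrow> complex" where
  "E2 z = 1 - 24 * (\<Sum>n. of_nat (divisor_sigma 1 (Suc n)) * qpar z ^ Suc n)"

definition E4 :: "complex \<Rightarrow> complex" where
  "E4 z = 1 + 240 * (\<Sum>n. of_nat (divisor_sigma 3 (Suc n)) * qpar z ^ Suc n)"

definition E6 :: "complex \<Rightarrow> complex" where
  "E6 z = 1 - 504 * (\<Sum>n. of_nat (divisor_sigma 5 (Suc n)) * qpar z ^ Suc n)"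

text \<open>Holomorphic modular forms of weight w on SL(2,Z): holomorphic on the upper
  half plane, weight-w invariant, and holomorphic at the cusp (bounded as Im z \<rightarrow> \<infinity>).\<close>
definition modular_form :: "nat \<Rightarrow> (complex \<Rightarrow> complex) \<Rightarrow> bool" where
  "modular_form w f \<longleftrightarrow>
     f holomorphic_on uhp \<and>
     (\<forall>a b c d :: int. a * d - b * c = 1 \<longrightarrow>
        (\<forall>z\<in>uhp. f ((of_int a * z + of_int b) / (of_int c * z + of_int d))
                   = (of_int c * z + of_int d) ^ w * f z)) \<and>
     (\<exists>B. \<forall>z. Im z \<ge> 1 \<longrightarrow> norm (f z) \<le> B)"

definition nderiv :: "(complex \<Rightarrow> complex) \<Rightarrow> complex \<Rightarrow> complex" where
  "nderiv f z = deriv f z / (2 * of_real pi * \<i>)"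

definition serre_D :: "real \<Rightarrow> (complex \<Rightarrow> complex) \<Rightarrow> complex \<Rightarrow> complex" where
  "serre_D k f z = nderiv f z - of_real k / 12 * E2 z * f z"

fun serre_D_iter :: "real \<Rightarrow> nat \<Rightarrow> (complex \<Rightarrow> complex) \<Rightarrow> complex \<Rightarrow> complex" where
  "serre_D_iter k 0 f = f"
| "serre_D_iter k (Suc j) f = serre_D (k + 2 * real j) (serre_D_iter k j f)"

definition satisfies_monic_MLDE :: "(complex \<Rightarrow> complex) \<Rightarrow> real \<Rightarrow> bool" where
  "satisfies_monic_MLDE f k \<longleftrightarrow>
     (\<exists>n :: nat. \<exists>g :: nat \<Rightarrow> complex \<Rightarrow> complex.
        (\<forall>i\<in>{1..n}. modular_form (2 * i) (g i)) \<and>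
        (\<forall>z\<in>uhp. serre_D_iter k n f z
                  + (\<Sum>i=1..n. g i z * serre_D_iter k (n - i) f z) = 0))"

text \<open>Differential weight: sup over integral weights k of monic MLDEs satisfied by f;
  the supremum in the extended reals is -\<infinity> for the empty set, \<infinity> if unbounded,
  and otherwise the largest such integer.\<close>
definition dwt :: "(complex \<Rightarrow> complex) \<Rightarrow> ereal" where
  "dwt f = Sup {ereal (real_of_int k) | k :: int. satisfies_monic_MLDE f (real_of_int k)}"

definition dwt_add :: "ereal \<Rightarrow> ereal \<Rightarrow> ereal" where
  "dwt_add a b = (if a = -\<infinity> \<or> b = -\<infinity> then -\<infinity> else a + b)"

text \<open>f is a quasimodular form of weight k and depth s: f = P(E2,E4,E6) on the upper
  half plane for a polynomial P, homogeneous of weight k (E2,E4,E6 of weights 2,4,6),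
  whose degree in E2 is s.\<close>
definition quasimodular :: "(complex \<Rightarrow> complex) \<Rightarrow> nat \<Rightarrow> nat \<Rightarrow> bool" where
  "quasimodular f k s \<longleftrightarrow>
     (\<exists>c :: nat \<times> nat \<times> nat \<Rightarrow> complex.
        (\<forall>z\<in>uhp. f z = (\<Sum>(a, b, e) \<in> {(a, b, e). 2 * a + 4 * b + 6 * e = k}.
                           c (a, b, e) * E2 z ^ a * E4 z ^ b * E6 z ^ e)) \<and>
        (\<forall>a b e. 2 * a + 4 * b + 6 * e = k \<and> c (a, b, e) \<noteq> 0 \<longrightarrow> a \<le> s) \<and>
        (\<exists>b e. 2 * s + 4 * b + 6 * e = k \<and> c (s, b, e) \<noteq> 0))"

end

theory Submission
  imports Defs "HOL-Complex_Analysis.Complex_Analysis"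
begin

text \<open>
  The ring \<open>M = \<complex>[E\<^sub>4, E\<^sub>6]\<close> of modular forms is Noetherian. Hence \<open>f\<close> satisfies a monic MLDE of
  weight \<open>k\<close> if and only if, regarded as an element of weight \<open>k\<close>, it lies in a finitely generated
  graded \<open>M\<close>-module of functions that is stable under the Serre derivative. Direct sums and tensor products of such modules show that the solutions of weight \<open>k\<close> are closed under addition and
  that weights add under multiplication. As the constant \<open>1\<close> has weight \<open>-1\<close> (its derivatives
  stay in \<open>M + M E\<^sub>2\<close>), the weights of a function are closed downwards; (1)--(3) follow formally.
  A quasimodular form of weight \<open>k\<close> and depth \<open>s\<close> lies in the stable module spanned by
  \<open>1, E\<^sub>2, \<dots>, E\<^sub>2\<^sup>s\<close>, which gives the weight \<open>k - s\<close>. For \<open>m > k - s\<close> the operator \<open>D\<^sub>m\<close>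
  multiplies the top coefficient in \<open>E\<^sub>2\<close> by the nonzero number \<open>(k - s - m)/12\<close> and
  raises the depth by one, so \<open>D\<^sub>m\<^sup>(\<^sup>n\<^sup>) f\<close> has larger depth than all other terms of a monic MLDE.

  The structure of \<open>M\<close> rests on the transformation laws of \<open>E\<^sub>2, E\<^sub>4, E\<^sub>6\<close>, obtained from lattice sums,
  and on Siegel's proof that there are no cusp forms of weight at most 10. The latter yields Ramanujan's
  equations, hence \<open>\<Delta>' = E\<^sub>2 \<Delta>\<close>, so that \<open>\<Delta>\<close> has no zeros and cusp forms are divisible by it.
\<close>

section \<open>Partial fractions of the cotangent\<close>

text \<open>The coefficients of an MLDE are arbitrary modular forms, whereas the Noetherian argument
  is about polynomials in \<open>E4\<close> and \<open>E6\<close>; the structure theorem for modular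
  forms connects the two and is the reason for the analytic half. There the obstacle is that
  \<open>E2\<close>, \<open>E4\<close>, \<open>E6\<close> are given as series in q, in which the
  effect of -1/z is invisible. Polygamma functions link both sides: they have partial fraction
  series, and the cotangent formed from them has a geometric series in q.

  Monicity is what calls for the Noetherian property. Dependence over the field of fractions of M
  would only give a relation whose leading coefficient is some modular form; membership of the n-th
  derivative in the module generated by the earlier ones gives leading coefficient 1, and
  homogeneity then gives the i-th coefficient weight 2i. The argument is carried out on formal
  coefficient functions, where leading monomials make sense whatever relations hold between the
  actual functions.\<close>

definition pcot :: "complex \<Rightarrow> complex" where
  "pcot z = Digamma (1 - z) - Digamma z"

lemma not_Ints_imp_not_nonpos_Ints:
  assumes "z \<notin> \<int>"
  shows "z \<notin> \<int>\<^sub>\<le>\<^sub>0" "1 - z \<notin> \<int>\<^sub>\<le>\<^sub>0" "z \<noteq> 0" "1 - z \<noteq> 0"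
proof -
  show "z \<notin> \<int>\<^sub>\<le>\<^sub>0" "z \<noteq> 0" using assms by (auto simp: nonpos_Ints_def)
  have "z \<noteq> 1" using assms by auto
  thus "1 - z \<noteq> 0" by simp
  show "1 - z \<notin> \<int>\<^sub>\<le>\<^sub>0"
  proof
    assume "1 - z \<in> \<int>\<^sub>\<le>\<^sub>0"
    hence "1 - z \<in> \<int>" using nonpos_Ints_subset_Ints by blast
    hence "1 - (1 - z) \<in> \<int>" by (rule Ints_diff[OF Ints_1])
    thus False using assms by simp
  qed
qed

lemma sin_pi_nonzero:
  assumes "z \<notin> \<int>"
  shows "sin (of_real pi * z) \<noteq> (0 :: complex)"
proof -
  have "rGamma z \<noteq> 0" "rGamma (1 - z) \<noteq> 0"
    using not_Ints_imp_not_nonpos_Ints[OF assms] by (auto simp: rGamma_eq_zero_iff)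
  thus ?thesis using rGamma_reflection_complex[of z] by auto
qed

text \<open>Logarithmic derivative of the reflection formula, which identifies \<open>pcot\<close>
  as pi cot(pi z). The Digamma form is the primary one because its series and its derivatives are
  those of the Polygamma functions.\<close>

lemma pcot_eq:
  assumes z: "z \<notin> \<int>"
  shows "pcot z = of_real pi * cos (of_real pi * z) / sin (of_real pi * z)"
proof -
  note nz = not_Ints_imp_not_nonpos_Ints[OF z]
  have "((\<lambda>w. rGamma w * rGamma (1 - w)) has_field_derivative
          (-rGamma z * Digamma z) * rGamma (1 - z) + (-rGamma (1 - z) * Digamma (1 - z) * (-1)) * rGamma z) (at z)"
    by (rule derivative_eq_intros has_field_derivative_rGamma_no_nonpos_int
        DERIV_chain2[where f = rGamma] nz refl | simp)+
  hence 1: "((\<lambda>w. rGamma w * rGamma (1 - w)) has_field_derivative rGamma z * rGamma (1 - z) * pcot z) (at z)"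
    by (simp add: pcot_def algebra_simps)
  have "((\<lambda>w. sin (of_real pi * w) / of_real pi) has_field_derivative cos (of_real pi * z)) (at z)"
    by (auto intro!: derivative_eq_intros)
  hence 2: "((\<lambda>w. rGamma w * rGamma (1 - w)) has_field_derivative cos (of_real pi * z)) (at z)"
    by (simp only: rGamma_reflection_complex)
  have "sin (of_real pi * z) / of_real pi * pcot z = cos (of_real pi * z)"
    using DERIV_unique[OF 1 2] by (simp only: rGamma_reflection_complex)
  thus ?thesis using sin_pi_nonzero[OF z] by (simp add: field_simps)
qed

lemma pcot_plus_int:
  assumes z: "z \<notin> \<int>"
  shows "pcot (z + of_int n) = pcot z"
proof -
  have zn: "z + of_int n \<notin> \<int>" using z by (metis Ints_diff Ints_of_int add_diff_cancel_right')
  have "of_real pi * of_int n = (of_real (of_int n * pi) :: complex)" by simp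
  hence "sin (of_real pi * of_int n :: complex) = of_real (sin (of_int n * pi))"
    by (simp only: sin_of_real)
  hence "sin (of_real pi * of_int n :: complex) = 0" by (auto simp: sin_zero_iff_int2)
  hence "sin (of_real pi * (z + of_int n)) = cos (of_real pi * of_int n) * sin (of_real pi * z)"
       "cos (of_real pi * (z + of_int n)) = cos (of_real pi * of_int n) * cos (of_real pi * z)"
    by (simp_all add: ring_distribs sin_add cos_add)
  moreover have "cos (of_real pi * of_int n) \<noteq> (0 :: complex)"
  proof -
    have "(sin (of_real pi * of_int n) :: complex)\<^sup>2 + (cos (of_real pi * of_int n))\<^sup>2 = 1" by simp
    thus ?thesis using \<open>sin (of_real pi * of_int n :: complex) = 0\<close> by auto
  qed
  ultimately show ?thesis using sin_pi_nonzero[OF z] by (simp add: pcot_eq z zn)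
qed

lemma pcot_minus:
  assumes z: "z \<notin> \<int>"
  shows "pcot (-z) = - pcot z"
proof -
  have "-z \<notin> \<int>" using z by (metis Ints_minus minus_minus)
  thus ?thesis using z by (simp add: pcot_eq)
qed

lemma uhp_not_Ints: "z \<in> uhp \<Longrightarrow> z \<notin> \<int>"
  by (auto simp: uhp_def elim!: Ints_cases)

lemma norm_qpar: "norm (qpar z) = exp (- 2 * pi * Im z)"
  by (simp add: qpar_def)

lemma norm_qpar_less_1: "z \<in> uhp \<Longrightarrow> norm (qpar z) < 1"
  by (simp add: norm_qpar uhp_def)

lemma qpar_nonzero [simp]: "qpar z \<noteq> 0" by (simp add: qpar_def)

lemma pcot_uhp:
  assumes z: "z \<in> uhp"
  shows "pcot z = - (of_real pi * \<i>) * (1 + qpar z) / (1 - qpar z)"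
proof -
  define e where "e = exp (\<i> * (of_real pi * z))"
  have e: "e \<noteq> 0" "qpar z = e\<^sup>2"
    by (simp_all add: e_def qpar_def exp_double[symmetric] mult_ac)
  have sin: "sin (of_real pi * z) = (e - 1/e) / (2 * \<i>)" and cos: "cos (of_real pi * z) = (e + 1/e) / 2"
    by (simp_all add: sin_exp_eq cos_exp_eq e_def exp_minus field_simps)
  have "e\<^sup>2 \<noteq> 1" using norm_qpar_less_1[OF z] e by auto
  moreover have "e - 1/e = (e\<^sup>2 - 1)/e" "e + 1/e = (e\<^sup>2+1)/e" using e by (auto simp: field_simps power2_eq_square)
  ultimately show ?thesis using e
    unfolding pcot_eq[OF uhp_not_Ints[OF z]] sin cos
    by (simp add: divide_simps) (simp add: algebra_simps)?
qed

text \<open>For odd \<open>k\<close> this is minus the k-th derivative of \<open>pcot\<close>. For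
  even \<open>k\<close> that derivative has a difference in place of the sum, so the two forms
  alternate below.\<close>

definition psum :: "nat \<Rightarrow> complex \<Rightarrow> complex" where
  "psum k z = Polygamma k z + Polygamma k (1 - z)"

lemma pcot_deriv:
  assumes "z \<notin> \<int>"
  shows "(pcot has_field_derivative - psum 1 z) (at z)"
  unfolding pcot_def[abs_def] psum_def
  by (rule derivative_eq_intros DERIV_chain2[where f = "Polygamma n" for n] 
      not_Ints_imp_not_nonpos_Ints[OF assms] refl | simp)+

lemma Polygamma_diff_deriv:
  assumes "z \<notin> \<int>"
  shows "((\<lambda>z. Polygamma k z - Polygamma k (1 - z)) has_field_derivative psum (Suc k) z) (at z)"
        "(psum k has_field_derivative Polygamma (Suc k) z - Polygamma (Suc k) (1 - z)) (at z)"
  unfolding psum_def[abs_def]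
  by (rule derivative_eq_intros DERIV_chain2[where f = "Polygamma n" for n] 
      not_Ints_imp_not_nonpos_Ints[OF assms] refl | simp)+

text \<open>The Riccati equation p' = -(pi^2 + p^2) of p = pi cot(pi z). It makes all higher
  derivatives polynomials in \<open>pcot\<close>.\<close>

lemma psum_1:
  assumes z: "z \<notin> \<int>"
  shows "psum 1 z = of_real pi ^ 2 + pcot z ^ 2"
proof -
  let ?s = "sin (of_real pi * z)" and ?c = "cos (of_real pi * z)"
  have s: "?s \<noteq> 0" by (rule sin_pi_nonzero[OF z])
  have ev: "\<forall>\<^sub>F w in nhds z. pcot w = of_real pi * cos (of_real pi * w) / sin (of_real pi * w)"
    by (rule eventually_nhds_in_open[of "-\<int>", THEN eventually_mono]) (use z in \<open>auto intro!: pcot_eq\<close>)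
  have "((\<lambda>w. of_real pi * cos (of_real pi * w) / sin (of_real pi * w)) has_field_derivative
     (of_real pi * (- ?s * of_real pi) * ?s - of_real pi * ?c * (?c * of_real pi)) / (?s * ?s)) (at z)"
    using s by (auto intro!: derivative_eq_intros)
  hence "(pcot has_field_derivative 
     (of_real pi * (- ?s * of_real pi) * ?s - of_real pi * ?c * (?c * of_real pi)) / (?s * ?s)) (at z)"
    using DERIV_cong_ev[OF refl ev refl] by blast
  from DERIV_unique[OF pcot_deriv[OF z] this] show ?thesis using s
    by (simp add: pcot_eq[OF z] field_simps power2_eq_square)
qed

lemma open_compl_Ints: "open (- \<int> :: complex set)"
  by (simp add: open_Compl)

lemma deriv_transfer_compl_Ints:
  assumes "(f has_field_derivative D) (at z)" "z \<notin> \<int>" "\<And>w. w \<notin> \<int> \<Longrightarrow> f w = g w"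
  shows "(g has_field_derivative D) (at (z::complex))"
  using has_field_derivative_transform_within_open[OF assms(1) open_compl_Ints, of g] assms(2,3) by auto

lemma psum_3:
  assumes z: "z \<notin> \<int>"
  shows "psum 3 z = 2 * of_real pi ^ 4 + 8 * of_real pi ^ 2 * pcot z ^ 2 + 6 * pcot z ^ 4"
proof -
  have d1: "Polygamma 2 w - Polygamma 2 (1 - w) = - 2 * pcot w * (of_real pi ^ 2 + pcot w ^ 2)"
    if w: "w \<notin> \<int>" for w
  proof -
    have "((\<lambda>x. of_real pi ^ 2 + pcot x ^ 2) has_field_derivative - 2 * pcot w * psum 1 w) (at w)"
      by (rule derivative_eq_intros pcot_deriv w refl | simp)+
    from deriv_transfer_compl_Ints[OF this w psum_1[symmetric]]
    have "(psum 1 has_field_derivative - 2 * pcot w * psum 1 w) (at w)" .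
    from DERIV_unique[OF Polygamma_diff_deriv(2)[OF w] this] show ?thesis
      by (simp add: psum_1[OF w, unfolded One_nat_def] numeral_2_eq_2)
  qed
  have "((\<lambda>w. - 2 * pcot w * (of_real pi ^ 2 + pcot w ^ 2)) has_field_derivative 
     2 * psum 1 z * (of_real pi ^ 2 + pcot z ^ 2) + 4 * pcot z ^ 2 * psum 1 z) (at z)"
    by (rule derivative_eq_intros pcot_deriv z refl | simp)+ (simp add: algebra_simps power2_eq_square)
  from deriv_transfer_compl_Ints[OF this z d1[symmetric]]
  have "((\<lambda>w. Polygamma 2 w - Polygamma 2 (1 - w)) has_field_derivative 
     2 * psum 1 z * (of_real pi ^ 2 + pcot z ^ 2) + 4 * pcot z ^ 2 * psum 1 z) (at z)" .
  from DERIV_unique[OF Polygamma_diff_deriv(1)[OF z] this] show ?thesis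
    by (simp add: psum_1[OF z, unfolded One_nat_def] numeral_3_eq_3 numeral_2_eq_2) (simp add: algebra_simps eval_nat_numeral)
qed

text \<open>The value at 1/2 serves to compute zeta(6). Since \<open>pcot\<close> vanishes there,
  the last differentiation leaves a single term.\<close>

lemma psum_5_half: "psum 5 (1/2) = 16 * of_real pi ^ 6"
proof -
  have half: "(1/2 :: complex) \<notin> \<int>" using fraction_not_in_Ints[where 'a = complex, of 2 1] by simp
  have d1: "Polygamma 4 w - Polygamma 4 (1 - w) = 
       - (16 * of_real pi ^ 2 * pcot w + 24 * pcot w ^ 3) * (of_real pi ^ 2 + pcot w ^ 2)"
    if w: "w \<notin> \<int>" for w
  proof -
    have "((\<lambda>z. 2 * of_real pi ^ 4 + 8 * of_real pi ^ 2 * pcot z ^ 2 + 6 * pcot z ^ 4) has_field_derivative 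
       - (16 * of_real pi ^ 2 * pcot w + 24 * pcot w ^ 3) * psum 1 w) (at w)"
      by (rule derivative_eq_intros pcot_deriv w refl | simp)+ (simp add: algebra_simps power3_eq_cube)
    from deriv_transfer_compl_Ints[OF this w psum_3[symmetric]]
    have "(psum 3 has_field_derivative - (16 * of_real pi ^ 2 * pcot w + 24 * pcot w ^ 3) * psum 1 w) (at w)" .
    from DERIV_unique[OF Polygamma_diff_deriv(2)[OF w] this] show ?thesis
      by (simp add: psum_1[OF w, unfolded One_nat_def] eval_nat_numeral)
  qed
  have z: "pcot (1/2) = 0" using pcot_eq[OF half] by (simp flip: of_real_divide cos_of_real add: mult.commute) 
  have "((\<lambda>w. - (16 * of_real pi ^ 2 * pcot w + 24 * pcot w ^ 3) * (of_real pi ^ 2 + pcot w ^ 2)) 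
     has_field_derivative 16 * of_real pi ^ 4 * psum 1 (1/2)) (at (1/2))"
    by (rule derivative_eq_intros pcot_deriv half refl | simp)+ (simp add: z power2_eq_square power4_eq_xxxx)
  from deriv_transfer_compl_Ints[OF this half d1[symmetric]]
  have "((\<lambda>w. Polygamma 4 w - Polygamma 4 (1 - w)) has_field_derivative 16 * of_real pi ^ 4 * psum 1 (1/2)) (at (1/2))" .
  from DERIV_unique[OF Polygamma_diff_deriv(1)[OF half] this]
  have "psum (Suc 4) (1/2) = 16 * of_real pi ^ 4 * (of_real pi ^ 2 + 0 ^ 2)"
    unfolding psum_1[OF half] z .
  also have "\<dots> = 16 * of_real pi ^ (4 + 2)" unfolding power_add by simp
  finally show ?thesis by simp
qed

section \<open>Unconditional sums over the integers\<close>

lemma has_sum_int_split: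
  fixes f :: "int \<Rightarrow> 'a::topological_comm_monoid_add"
  assumes "((\<lambda>n::nat. f (int n)) has_sum a) UNIV" "((\<lambda>n::nat. f (- 1 - int n)) has_sum b) UNIV"
  shows "(f has_sum (a + b)) UNIV"
proof -
  have "(f has_sum a) (range int)" using assms(1) by (subst has_sum_reindex) (auto simp: o_def)
  moreover have "(f has_sum b) (range (\<lambda>n. - 1 - int n))"
    using assms(2) by (subst has_sum_reindex) (auto simp: o_def inj_on_def)
  moreover have "range int \<inter> range (\<lambda>n. - 1 - int n) = {}" by auto
  ultimately have "(f has_sum (a + b)) (range int \<union> range (\<lambda>n. - 1 - int n))"
    by (rule has_sum_Un_disjoint)
  moreover have "range int \<union> range (\<lambda>n. - 1 - int n) = UNIV"
  proof -
    have "x \<in> range int \<union> range (\<lambda>n. - 1 - int n)" for x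
    proof (cases "x \<ge> 0")
      case True hence "x = int (nat x)" by simp
      thus ?thesis by blast
    next
      case False hence "x = - 1 - int (nat (- 1 - x))" by simp
      thus ?thesis by blast
    qed
    thus ?thesis by auto
  qed
  ultimately show ?thesis by simp
qed

text \<open>\<open>sums\<close> fixes an order of summation and \<open>has_sum\<close> does not.
  Once unconditional summability is known, the ordinary series over n >= 0 and n < 0 determine the
  value.\<close>

lemma has_sum_int_sums:
  fixes f :: "int \<Rightarrow> 'a::banach"
  assumes s: "f summable_on UNIV" and "(\<lambda>n. f (int n)) sums a" "(\<lambda>n. f (- 1 - int n)) sums b"
  shows "(f has_sum (a + b)) UNIV"
proof (rule has_sum_int_split)
  have "(f \<circ> h) summable_on UNIV" if "inj h" for h :: "nat \<Rightarrow> int"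
    using summable_on_reindex[OF that, of f] summable_on_subset_banach[OF s, of "range h"] by simp
  from this[of int] this[of "\<lambda>n. - 1 - int n"]
  have "(f \<circ> int) summable_on UNIV" "(f \<circ> (\<lambda>n. - 1 - int n)) summable_on UNIV"
    by (simp_all add: inj_on_def)
  then obtain a' b' where ab: "((\<lambda>n. f (int n)) has_sum a') UNIV" "((\<lambda>n. f (- 1 - int n)) has_sum b') UNIV"
    by (auto simp: summable_on_def o_def)
  from ab[THEN has_sum_imp_sums] assms have "a' = a" "b' = b" by (auto dest: sums_unique2)
  with ab show "((\<lambda>n. f (int n)) has_sum a) UNIV" "((\<lambda>n. f (- 1 - int n)) has_sum b) UNIV" by auto
qed

text \<open>The limits at the two ends may differ. For the cotangent they do, and their difference
  becomes the extra term in the transformation of \<open>E2\<close>.\<close>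

lemma has_sum_telescope_int:
  fixes g :: "int \<Rightarrow> 'a::banach"
  assumes s: "(\<lambda>n. g n - g (n + 1)) summable_on UNIV"
    and "(\<lambda>N. g (- int N)) \<longlonglongrightarrow> a" "(\<lambda>N. g (int N)) \<longlonglongrightarrow> b"
  shows "((\<lambda>n. g n - g (n + 1)) has_sum (a - b)) UNIV"
proof -
  have "(\<lambda>N. \<Sum>n<N. g (int n) - g (int (Suc n))) \<longlonglongrightarrow> g 0 - b"
    using assms(3) by (subst sum_lessThan_telescope') (auto intro!: tendsto_intros)
  moreover have "(\<lambda>N. \<Sum>n<N. g (- int (Suc n)) - g (- int n)) \<longlonglongrightarrow> a - g 0"
    using assms(2) by (subst sum_lessThan_telescope) (auto intro!: tendsto_intros)
  ultimately have "((\<lambda>n. g n - g (n + 1)) has_sum (g 0 - b + (a - g 0))) UNIV"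
    by (intro has_sum_int_sums s) (simp_all add: sums_def algebra_simps)
  thus ?thesis by simp
qed

lemma summable_norm_inverse_power:
  fixes w :: complex
  assumes "k \<ge> 2"
  shows "summable (\<lambda>n. norm (1 / (w + of_nat n) ^ k))"
proof (rule summable_comparison_test_ev)
  have "summable (\<lambda>n. 2 ^ k * inverse (real n ^ k))"
    using inverse_power_summable[of k, where 'a = real] assms by (intro summable_mult) auto
  thus "summable (\<lambda>n. 2 ^ k * inverse (real n ^ k))" .
  show "\<forall>\<^sub>F n in sequentially. norm (norm (1 / (w + of_nat n) ^ k)) \<le> 2 ^ k * inverse (real n ^ k)"
    using eventually_gt_at_top[of "nat \<lceil>2 * norm w + 1\<rceil>"]
  proof eventually_elim
    case (elim n)
    hence n: "real n > 2 * norm w + 1" by linarith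
    have "real n = norm ((w + of_nat n) - w)" by simp
    also have "\<dots> \<le> norm (w + of_nat n) + norm w" by (rule norm_triangle_ineq4)
    finally have "norm (w + of_nat n) \<ge> real n / 2" using n by linarith
    hence "norm (w + of_nat n) ^ k \<ge> (real n / 2) ^ k" by (rule power_mono) simp
    moreover have "real n > 0" using n norm_ge_zero[of w] by linarith
    hence "(real n / 2) ^ k > 0" by simp
    ultimately have "1 / norm (w + of_nat n) ^ k \<le> 1 / (real n / 2) ^ k"
      by (intro divide_left_mono) (auto intro: mult_pos_pos order_less_le_trans)
    thus ?case by (simp add: norm_divide norm_power power_divide field_simps)
  qed
qed

lemma neg_int_shift: "w + of_int (- 1 - int n) = - ((1 - w) + of_nat n)" for w :: complex
  by simp

lemma abs_summable_row:
  fixes w :: complex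
  assumes "k \<ge> 2"
  shows "(\<lambda>n::int. norm (1 / (w + of_int n) ^ k)) summable_on UNIV"
proof -
  have "norm (1 / (w + of_int (- 1 - int n)) ^ k) = norm (1 / ((1 - w) + of_nat n) ^ k)" for n
    unfolding neg_int_shift norm_divide norm_power norm_minus_cancel ..
  thus ?thesis
    using summable_norm_inverse_power[OF assms, of w, THEN norm_summable_imp_has_sum[rotated, OF summable_sums]]
      summable_norm_inverse_power[OF assms, of "1 - w", THEN norm_summable_imp_has_sum[rotated, OF summable_sums]]
      summable_norm_inverse_power[OF assms] 
    by (intro has_sum_imp_summable[OF has_sum_int_split]) auto
qed

lemma summable_row:
  fixes w :: complex
  assumes "k \<ge> 2"
  shows "(\<lambda>n::int. 1 / (w + of_int n) ^ k) summable_on UNIV"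
  using abs_summable_row[OF assms] by (rule abs_summable_summable)

text \<open>The exponent \<open>Suc k\<close> is even, so the terms with n < 0 form the same series
  at \<open>1 - w\<close>; this is where the second summand of \<open>psum\<close> comes
  from.\<close>

lemma has_sum_row:
  assumes w: "w \<notin> \<int>" and k: "odd k"
  shows "((\<lambda>n::int. 1 / (w + of_int n) ^ Suc k) has_sum psum k w / fact k) UNIV"
proof -
  have k': "k > 0" using k by (cases k) auto
  have "(\<lambda>n. 1 / (w + of_nat n) ^ Suc k) sums (Polygamma k w / fact k)"
       "(\<lambda>n. 1 / ((1 - w) + of_nat n) ^ Suc k) sums (Polygamma k (1 - w) / fact k)"
    using Polygamma_LIMSEQ[of w k] Polygamma_LIMSEQ[of "1 - w" k] k k' not_Ints_imp_not_nonpos_Ints[OF w]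
    by (simp_all add: inverse_eq_divide)
  moreover have "1 / (w + of_int (- 1 - int n)) ^ Suc k = 1 / ((1 - w) + of_nat n) ^ Suc k" for n
    unfolding neg_int_shift using k by (subst power_minus_even) simp_all
  ultimately show ?thesis 
    using has_sum_int_sums[OF summable_row[of "Suc k" w], of "Polygamma k w / fact k" "Polygamma k (1 - w) / fact k"] k'
    by (simp add: psum_def add_divide_distrib del: power_Suc)
qed

text \<open>The sum over all integers in \<open>has_sum_row\<close> does not change under n ->
  -n.\<close>

lemma psum_minus:
  assumes w: "w \<notin> \<int>" and k: "odd k"
  shows "psum k (- w) = psum k w"
proof -
  have w': "-w \<notin> \<int>" using w by (metis Ints_minus minus_minus)
  have "((\<lambda>n::int. 1 / (w + of_int n) ^ Suc k) has_sum psum k (-w) / fact k) UNIV"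
  proof -
    have "1 / (w + of_int (-n)) ^ Suc k = 1 / (-w + of_int n) ^ Suc k" for n
      using k by (subst power_minus_even[symmetric]) simp_all
    hence "((\<lambda>n::int. 1 / (w + of_int (-n)) ^ Suc k) has_sum psum k (-w) / fact k) UNIV"
      using has_sum_row[OF w' k] by (simp only:)
    thus ?thesis by (rule has_sum_reindex_bij_witness[of _ uminus uminus, THEN iffD1, rotated -1]) auto
  qed
  from has_sum_unique[OF this has_sum_row[OF w k]] show ?thesis by simp
qed

text \<open>A single series of terms 1/(a + n) is not unconditionally summable, but the difference
  of two decays like 1/n^2. In this form it gives the row and column sums of the auxiliary series in
  weight 2.\<close>

lemma has_sum_pcot:
  assumes a: "a \<notin> \<int>" and b: "b \<notin> \<int>"
  shows "((\<lambda>n::int. 1 / (a + of_int n) - 1 / (b + of_int n)) has_sum (pcot a - pcot b)) UNIV"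
proof -
  have nz: "x + of_int n \<noteq> 0" if "x \<notin> \<int>" for x :: complex and n
    using that by (metis Ints_minus Ints_of_int add_eq_0_iff minus_minus)
  have s: "(\<lambda>n::int. 1 / (a + of_int n) - 1 / (b + of_int n)) summable_on UNIV"
  proof (rule abs_summable_summable[OF Infinite_Sum.abs_summable_on_comparison_test'])
    show "(\<lambda>n::int. norm (b - a) * (norm (1 / (a + of_int n) ^ 2) + norm (1 / (b + of_int n) ^ 2))) summable_on UNIV"
      by (intro summable_on_cmult_right summable_on_add abs_summable_row) auto
    fix n :: int
    have "1 / (a + of_int n) - 1 / (b + of_int n) = (b - a) * ((1 / (a + of_int n)) * (1 / (b + of_int n)))"
      using nz[OF a, of n] nz[OF b, of n] by (simp add: field_simps)
    hence 1: "norm (1 / (a + of_int n) - 1 / (b + of_int n)) = 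
        norm (b - a) * (norm (1 / (a + of_int n)) * norm (1 / (b + of_int n)))"
      by (simp only: norm_mult)
    have "x * y \<le> x\<^sup>2 + y\<^sup>2" if "x \<ge> 0" "y \<ge> 0" for x y :: real
      using sum_squares_bound[of x y] mult_nonneg_nonneg[OF that] by (simp add: mult.assoc)
    thus "norm (1 / (a + of_int n) - 1 / (b + of_int n)) \<le>
        norm (b - a) * (norm (1 / (a + of_int n) ^ 2) + norm (1 / (b + of_int n) ^ 2))"
      unfolding 1 power_one_over[symmetric] norm_power by (intro mult_left_mono) auto
  qed
  have dg: "(\<lambda>n. 1 / (x + of_nat n) - 1 / (y + of_nat n)) sums (Digamma y - Digamma x)"
    if "x \<noteq> 0" "y \<noteq> 0" for x y :: complex
  proof -
    have "(\<lambda>m. (of_real (ln (real m)) - (\<Sum>n<m. inverse (y + of_nat n))) - 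
            (of_real (ln (real m)) - (\<Sum>n<m. inverse (x + of_nat n)))) \<longlonglongrightarrow> Digamma y - Digamma x"
      using that by (intro tendsto_diff Digamma_LIMSEQ)
    thus ?thesis by (simp add: sums_def sum_subtractf inverse_eq_divide)
  qed
  note nza = not_Ints_imp_not_nonpos_Ints[OF a] and nzb = not_Ints_imp_not_nonpos_Ints[OF b]
  have "(\<lambda>n. 1 / (a + of_int (- 1 - int n)) - 1 / (b + of_int (- 1 - int n))) sums (Digamma (1 - a) - Digamma (1 - b))"
    using dg[OF nzb(4) nza(4)] unfolding neg_int_shift
    by (simp only: divide_minus_right diff_minus_eq_add uminus_add_conv_diff)
  from has_sum_int_sums[OF s _ this, of "Digamma b - Digamma a"] dg[OF nza(3) nzb(3)]
  show ?thesis by (simp add: pcot_def algebra_simps)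
qed

section \<open>Power series in q and their derivatives in z\<close>

lemma theta_powser:
  fixes a :: "nat \<Rightarrow> complex"
  assumes a: "\<And>x. norm x < 1 \<Longrightarrow> summable (\<lambda>n. a n * x ^ n)"
  shows "norm x < 1 \<Longrightarrow> summable (\<lambda>n. of_nat n * a n * x ^ n)"
    and "z \<in> uhp \<Longrightarrow> ((\<lambda>z. \<Sum>n. a n * qpar z ^ n) has_field_derivative
            2 * of_real pi * \<i> * (\<Sum>n. of_nat n * a n * qpar z ^ n)) (at z)"
proof -
  have *: "(\<lambda>n. of_nat n * a n * x ^ n) sums (x * (\<Sum>n. diffs a n * x ^ n))" if x: "norm x < 1" for x
  proof -
    have "summable (\<lambda>n. diffs a n * x ^ n)" by (rule termdiff_converges[OF x]) (use a in auto)
    hence "(\<lambda>n. x * (diffs a n * x ^ n)) sums (x * (\<Sum>n. diffs a n * x ^ n))"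
      by (intro sums_mult summable_sums)
    hence "(\<lambda>n. of_nat (Suc n) * a (Suc n) * x ^ Suc n) sums (x * (\<Sum>n. diffs a n * x ^ n))"
      by (simp add: diffs_def algebra_simps)
    thus ?thesis by (subst (asm) sums_Suc_iff) simp
  qed
  show "norm x < 1 \<Longrightarrow> summable (\<lambda>n. of_nat n * a n * x ^ n)" using * by (auto simp: sums_iff)
  assume z: "z \<in> uhp"
  have "((\<lambda>x. \<Sum>n. a n * x ^ n) has_field_derivative (\<Sum>n. diffs a n * qpar z ^ n)) (at (qpar z))"
    by (rule termdiffs_strong'[OF a]) (use norm_qpar_less_1[OF z] in auto)
  moreover have "(qpar has_field_derivative 2 * of_real pi * \<i> * qpar z) (at z)"
    unfolding qpar_def by (auto intro!: derivative_eq_intros)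
  ultimately have "((\<lambda>z. \<Sum>n. a n * qpar z ^ n) has_field_derivative
       (\<Sum>n. diffs a n * qpar z ^ n) * (2 * of_real pi * \<i> * qpar z)) (at z)"
    by (rule DERIV_chain2)
  also have "(\<Sum>n. diffs a n * qpar z ^ n) * (2 * of_real pi * \<i> * qpar z) = 
      2 * of_real pi * \<i> * (\<Sum>n. of_nat n * a n * qpar z ^ n)"
    using *[OF norm_qpar_less_1[OF z]] by (simp add: sums_iff)
  finally show "((\<lambda>z. \<Sum>n. a n * qpar z ^ n) has_field_derivative
            2 * of_real pi * \<i> * (\<Sum>n. of_nat n * a n * qpar z ^ n)) (at z)" .
qed

lemma summable_power_geometric: "norm x < 1 \<Longrightarrow> summable (\<lambda>n. of_nat n ^ j * x ^ n)" for x :: complex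
proof (induction j arbitrary: x)
  case (Suc j)
  show ?case using theta_powser(1)[OF Suc.IH Suc.prems] by (simp add: mult_ac)
qed auto

lemma summable_norm_power_geometric: "norm x < 1 \<Longrightarrow> summable (\<lambda>n. norm (of_nat n ^ j * x ^ n))" for x :: complex
proof -
  have "(\<lambda>n. of_nat n ^ j * of_real (norm x) ^ n :: complex) = (\<lambda>n. of_real (norm (of_nat n ^ j * x ^ n)))"
    by (simp add: norm_mult norm_power)
  moreover assume "norm x < 1"
  hence "summable (\<lambda>n. of_nat n ^ j * of_real (norm x) ^ n :: complex)"
    by (intro summable_power_geometric) simp
  ultimately show ?thesis by (simp only: summable_complex_of_real)
qed

text \<open>Lipschitz's formula: it starts from the geometric series of the cotangent, and every
  derivative in z multiplies the n-th coefficient by 2 pi \<i> n.\<close>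

lemma psum_qexp:
  assumes z: "z \<in> uhp"
  shows "psum 1 z = (2 * of_real pi * \<i>) ^ 2 * (\<Sum>n. of_nat n ^ 1 * qpar z ^ n)"
    and "psum 3 z = (2 * of_real pi * \<i>) ^ 4 * (\<Sum>n. of_nat n ^ 3 * qpar z ^ n)"
    and "psum 5 z = (2 * of_real pi * \<i>) ^ 6 * (\<Sum>n. of_nat n ^ 5 * qpar z ^ n)"
proof -
  define S where "S = (\<lambda>j z. \<Sum>n. of_nat n ^ j * qpar z ^ n)"
  let ?c = "2 * of_real pi * \<i> :: complex"
  have S': "(S j has_field_derivative ?c * S (Suc j) w) (at w)" if "w \<in> uhp" for j w
    using theta_powser(2)[OF summable_power_geometric that, of j] by (simp add: S_def[abs_def] mult_ac)
  have op: "open uhp" unfolding uhp_def by (rule open_halfspace_Im_gt)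
  have step: "D w = ?c * (C * S (Suc j) w)" 
    if "w \<in> uhp" "\<And>w. w \<in> uhp \<Longrightarrow> f w = C * S j w" "\<And>w. w \<in> uhp \<Longrightarrow> (f has_field_derivative D w) (at w)" for f D w C j
  proof -
    have "((\<lambda>w. C * S j w) has_field_derivative C * (?c * S (Suc j) w)) (at w)"
      by (intro DERIV_cmult S' that)
    hence "(f has_field_derivative C * (?c * S (Suc j) w)) (at w)"
      by (rule has_field_derivative_transform_within_open[OF _ op]) (use that in auto)
    from DERIV_unique[OF that(3)[OF that(1)] this] show ?thesis by simp
  qed
  have n: "w \<notin> \<int>" if "w \<in> uhp" for w using that by (rule uhp_not_Ints)
  \<comment> \<open>The shift by pi \<i> makes the constant term fit the geometric series including
    n = 0; it disappears on differentiation.\<close>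
  have 0: "- (pcot w - of_real pi * \<i>) = ?c * S 0 w" if w: "w \<in> uhp" for w
  proof -
    have S0: "S 0 w = 1 / (1 - qpar w)" using suminf_geometric[OF norm_qpar_less_1[OF w]] by (simp add: S_def)
    have "1 - qpar w \<noteq> 0" using norm_qpar_less_1[OF w] by auto
    thus ?thesis unfolding pcot_uhp[OF w] S0 by (simp add: divide_simps) (simp add: algebra_simps)
  qed
  have "((\<lambda>w. - (pcot w - of_real pi * \<i>)) has_field_derivative psum 1 w) (at w)" if "w \<in> uhp" for w
    using DERIV_minus[OF DERIV_diff[OF pcot_deriv[OF n[OF that]] DERIV_const[of "of_real pi * \<i>"]]] by simp
  from step[OF _ 0 this] have 1: "psum 1 w = ?c^2 * S 1 w" if "w \<in> uhp" for w 
    using that by (simp add: power2_eq_square mult.assoc)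
  from step[OF _ 1 Polygamma_diff_deriv(2)[OF n]]
  have 2: "Polygamma 2 w - Polygamma 2 (1 - w) = ?c ^ 3 * S 2 w" if "w \<in> uhp" for w 
    using that by (simp add: numeral_2_eq_2 eval_nat_numeral mult_ac)
  from step[OF _ 2 Polygamma_diff_deriv(1)[OF n]]
  have 3: "psum 3 w = ?c ^ 4 * S 3 w" if "w \<in> uhp" for w 
    using that by (simp add: eval_nat_numeral mult_ac)
  from step[OF _ 3 Polygamma_diff_deriv(2)[OF n]]
  have 4: "Polygamma 4 w - Polygamma 4 (1 - w) = ?c ^ 5 * S 4 w" if "w \<in> uhp" for w 
    using that by (simp add: eval_nat_numeral mult_ac)
  from step[OF _ 4 Polygamma_diff_deriv(1)[OF n]]
  have 5: "psum 5 w = ?c ^ 6 * S 5 w" if "w \<in> uhp" for w 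
    using that by (simp add: eval_nat_numeral mult_ac)
  show "psum 1 z = ?c ^ 2 * (\<Sum>n. of_nat n ^ 1 * qpar z ^ n)"
    and "psum 3 z = ?c ^ 4 * (\<Sum>n. of_nat n ^ 3 * qpar z ^ n)"
    and "psum 5 z = ?c ^ 6 * (\<Sum>n. of_nat n ^ 5 * qpar z ^ n)"
    using 1[OF z] 3[OF z] 5[OF z] by (simp_all add: S_def)
qed

section \<open>Lattice sums and the transformation of Eisenstein series under \<open>z \<mapsto> -1/z\<close>\<close>

lemma summable_on_nonneg_product:
  fixes A :: "'a \<Rightarrow> real" and B :: "'b \<Rightarrow> real"
  assumes A: "A summable_on X" and B: "B summable_on Y"
    and nn: "\<And>x. x \<in> X \<Longrightarrow> A x \<ge> 0" "\<And>y. y \<in> Y \<Longrightarrow> B y \<ge> 0"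
  shows "(\<lambda>(x, y). A x * B y) summable_on X \<times> Y"
proof (rule summable_on_SigmaI)
  show "((\<lambda>y. case (x, y) of (x, y) \<Rightarrow> A x * B y) has_sum A x * infsum B Y) Y" for x
    using has_sum_cmult_right[OF has_sum_infsum[OF B]] by simp
  show "(\<lambda>x. A x * infsum B Y) summable_on X" by (intro summable_on_cmult_left A)
qed (use nn in auto)

definition eis_series :: "nat \<Rightarrow> complex \<Rightarrow> complex" where
  "eis_series k q = (\<Sum>n. of_nat (divisor_sigma k (Suc n)) * q ^ Suc n)"

text \<open>The double series of r^j q^(mr) is summed by rows, and again by the values n = mr, where
  r runs over the divisors of n.\<close>

lemma lambert_has_sum:
  fixes q :: complex
  assumes q: "norm q < 1" and j: "j > 0"
  shows "((\<lambda>m::nat. \<Sum>r. of_nat r ^ j * (q ^ m) ^ r) has_sum eis_series j q) {1..}"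
proof -
  define f where "f = (\<lambda>(m::nat, r::nat). of_nat r ^ j * q ^ (m * r) :: complex)"
  have "(\<lambda>m. norm q ^ m) summable_on UNIV"
    by (intro summable_nonneg_imp_summable_on summable_geometric) (use q in auto)
  hence "(\<lambda>m. norm q ^ m) summable_on (\<lambda>m. m - 1) ` {1..}" by (rule summable_on_subset_banach) auto
  hence A: "(\<lambda>m. norm q ^ (m - 1)) summable_on {1..}"
    by (subst (asm) summable_on_reindex) (auto simp: inj_on_def o_def)
  have "(\<lambda>r. norm (of_nat r ^ j * q ^ r)) summable_on UNIV"
    by (intro summable_nonneg_imp_summable_on summable_norm_power_geometric q) auto
  hence B: "(\<lambda>r. norm (of_nat r ^ j * q ^ r)) summable_on {1..}" by (rule summable_on_subset_banach) auto
  have "f summable_on {1..} \<times> {1..}"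
  proof (rule abs_summable_summable[OF Infinite_Sum.abs_summable_on_comparison_test'])
    \<comment> \<open>From mr >= (m - 1) + r for m, r >= 1: the majorant is a product of two
      convergent series.\<close>
    show "(\<lambda>(m, r). norm q ^ (m - 1) * norm (of_nat r ^ j * q ^ r)) summable_on {1..} \<times> {1..}"
      by (intro summable_on_nonneg_product A B) auto
    fix x :: "nat \<times> nat" assume "x \<in> {1..} \<times> {1..}"
    then obtain m r where x: "x = (Suc m, Suc r)" by (cases x) (auto simp: Suc_le_eq gr0_conv_Suc)
    have "norm (q ^ (Suc m * Suc r)) \<le> norm q ^ (m + Suc r)"
      unfolding norm_power by (intro power_decreasing) (use q in auto)
    hence "norm (of_nat (Suc r) ^ j * q ^ (Suc m * Suc r)) \<le> norm (of_nat (Suc r) ^ j :: complex) * norm q ^ (m + Suc r)"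
      unfolding norm_mult by (intro mult_left_mono) auto
    also have "\<dots> = norm q ^ m * norm (of_nat (Suc r) ^ j * q ^ Suc r)"
      by (simp add: norm_mult norm_power power_add)
    finally show "norm (f x) \<le> (case x of (m, r) \<Rightarrow> norm q ^ (m - 1) * norm (of_nat r ^ j * q ^ r))"
      by (simp only: f_def x prod.case diff_Suc_1)
  qed
  then obtain T where T: "(f has_sum T) ({1..} \<times> {1..})" by (auto simp: summable_on_def)
  have row: "((\<lambda>r. f (m, r)) has_sum (\<Sum>r. of_nat r ^ j * (q ^ m) ^ r)) {1..}" if m: "m \<in> {1..}" for m
  proof -
    have qm: "norm (q ^ m) < 1" unfolding norm_power using q m by (simp add: power_less_one_iff)
    have "((\<lambda>r. of_nat r ^ j * (q ^ m) ^ r) has_sum (\<Sum>r. of_nat r ^ j * (q ^ m) ^ r)) UNIV"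
      by (intro norm_summable_imp_has_sum summable_norm_power_geometric qm summable_sums summable_power_geometric)
    \<comment> \<open>The term r = 0 is zero because \<open>j > 0\<close>, so starting at 1 loses
      nothing.\<close>
    thus ?thesis
      by (rule has_sum_cong_neutral[THEN iffD1, rotated -1]) (use j in \<open>auto simp: f_def power_mult not_le\<close>)
  qed
  have rows: "((\<lambda>m::nat. \<Sum>r. of_nat r ^ j * (q ^ m) ^ r) has_sum T) {1..}"
    using has_sum_Sigma'[OF T row] by simp
  have "((\<lambda>(n, d). of_nat d ^ j * q ^ n) has_sum T) (SIGMA n:{1..}. {d. d dvd n})"
    using T
    by (rule has_sum_reindex_bij_witness[of _ "\<lambda>(n, d). (n div d, d)" "\<lambda>(m, r). (m * r, r)", THEN iffD1, rotated -1])
       (auto simp: f_def Suc_le_eq dvd_div_eq_0_iff intro!: Nat.gr0I)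
  hence "((\<lambda>n. of_nat (divisor_sigma j n) * q ^ n) has_sum T) {1..}"
  proof (rule has_sum_Sigma')
    fix n :: nat assume "n \<in> {1..}"
    hence "finite {d. d dvd n}" by (intro finite_divisors_nat) auto
    thus "((\<lambda>d. case (n, d) of (n, d) \<Rightarrow> of_nat d ^ j * q ^ n) has_sum of_nat (divisor_sigma j n) * q ^ n) {d. d dvd n}"
      by (intro has_sum_finiteI) (auto simp: divisor_sigma_def sum_distrib_right)
  qed
  hence "((\<lambda>n. of_nat (divisor_sigma j n) * q ^ n) has_sum T) (range Suc)"
    by (rule has_sum_cong_neutral[THEN iffD1, rotated -1]) (auto simp: image_iff Suc_le_eq gr0_conv_Suc)
  hence "((\<lambda>n. of_nat (divisor_sigma j (Suc n)) * q ^ Suc n) has_sum T) UNIV"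
    by (subst (asm) has_sum_reindex) (auto simp: o_def)
  from has_sum_imp_sums[OF this] have "eis_series j q = T" by (simp add: eis_series_def sums_iff)
  with rows show ?thesis by simp
qed

lemma qpar_mult_nat: "qpar (of_nat m * z) = qpar z ^ m"
proof -
  have "2 * of_real pi * \<i> * (of_nat m * z) = of_nat m * (2 * of_real pi * \<i> * z)" by simp
  thus ?thesis by (simp only: qpar_def exp_of_nat_mult)
qed

section \<open>Zeta values at 2, 4 and 6\<close>

definition zeta_sum :: "nat \<Rightarrow> complex" where
  "zeta_sum k = 2 * Polygamma k 1 / fact k"

text \<open>As \<open>Suc k\<close> is even, n and -n contribute equally; hence
  \<open>zeta_sum k\<close> is 2 zeta(k + 1).\<close>

lemma has_sum_zeta:
  assumes k: "odd k"
  shows "((\<lambda>n::int. 1 / of_int n ^ Suc k) has_sum zeta_sum k) (- {0})"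
proof -
  have k': "k > 0" using k by (cases k) auto
  have "(\<lambda>n. 1 / (1 + of_nat n) ^ Suc k) sums (Polygamma k 1 / fact k :: complex)"
    using Polygamma_LIMSEQ[of 1 k] k k' by (simp add: inverse_eq_divide)
  moreover have "((\<lambda>n::int. if n = 0 then 0 else 1 / of_int n ^ Suc k) has_sum (Polygamma k 1 / fact k + Polygamma k 1 / fact k :: complex)) UNIV"
  proof (rule has_sum_int_sums)
    have "(\<lambda>n::int. 1 / (0 + of_int n :: complex) ^ Suc k) summable_on UNIV"
      using k' by (intro summable_row) auto
    thus "(\<lambda>n::int. if n = 0 then 0 else 1 / of_int n ^ Suc k :: complex) summable_on UNIV"
      by (rule summable_on_cong[THEN iffD1, rotated]) (auto simp: k')
    have "(\<lambda>n. if int (Suc n) = 0 then 0 else 1 / of_int (int (Suc n)) ^ Suc k :: complex) sums (Polygamma k 1 / fact k)"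
      using calculation by (simp del: power_Suc)
    thus "(\<lambda>n. if int n = 0 then 0 else 1 / of_int (int n) ^ Suc k :: complex) sums (Polygamma k 1 / fact k)"
      by (subst (asm) sums_Suc_iff) simp
    have "1 / of_int (- 1 - int n) ^ Suc k = (1 / (1 + of_nat n) ^ Suc k :: complex)" for n
    proof -
      have "of_int (- 1 - int n) = - (1 + of_nat n :: complex)" by simp
      thus ?thesis using power_minus_even[of "Suc k" "1 + of_nat n :: complex"] k by (simp only: even_Suc simp_thms)
    qed
    thus "(\<lambda>n. if - 1 - int n = 0 then 0 else 1 / of_int (- 1 - int n) ^ Suc k :: complex) sums (Polygamma k 1 / fact k)"
      using calculation by (simp del: power_Suc of_int_diff)
  qed
  ultimately have "((\<lambda>n::int. if n = 0 then 0 else 1 / of_int n ^ Suc k) has_sum zeta_sum k) UNIV"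
    by (simp add: zeta_sum_def)
  thus ?thesis by (rule has_sum_cong_neutral[THEN iffD1, rotated -1]) auto
qed

text \<open>Splitting zeta(s) into odd and even denominators gives zeta(s, 1/2) = (2^s - 1) zeta(s).
  The values of \<open>psum\<close> at 1/2, where \<open>pcot\<close> vanishes, thus turn into zeta
  values.\<close>

lemma psum_half:
  assumes k: "odd k"
  shows "psum k (1/2) = (2 ^ Suc k - 1) * fact k * zeta_sum k"
proof -
  have k': "k > 0" using k by (cases k) auto
  have 1: "(\<lambda>n. 1 / (1 + of_nat n) ^ Suc k) sums (Polygamma k 1 / fact k :: complex)"
   and 2: "(\<lambda>n. 1 / (1/2 + of_nat n) ^ Suc k) sums (Polygamma k (1/2) / fact k :: complex)"
    using Polygamma_LIMSEQ[of 1 k] Polygamma_LIMSEQ[of "1/2" k] k k' by (simp_all add: inverse_eq_divide)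
  have *: "(\<Sum>i\<in>{n * 2..<n * 2 + 2}. 1 / (1 + of_nat i) ^ Suc k) = 
       1 / 2 ^ Suc k * (1 / (1/2 + of_nat n) ^ Suc k + 1 / (1 + of_nat n) ^ Suc k :: complex)" for n
  proof -
    have "{n * 2..<n * 2 + 2} = {2 * n, Suc (2 * n)}" by auto
    moreover have "1 + of_nat (2 * n) = 2 * (1/2 + of_nat n :: complex)" 
      "1 + of_nat (Suc (2 * n)) = 2 * (1 + of_nat n :: complex)" by simp_all
    ultimately have "(\<Sum>i\<in>{n * 2..<n * 2 + 2}. 1 / (1 + of_nat i) ^ Suc k) = 
       1 / (2 * (1/2 + of_nat n)) ^ Suc k + 1 / (2 * (1 + of_nat n :: complex)) ^ Suc k"
      by (simp del: power_Suc of_nat_Suc of_nat_mult)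
    thus ?thesis
      by (simp only: power_mult_distrib) (simp only: distrib_left[of "1 / 2 ^ Suc k"] times_divide_times_eq mult_1_left)
  qed
  have "(\<lambda>n. \<Sum>i\<in>{n * 2..<n * 2 + 2}. 1 / (1 + of_nat i) ^ Suc k) sums (Polygamma k 1 / fact k :: complex)"
    using sums_group[OF 1, of 2] by simp
  moreover have "(\<lambda>n. \<Sum>i\<in>{n * 2..<n * 2 + 2}. 1 / (1 + of_nat i) ^ Suc k) sums
      (1 / 2 ^ Suc k * (Polygamma k (1/2) / fact k + Polygamma k 1 / fact k :: complex))"
    unfolding * by (intro sums_mult sums_add 1 2)
  ultimately have "Polygamma k 1 / fact k = 1 / 2 ^ Suc k * (Polygamma k (1/2) / fact k + Polygamma k 1 / fact k :: complex)"
    by (rule sums_unique2)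
  hence "Polygamma k (1/2) = (2 ^ Suc k - 1) * (Polygamma k 1 :: complex)"
    by (simp add: field_simps)
  thus ?thesis by (simp add: psum_def zeta_sum_def)
qed

lemma zeta_sum_values:
  "zeta_sum 1 = of_real pi ^ 2 / 3" "zeta_sum 3 = of_real pi ^ 4 / 45" "zeta_sum 5 = 2 * of_real pi ^ 6 / 945"
proof -
  have half: "(1/2 :: complex) \<notin> \<int>" using fraction_not_in_Ints[where 'a = complex, of 2 1] by simp
  have z: "pcot (1/2) = 0" using pcot_eq[OF half] by (simp flip: of_real_divide cos_of_real add: mult.commute) 
  show "zeta_sum 1 = of_real pi ^ 2 / 3"
    using psum_half[of 1] psum_1[OF half] by (simp add: z field_simps)
  show "zeta_sum 3 = of_real pi ^ 4 / 45"
    using psum_half[of 3] psum_3[OF half] by (simp add: z fact_numeral)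
  show "zeta_sum 5 = 2 * of_real pi ^ 6 / 945"
    using psum_half[of 5] psum_5_half by (simp add: fact_numeral)
qed

text \<open>The index is one less than the weight w. For odd \<open>k\<close> the factor is (2 pi
  \<i>)^w / ((w - 1)! zeta(w)), the usual -2w/B_w, kept in the form in which the lattice sum
  produces it.\<close>

definition Eis :: "nat \<Rightarrow> complex \<Rightarrow> complex" where
  "Eis k z = 1 + 2 * (2 * of_real pi * \<i>) ^ Suc k / (fact k * zeta_sum k) * eis_series k (qpar z)"

lemma Eis_eq: "Eis 1 z = E2 z" "Eis 3 z = E4 z" "Eis 5 z = E6 z"
proof -
  have i: "\<i> ^ 2 = -1" "\<i> ^ 4 = 1" "\<i> ^ 6 = -1" by (simp_all add: eval_nat_numeral)
  have c: "2 * (2 * of_real pi * \<i>) ^ 2 / (fact 1 * zeta_sum 1) = -24"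
       "2 * (2 * of_real pi * \<i>) ^ 4 / (fact 3 * zeta_sum 3) = 240"
       "2 * (2 * of_real pi * \<i>) ^ 6 / (fact 5 * zeta_sum 5) = -504"
    unfolding zeta_sum_values power_mult_distrib i by (simp_all add: fact_numeral)
  have s: "Suc 1 = 2" "Suc 3 = 4" "Suc 5 = 6" by simp_all
  show "Eis 1 z = E2 z" "Eis 3 z = E4 z" "Eis 5 z = E6 z"
    unfolding Eis_def E2_def E4_def E6_def eis_series_def s c by simp_all
qed

text \<open>The rows m > 0 form a Lambert series, and the rows m and -m agree because
  \<open>psum\<close> is even; this is the factor 2 in \<open>Eis\<close>.\<close>

lemma has_sum_psum_multiples:
  assumes z: "z \<in> uhp" and k: "k \<in> {1, 3, 5}"
  shows "((\<lambda>m::int. psum k (of_int m * z) / fact k) has_sum zeta_sum k * (Eis k z - 1)) (- {0})"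
proof -
  have ok: "odd k" "k > 0" using k by auto
  have zk: "zeta_sum k \<noteq> 0" using k zeta_sum_values by auto
  let ?c = "(2 * of_real pi * \<i>) ^ Suc k / fact k :: complex"
  have "((\<lambda>m::nat. ?c * (\<Sum>r. of_nat r ^ k * (qpar z ^ m) ^ r)) has_sum ?c * eis_series k (qpar z)) {1..}"
    by (intro has_sum_cmult_right lambert_has_sum norm_qpar_less_1 z ok)
  also have "?this \<longleftrightarrow> ((\<lambda>m::nat. psum k (of_nat m * z) / fact k) has_sum ?c * eis_series k (qpar z)) {1..}"
  proof (rule has_sum_cong)
    fix m :: nat assume "m \<in> {1..}"
    hence mz: "of_nat m * z \<in> uhp" using z by (auto simp: uhp_def)
    show "?c * (\<Sum>r. of_nat r ^ k * (qpar z ^ m) ^ r) = psum k (of_nat m * z) / fact k"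
      using psum_qexp[OF mz] k by (auto simp: qpar_mult_nat numeral_2_eq_2[symmetric] simp del: power_Suc)
  qed
  finally have 1: "((\<lambda>m::nat. psum k (of_nat m * z) / fact k) has_sum ?c * eis_series k (qpar z)) {1..}" .
  have pos: "((\<lambda>m::int. psum k (of_int m * z) / fact k) has_sum ?c * eis_series k (qpar z)) {0<..}"
    using 1 by (rule has_sum_reindex_bij_witness[of _ nat int, THEN iffD1, rotated -1]) auto
  hence neg: "((\<lambda>m::int. psum k (of_int m * z) / fact k) has_sum ?c * eis_series k (qpar z)) {..<0}"
  proof (rule has_sum_reindex_bij_witness[of _ uminus uminus, THEN iffD1, rotated -1])
    fix m :: int assume "m \<in> {0<..}"
    hence "of_int m * z \<in> uhp" using z by (auto simp: uhp_def)
    thus "psum k (of_int (- m) * z) / fact k = psum k (of_int m * z) / fact k"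
      using psum_minus[OF uhp_not_Ints ok(1)] by simp
  qed auto
  have "{0<..} \<inter> {..<0 :: int} = {}" by auto
  note sum = has_sum_Un_disjoint[OF pos neg this]
  have "{0<..} \<union> {..<0} = - {0 :: int}" by auto
  moreover have "?c * eis_series k (qpar z) + ?c * eis_series k (qpar z) = zeta_sum k * (Eis k z - 1)"
    using zk by (simp add: Eis_def)
  ultimately show ?thesis using sum by (simp only:)
qed

lemma has_sum_diff:
  fixes f g :: "'a \<Rightarrow> complex"
  assumes "(f has_sum a) A" "(g has_sum b) A"
  shows "((\<lambda>x. f x - g x) has_sum (a - b)) A"
proof -
  have "((\<lambda>x. f x + - g x) has_sum (a + - b)) A"
    by (intro has_sum_add has_sum_uminusI assms)
  thus ?thesis by simp
qed

text \<open>The constant is determinant over trace of the quadratic form.\<close>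

lemma lattice_norm_lower_bound:
  assumes z: "z \<in> uhp"
  obtains \<delta> :: real where "\<delta> > 0" "\<And>m x :: real. \<delta> * (m\<^sup>2 + x\<^sup>2) \<le> (norm (of_real m * z + of_real x))\<^sup>2"
proof
  define a b where "a = Re z" and "b = Im z"
  have b: "b > 0" using z by (simp add: b_def uhp_def)
  have t: "1 + a\<^sup>2 + b\<^sup>2 > 0" by (simp add: add_pos_nonneg)
  show "b\<^sup>2 / (1 + a\<^sup>2 + b\<^sup>2) > 0" using b t by simp
  fix m x :: real
  have "(norm (of_real m * z + of_real x))\<^sup>2 = (m * a + x)\<^sup>2 + (m * b)\<^sup>2"
    by (simp add: cmod_power2 a_def b_def)
  moreover have "((m * a + x)\<^sup>2 + (m * b)\<^sup>2) * (1 + a\<^sup>2 + b\<^sup>2) - b\<^sup>2 * (m\<^sup>2 + x\<^sup>2) = 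
      ((a\<^sup>2 + b\<^sup>2) * m + a * x)\<^sup>2 + (a * m + x)\<^sup>2"
    by (simp add: power2_eq_square algebra_simps)
  moreover have "((a\<^sup>2 + b\<^sup>2) * m + a * x)\<^sup>2 + (a * m + x)\<^sup>2 \<ge> 0" by simp
  ultimately show "b\<^sup>2 / (1 + a\<^sup>2 + b\<^sup>2) * (m\<^sup>2 + x\<^sup>2) \<le> (norm (of_real m * z + of_real x))\<^sup>2"
    using t by (simp add: field_simps)
qed

lemma of_int_square_ge_1: "m \<noteq> 0 \<Longrightarrow> (of_int m)\<^sup>2 \<ge> (1 :: real)"
proof -
  assume "m \<noteq> 0"
  hence "\<bar>m\<bar> \<ge> 1" by simp
  hence "m\<^sup>2 \<ge> 1" by (metis abs_le_square_iff abs_1 one_power2)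
  thus ?thesis by (metis of_int_1 of_int_le_iff of_int_power)
qed

text \<open>Since m is nonzero, (1 + m^2)(1 + n^2) <= 2 (m^2 + n^2)^2, so inverse fourth powers of
  the distance are dominated by a product of two convergent series.\<close>

lemma summable_lattice:
  fixes f :: "int \<times> int \<Rightarrow> complex"
  assumes f: "\<And>m n. m \<noteq> 0 \<Longrightarrow> norm (f (m, n)) \<le> C / ((of_int m)\<^sup>2 + (of_int n)\<^sup>2)\<^sup>2"
  shows "f summable_on (- {0}) \<times> UNIV"
proof (rule abs_summable_summable[OF Infinite_Sum.abs_summable_on_comparison_test'])
  have s: "(\<lambda>n::int. 1 / (1 + (of_int n)\<^sup>2) :: real) summable_on UNIV"
  proof -
    have eq: "norm (1 / (\<i> + of_int n) ^ 2) = 1 / (1 + (of_int n)\<^sup>2)" for n :: int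
      by (simp add: norm_divide norm_power cmod_power2)
    show ?thesis using abs_summable_row[of 2 \<i>] unfolding eq by simp
  qed
  show "(\<lambda>(m, n). 2 * \<bar>C\<bar> * (1 / (1 + (of_int m)\<^sup>2)) * (1 / (1 + (of_int n)\<^sup>2))) summable_on (- {0 :: int}) \<times> (UNIV :: int set)"
    by (intro summable_on_nonneg_product summable_on_cmult_right s summable_on_subset_banach[OF s]) auto
  fix x :: "int \<times> int" assume "x \<in> (- {0}) \<times> UNIV"
  then obtain m n where x: "x = (m, n)" "m \<noteq> 0" by (cases x) auto
  define M N :: real where "M = (of_int m)\<^sup>2" and "N = (of_int n)\<^sup>2"
  have M: "M \<ge> 1" unfolding M_def by (rule of_int_square_ge_1[OF x(2)])
  have N: "N \<ge> 0" by (simp add: N_def)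
  have "(1 + M) * (1 + N) \<le> (2 * M) * (M + N)" using M N by (intro mult_mono) auto
  also have "\<dots> \<le> 2 * ((M + N) * (M + N))" using M N by (simp add: mult_right_mono)
  finally have le: "(1 + M) * (1 + N) \<le> 2 * (M + N)\<^sup>2" by (simp add: power2_eq_square)
  have "norm (f x) \<le> C / (M + N)\<^sup>2" using f[OF x(2), of n] by (simp add: x M_def N_def)
  also have "\<dots> \<le> \<bar>C\<bar> / (M + N)\<^sup>2" by (intro divide_right_mono) auto
  also have "\<dots> = 2 * \<bar>C\<bar> / (2 * (M + N)\<^sup>2)" by simp
  also have "\<dots> \<le> 2 * \<bar>C\<bar> / ((1 + M) * (1 + N))"
    using le M N by (intro divide_left_mono mult_pos_pos) auto
  finally show "norm (f x) \<le> (case x of (m, n) \<Rightarrow> 2 * \<bar>C\<bar> * (1 / (1 + (of_int m)\<^sup>2)) * (1 / (1 + (of_int n)\<^sup>2)))"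
    by (simp add: x M_def N_def)
qed

lemma lattice_point_not_Ints: "z \<in> uhp \<Longrightarrow> m \<noteq> 0 \<Longrightarrow> of_int m * z + of_real x \<notin> \<int>"
  by (auto elim!: Ints_cases simp: uhp_def complex_eq_iff)

lemma uhp_inverse: "z \<in> uhp \<Longrightarrow> - 1 / z \<in> uhp"
  by (auto simp: uhp_def Im_divide' zero_less_divide_iff) 

lemma Eis_rows:
  assumes z: "z \<in> uhp" and k: "k \<in> {1, 3, 5}" and m: "m \<noteq> 0"
  shows "((\<lambda>n::int. 1 / (of_int m * z + of_int n) ^ Suc k) has_sum psum k (of_int m * z) / fact k) UNIV"
  using has_sum_row[of "of_int m * z" k] lattice_point_not_Ints[OF z m, of 0] k by auto

text \<open>Taking z out of mz + n turns the column of n into a row for the point n/z, so the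
  columns together form the Eisenstein series at -1/z. As m = 0 is omitted, each column n \<noteq> 0
  loses 1/n^(k+1), and the column n = 0 is a zeta value by itself.\<close>

lemma Eis_columns:
  assumes z: "z \<in> uhp" and k: "k \<in> {1, 3, 5}"
  obtains V where "\<And>n. ((\<lambda>m::int. 1 / (of_int m * z + of_int n) ^ Suc k) has_sum V n) (- {0})"
    "(V has_sum zeta_sum k * (Eis k (- 1 / z) / z ^ Suc k - 1)) UNIV"
proof
  define U where "U = (\<lambda>n::int. psum k (of_int n / z) / fact k / z ^ Suc k)"
  define V where "V = (\<lambda>n. if n = 0 then zeta_sum k / z ^ Suc k else U n - 1 / of_int n ^ Suc k)"
  have ok: "odd k" "k > 0" using k by auto
  have z0: "z \<noteq> 0" using z by (auto simp: uhp_def)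
  have w: "- 1 / z \<in> uhp" by (rule uhp_inverse[OF z])
  have nz: "of_int n / z \<notin> \<int>" if "n \<noteq> 0" for n
    using lattice_point_not_Ints[OF w, of "-n" 0] that by simp
  show "((\<lambda>m::int. 1 / (of_int m * z + of_int n) ^ Suc k) has_sum V n) (- {0})" for n
  proof (cases "n = 0")
    case True
    have "((\<lambda>m::int. 1 / of_int m ^ Suc k * (1 / z ^ Suc k)) has_sum zeta_sum k * (1 / z ^ Suc k)) (- {0})"
      by (intro has_sum_cmult_left has_sum_zeta ok)
    thus ?thesis using True by (simp add: V_def power_mult_distrib del: power_Suc)
  next
    case False
    have "((\<lambda>m::int. 1 / (of_int n / z + of_int m) ^ Suc k * (1 / z ^ Suc k)) has_sum psum k (of_int n / z) / fact k * (1 / z ^ Suc k)) UNIV"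
      by (intro has_sum_cmult_left has_sum_row ok nz False)
    moreover have "1 / (of_int n / z + of_int m) ^ Suc k * (1 / z ^ Suc k) = 1 / (of_int m * z + of_int n) ^ Suc k" for m
    proof -
      have "(of_int n / z + of_int m) * z = of_int m * z + of_int n" using z0 by (simp add: field_simps)
      thus ?thesis by (metis mult_1 power_mult_distrib times_divide_times_eq)
    qed
    ultimately have U: "((\<lambda>m::int. 1 / (of_int m * z + of_int n) ^ Suc k) has_sum U n) UNIV"
      by (simp add: U_def)
    moreover have "((\<lambda>m::int. 1 / (of_int m * z + of_int n) ^ Suc k) has_sum 1 / of_int n ^ Suc k) {0}"
      by (rule has_sum_finiteI) auto
    ultimately have "((\<lambda>m::int. 1 / (of_int m * z + of_int n) ^ Suc k) has_sum U n - 1 / of_int n ^ Suc k) (UNIV - {0})"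
      by (rule has_sum_Diff) auto
    thus ?thesis using False by (simp add: V_def Compl_eq_Diff_UNIV)
  qed
  have "((\<lambda>m::int. psum k (of_int m * (- 1 / z)) / fact k * (1 / z ^ Suc k)) has_sum zeta_sum k * (Eis k (- 1 / z) - 1) * (1 / z ^ Suc k)) (- {0})"
    by (intro has_sum_cmult_left has_sum_psum_multiples w k)
  hence "(U has_sum zeta_sum k * (Eis k (- 1 / z) - 1) * (1 / z ^ Suc k)) (- {0})"
  proof (rule has_sum_cong[THEN iffD1, rotated])
    fix m :: int assume "m \<in> - {0}"
    thus "psum k (of_int m * (- 1 / z)) / fact k * (1 / z ^ Suc k) = U m"
      using psum_minus[OF nz ok(1), of m] by (simp add: U_def)
  qed
  hence "((\<lambda>n. U n + - (1 / of_int n ^ Suc k)) has_sum zeta_sum k * (Eis k (- 1 / z) - 1) * (1 / z ^ Suc k) + - zeta_sum k) (- {0})"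
    by (intro has_sum_add has_sum_uminusI has_sum_zeta ok)
  hence "(V has_sum zeta_sum k * (Eis k (- 1 / z) - 1) * (1 / z ^ Suc k) + - zeta_sum k) (- {0})"
    by (rule has_sum_cong[THEN iffD1, rotated -1]) (auto simp: V_def)
  hence "(V has_sum V 0 + (zeta_sum k * (Eis k (- 1 / z) - 1) * (1 / z ^ Suc k) + - zeta_sum k)) (insert 0 (- {0}))"
    by (intro has_sum_insert) auto
  moreover have "V 0 + (zeta_sum k * (Eis k (- 1 / z) - 1) * (1 / z ^ Suc k) + - zeta_sum k) = zeta_sum k * (Eis k (- 1 / z) / z ^ Suc k - 1)"
    by (simp add: V_def algebra_simps diff_divide_distrib del: power_Suc)
  moreover have "insert 0 (- {0 :: int}) = UNIV" by auto
  ultimately show "(V has_sum zeta_sum k * (Eis k (- 1 / z) / z ^ Suc k - 1)) UNIV" by simp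
qed

text \<open>In weights 4 and 6 the lattice sum converges absolutely and may be summed by rows or by
  columns. The row m = 0 is left out of both, so the same constant is subtracted on either
  side.\<close>

lemma Eis_S_abs:
  assumes z: "z \<in> uhp" and k: "k \<in> {3, 5}"
  shows "Eis k (- 1 / z) = z ^ Suc k * Eis k z"
proof -
  have k': "k \<in> {1, 3, 5}" using k by auto
  have z0: "z \<noteq> 0" using z by (auto simp: uhp_def)
  have zk: "zeta_sum k \<noteq> 0" using k zeta_sum_values by auto
  define f where "f = (\<lambda>(m::int, n::int). 1 / (of_int m * z + of_int n) ^ Suc k)"
  obtain \<delta> where \<delta>: "\<delta> > 0" "\<And>m x :: real. \<delta> * (m\<^sup>2 + x\<^sup>2) \<le> (norm (of_real m * z + of_real x))\<^sup>2"
    using lattice_norm_lower_bound[OF z] by blast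
  have "f summable_on (- {0}) \<times> UNIV"
  proof (rule summable_lattice)
    fix m n :: int assume m: "m \<noteq> 0"
    define R :: real where "R = (of_int m)\<^sup>2 + (of_int n)\<^sup>2"
    \<comment> \<open>This lets R^h with h = 2 or h = 3 be bounded below by R^2, which serves both
      weights.\<close>
    have R: "R \<ge> 1" using of_int_square_ge_1[OF m] by (simp add: R_def add_increasing2)
    define h where "h = Suc k div 2"
    have h: "Suc k = 2 * h" "h \<ge> 2" using k by (auto simp: h_def)
    have "\<delta> ^ h * R\<^sup>2 \<le> \<delta> ^ h * R ^ h" using \<delta>(1) R h by (intro mult_left_mono power_increasing) auto
    also have "\<dots> = (\<delta> * R) ^ h" by (simp add: power_mult_distrib)
    also have "\<dots> \<le> ((norm (of_int m * z + of_int n))\<^sup>2) ^ h"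
      using \<delta>(2)[of "of_int m" "of_int n"] \<delta>(1) R by (intro power_mono) (auto simp: R_def)
    also have "\<dots> = norm (of_int m * z + of_int n) ^ Suc k" by (simp only: h power_mult)
    finally have "1 / norm (of_int m * z + of_int n) ^ Suc k \<le> 1 / (\<delta> ^ h * R\<^sup>2)"
      using \<delta>(1) R by (intro divide_left_mono mult_pos_pos) (auto intro: order_less_le_trans[of _ "\<delta> ^ h * R\<^sup>2"])
    thus "norm (f (m, n)) \<le> (1 / \<delta> ^ h) / ((of_int m)\<^sup>2 + (of_int n)\<^sup>2)\<^sup>2"
      by (simp add: f_def norm_divide norm_power R_def[symmetric] del: power_Suc)
  qed
  then obtain T where T: "(f has_sum T) ((- {0}) \<times> UNIV)" by (auto simp: summable_on_def)
  have "((\<lambda>m. psum k (of_int m * z) / fact k) has_sum T) (- {0})"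
    by (rule has_sum_Sigma'[OF T]) (use Eis_rows[OF z k'] in \<open>auto simp: f_def\<close>)
  from has_sum_unique[OF this has_sum_psum_multiples[OF z k']] have 1: "T = zeta_sum k * (Eis k z - 1)" .
  obtain V where V: "\<And>n. ((\<lambda>m::int. 1 / (of_int m * z + of_int n) ^ Suc k) has_sum V n) (- {0})"
    "(V has_sum zeta_sum k * (Eis k (- 1 / z) / z ^ Suc k - 1)) UNIV"
    using Eis_columns[OF z k'] by blast
  have "((\<lambda>(n, m). f (m, n)) has_sum T) (UNIV \<times> (- {0}))" using T by (subst (asm) has_sum_swap)
  hence "(V has_sum T) UNIV"
    by (rule has_sum_Sigma') (use V(1) in \<open>auto simp: f_def\<close>)
  from has_sum_unique[OF this V(2)] 1 zk have "Eis k z - 1 = Eis k (- 1 / z) / z ^ Suc k - 1" by simp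
  hence "Eis k (- 1 / z) / z ^ Suc k = Eis k z" by simp
  thus ?thesis using z0 by (simp add: field_simps)
qed

text \<open>Along a ray in \<open>uhp\<close> the parameter q tends to 0, and the cotangent tends to
  -\<i>.\<close>

lemma pcot_limit_vertical:
  assumes w: "w \<in> uhp" and c: "c > 0"
  shows "(\<lambda>N. pcot (of_real (real N + c) * w)) \<longlonglongrightarrow> - (of_real pi * \<i>)"
proof -
  have "qpar (of_real (real N + c) * w) = qpar w ^ N * qpar (of_real c * w)" for N
  proof -
    have "qpar (of_real (real N + c) * w) = qpar (of_nat N * w) * qpar (of_real c * w)"
      by (simp add: qpar_def ring_distribs exp_add)
    thus ?thesis by (simp only: qpar_mult_nat)
  qed
  hence q: "(\<lambda>N. qpar (of_real (real N + c) * w)) \<longlonglongrightarrow> 0"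
    using LIMSEQ_power_zero[OF norm_qpar_less_1[OF w]] by (simp add: tendsto_mult_left_zero)
  have "(\<lambda>N. - (of_real pi * \<i>) * (1 + qpar (of_real (real N + c) * w)) / (1 - qpar (of_real (real N + c) * w)))
      \<longlonglongrightarrow> - (of_real pi * \<i>) * (1 + 0) / (1 - 0)"
    by (intro tendsto_intros q) auto
  moreover have "of_real (real N + c) * w \<in> uhp" for N 
    using w c by (auto simp: uhp_def intro!: mult_pos_pos add_nonneg_pos)
  ultimately show ?thesis by (simp add: pcot_uhp)
qed

text \<open>For weight 2 the double series converges only conditionally. Subtracting
  \<open>b = 1/((mz + n)\<^sup>2 - 1/4)\<close>, which telescopes in \<open>n\<close>, makes it absolutely convergent; the two
  iterated sums of \<open>b\<close> are \<open>0\<close> and \<open>-2\<pi>i/z\<close>, and their difference is the anomaly of \<open>E\<^sub>2\<close>.\<close>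

lemma Eis_S_1:
  assumes z: "z \<in> uhp"
  shows "Eis 1 (- 1 / z) = z ^ 2 * Eis 1 z + 6 * z / (of_real pi * \<i>)"
proof -
  have k: "1 \<in> {1, 3, 5 :: nat}" by simp
  have z0: "z \<noteq> 0" using z by (auto simp: uhp_def)
  have w: "- 1 / z \<in> uhp" by (rule uhp_inverse[OF z])
  define f where "f = (\<lambda>(m::int, n::int). 1 / (of_int m * z + of_int n) ^ Suc 1)"
  define b where "b = (\<lambda>(m::int, n::int). 1 / (of_int m * z + of_real (of_int n - 1/2)) - 1 / (of_int m * z + of_real (of_int n + 1/2)))"
  obtain \<delta> where \<delta>: "\<delta> > 0" "\<And>m x :: real. \<delta> * (m\<^sup>2 + x\<^sup>2) \<le> (norm (of_real m * z + of_real x))\<^sup>2"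
    using lattice_norm_lower_bound[OF z] by blast
  have "(\<lambda>x. f x - b x) summable_on (- {0}) \<times> UNIV"
  proof (rule summable_lattice)
    fix m n :: int assume m: "m \<noteq> 0"
    define R :: real where "R = (of_int m)\<^sup>2 + (of_int n)\<^sup>2"
    note m1 = of_int_square_ge_1[OF m]
    hence R: "R > 0" using zero_le_power2[of "real_of_int n"] unfolding R_def by linarith
    define u where "u = of_int m * z + of_int n"
    \<comment> \<open>Moving n by 1/2 or -1/2 costs at most a factor 4 because m^2 >= 1; the square
      below is chosen to show this.\<close>
    have sh: "norm (of_int m * z + of_real (of_int n + s)) ^ 2 \<ge> \<delta> * (R / 4)" if "s\<^sup>2 = 1/4" for s
    proof -
      have "0 \<le> (3 * of_int n / 2 + 2 * s)\<^sup>2" by simp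
      hence "9 / 4 * (of_int n)\<^sup>2 + 6 * (of_int n * s) + 1 \<ge> 0"
        using that by (simp add: power2_eq_square algebra_simps)
      hence "R / 4 \<le> (of_int m)\<^sup>2 + (of_int n + s)\<^sup>2"
        using m1 that unfolding R_def by (simp add: power2_eq_square algebra_simps)
      hence "\<delta> * (R / 4) \<le> \<delta> * ((of_int m)\<^sup>2 + (of_int n + s)\<^sup>2)" using \<delta>(1) by (intro mult_left_mono) auto
      also have "\<dots> \<le> norm (of_int m * z + of_real (of_int n + s)) ^ 2"
        using \<delta>(2)[of "of_int m" "of_int n + s"] by simp
      finally show ?thesis .
    qed
    have nz: "u \<noteq> 0" "u - 1/2 \<noteq> 0" "u + 1/2 \<noteq> 0"
      using z m by (auto simp: u_def uhp_def complex_eq_iff)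
    have eq: "of_int m * z + of_real (of_int n - 1/2) = u - 1/2" "of_int m * z + of_real (of_int n + 1/2) = u + 1/2"
      by (simp_all add: u_def)
    \<comment> \<open>The parts of size u^-2 cancel, and what is left has size u^-4.\<close>
    have eq2: "f (m, n) - b (m, n) = - 1 / (4 * (u\<^sup>2 * ((u - 1/2) * (u + 1/2))))"
      using nz unfolding f_def b_def prod.case eq u_def[symmetric] 
      by (simp add: divide_simps power2_eq_square) (simp add: algebra_simps)
    have i1: "\<delta> * R \<le> (norm u)\<^sup>2" using \<delta>(2)[of "of_int m" "of_int n"] by (simp add: R_def u_def)
    have "(\<delta> * (R / 4))\<^sup>2 \<le> (norm (u - 1/2))\<^sup>2 * (norm (u + 1/2))\<^sup>2"
      unfolding power2_eq_square[of "\<delta> * (R / 4)"] using \<delta>(1) R sh[of "-1/2"] sh[of "1/2"]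
      by (intro mult_mono) (auto simp: u_def power2_eq_square algebra_simps)
    hence "(\<delta> * (R / 4))\<^sup>2 \<le> (norm (u - 1/2) * norm (u + 1/2))\<^sup>2" by (simp add: power_mult_distrib)
    hence i2: "\<delta> * (R / 4) \<le> norm (u - 1/2) * norm (u + 1/2)" by (rule power2_le_imp_le) simp
    have i3: "4 * ((\<delta> * R) * (\<delta> * (R / 4))) \<le> 4 * ((norm u)\<^sup>2 * (norm (u - 1/2) * norm (u + 1/2)))"
      by (intro mult_left_mono mult_mono[OF i1 i2]) (use \<delta>(1) R in auto)
    from eq2 have "norm (f (m, n) - b (m, n)) = 1 / (4 * ((norm u)\<^sup>2 * (norm (u - 1/2) * norm (u + 1/2))))"
      by (simp add: norm_divide norm_mult norm_power)
    also have "\<dots> \<le> 1 / (4 * ((\<delta> * R) * (\<delta> * (R / 4))))"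
      using i3 \<delta>(1) R nz by (intro divide_left_mono) auto
    also have "\<dots> = (1 / \<delta>\<^sup>2) / R\<^sup>2" by (simp add: power2_eq_square)
    finally show "norm (f (m, n) - b (m, n)) \<le> (1 / \<delta>\<^sup>2) / ((of_int m)\<^sup>2 + (of_int n)\<^sup>2)\<^sup>2"
      by (simp add: R_def)
  qed
  then obtain T where T: "((\<lambda>x. f x - b x) has_sum T) ((- {0}) \<times> UNIV)" by (auto simp: summable_on_def)
  \<comment> \<open>The two arguments of \<open>pcot\<close> differ by 1, which is a period.\<close>
  have rowb: "((\<lambda>n. b (m, n)) has_sum 0) UNIV" if m: "m \<noteq> 0" for m
  proof -
    have nI: "of_int m * z - 1/2 \<notin> \<int>" "of_int m * z + 1/2 \<notin> \<int>"
      using lattice_point_not_Ints[OF z m, of "-1/2"] lattice_point_not_Ints[OF z m, of "1/2"] by simp_all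
    have "pcot (of_int m * z + 1/2) = pcot (of_int m * z - 1/2)"
      using pcot_plus_int[OF nI(1), of 1] by (simp add: add.commute)
    thus ?thesis using has_sum_pcot[OF nI] by (simp add: b_def algebra_simps)
  qed
  have "((\<lambda>m. psum 1 (of_int m * z) / fact 1 - 0) has_sum T) (- {0})"
  proof (rule has_sum_Sigma'[OF T])
    fix m :: int assume "m \<in> - {0}"
    thus "((\<lambda>n. f (m, n) - b (m, n)) has_sum psum 1 (of_int m * z) / fact 1 - 0) UNIV"
      using has_sum_diff[OF Eis_rows[OF z k] rowb, of m] by (simp add: f_def)
  qed
  from has_sum_unique[OF this] has_sum_psum_multiples[OF z k] have 1: "T = zeta_sum 1 * (Eis 1 z - 1)" by simp
  obtain V where V: "\<And>n. ((\<lambda>m::int. 1 / (of_int m * z + of_int n) ^ Suc 1) has_sum V n) (- {0})"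
    "(V has_sum zeta_sum 1 * (Eis 1 (- 1 / z) / z ^ Suc 1 - 1)) UNIV"
    using Eis_columns[OF z k] by blast
  \<comment> \<open>\<open>C (n - 1/2) - C (n + 1/2)\<close> is the sum of \<open>b\<close> over m
    \<noteq> 0; the summand -1/x takes away the term m = 0.\<close>
  define C where "C = (\<lambda>x::real. pcot (of_real x / z) / z - 1 / of_real x)"
  define B where "B = (\<lambda>n::int. C (of_int n - 1/2) - C (of_int (n + 1) - 1/2))"
  have nz: "of_real x / z \<notin> \<int>" if "x \<noteq> 0" for x
  proof
    assume "of_real x / z \<in> \<int>"
    then obtain i where "of_real x / z = of_int i" by (auto elim: Ints_cases)
    hence "of_real x = of_int i * z" using z0 by (simp add: field_simps)
    thus False using z that by (auto simp: complex_eq_iff uhp_def)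
  qed
  have half: "of_int n - 1/2 \<noteq> (0 :: real)" "of_int n + 1/2 \<noteq> (0 :: real)" for n
  proof -
    have "2 * n \<noteq> 1" "2 * n \<noteq> -1" by presburger+
    hence "of_int (2 * n) \<noteq> (of_int 1 :: real)" "of_int (2 * n) \<noteq> (of_int (-1) :: real)"
      by (simp_all only: of_int_eq_iff not_False_eq_True)
    thus "of_int n - 1/2 \<noteq> (0 :: real)" "of_int n + 1/2 \<noteq> (0 :: real)"
      unfolding of_int_mult of_int_numeral of_int_1 of_int_minus by linarith+
  qed
  have colb: "((\<lambda>m. b (m, n)) has_sum B n) (- {0})" for n
  proof -
    define x y :: real where "x = of_int n - 1/2" and "y = of_int n + 1/2"
    have "((\<lambda>m::int. (1 / (of_real x / z + of_int m) - 1 / (of_real y / z + of_int m)) * (1 / z)) has_sum 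
        (pcot (of_real x / z) - pcot (of_real y / z)) * (1 / z)) UNIV"
      unfolding x_def y_def by (intro has_sum_cmult_left has_sum_pcot nz half)
    moreover have "(1 / (of_real x / z + of_int m) - 1 / (of_real y / z + of_int m)) * (1 / z) = b (m, n)" for m
    proof -
      have *: "1 / (of_real t / z + of_int m) * (1 / z) = 1 / (of_int m * z + of_real t)" for t
      proof -
        have "(of_real t / z + of_int m) * z = of_int m * z + of_real t" using z0 by (simp add: field_simps)
        thus ?thesis by (metis mult_1 times_divide_times_eq)
      qed
      show ?thesis unfolding left_diff_distrib * by (simp add: b_def x_def y_def)
    qed
    ultimately have "((\<lambda>m. b (m, n)) has_sum (pcot (of_real x / z) - pcot (of_real y / z)) * (1 / z)) UNIV"
      by simp
    moreover have "((\<lambda>m. b (m, n)) has_sum 1 / of_real x - 1 / of_real y) {0}"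
      by (rule has_sum_finiteI) (auto simp: b_def x_def y_def)
    ultimately have "((\<lambda>m. b (m, n)) has_sum (pcot (of_real x / z) - pcot (of_real y / z)) * (1 / z) - (1 / of_real x - 1 / of_real y)) (UNIV - {0})"
      by (rule has_sum_Diff) auto
    moreover have "(pcot (of_real x / z) - pcot (of_real y / z)) * (1 / z) - (1 / of_real x - 1 / of_real y) = C x - C y"
      by (simp add: C_def algebra_simps diff_divide_distrib)
    moreover have "of_int (n + 1) - 1/2 = y" by (simp add: y_def)
    ultimately show ?thesis by (simp add: B_def x_def Compl_eq_Diff_UNIV)
  qed
  have "((\<lambda>(n, m). f (m, n) - b (m, n)) has_sum T) (UNIV \<times> (- {0}))" using T by (subst (asm) has_sum_swap)
  hence VB: "((\<lambda>n. V n - B n) has_sum T) UNIV"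
  proof (rule has_sum_Sigma')
    fix n :: int
    show "((\<lambda>m. case (n, m) of (n, m) \<Rightarrow> f (m, n) - b (m, n)) has_sum V n - B n) (- {0})"
      using has_sum_diff[OF V(1)[of n] colb[of n]] by (simp add: f_def)
  qed
  have B1: "(B has_sum zeta_sum 1 * (Eis 1 (- 1 / z) / z ^ Suc 1 - 1) - T) UNIV"
    using has_sum_diff[OF V(2) VB] by simp
  have C_odd: "C (- x) = - C x" if "x \<noteq> 0" for x
    using pcot_minus[OF nz[OF that]] by (simp add: C_def)
  \<comment> \<open>For x > 0 the point x/z lies in the lower half plane, hence the sign opposite to
    the limit in \<open>uhp\<close>.\<close>
  have lim: "(\<lambda>N. C (real N + c)) \<longlonglongrightarrow> of_real pi * \<i> / z" if c: "c > 0" for c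
  proof -
    have "pcot (of_real (real N + c) / z) = - pcot (of_real (real N + c) * (- 1 / z))" for N
      using pcot_minus[OF nz, of "real N + c"] c by simp
    moreover have "(\<lambda>N. - pcot (of_real (real N + c) * (- 1 / z)) / z - 1 / of_real (real N + c)) \<longlonglongrightarrow> - (- (of_real pi * \<i>)) / z - 0"
    proof (intro tendsto_intros pcot_limit_vertical w c z0)
      have "filterlim (\<lambda>N. real N + c) at_top sequentially"
        using filterlim_tendsto_add_at_top[OF tendsto_const filterlim_real_sequentially, of c] by (simp add: add.commute)
      from tendsto_inverse_0_at_top[OF this] have "(\<lambda>N. 1 / (real N + c)) \<longlonglongrightarrow> 0" by (simp add: inverse_eq_divide)
      from tendsto_of_real[OF this, where 'a = complex] show "(\<lambda>N. 1 / of_real (real N + c) :: complex) \<longlonglongrightarrow> 0" by simp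
    qed
    ultimately show ?thesis by (simp add: C_def)
  qed
  have "(B has_sum - (of_real pi * \<i> / z) - of_real pi * \<i> / z) UNIV"
    unfolding B_def
  proof (rule has_sum_telescope_int)
    show "(\<lambda>n. C (of_int n - 1/2) - C (of_int (n + 1) - 1/2)) summable_on UNIV"
      using has_sum_imp_summable[OF B1] by (simp add: B_def)
    have "C (of_int (- int N) - 1/2) = - C (real N + 1/2)" for N
      using C_odd[of "real N + 1/2"] by (simp add: algebra_simps)
    thus "(\<lambda>N. C (of_int (- int N) - 1/2)) \<longlonglongrightarrow> - (of_real pi * \<i> / z)"
      using tendsto_minus[OF lim[of "1/2"]] by simp
    have "C (of_int (int (Suc N)) - 1/2) = C (real N + 1/2)" for N by (simp add: algebra_simps)
    hence "(\<lambda>N. C (of_int (int (Suc N)) - 1/2)) \<longlonglongrightarrow> of_real pi * \<i> / z"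
      using lim[of "1/2"] by simp
    thus "(\<lambda>N. C (of_int (int N) - 1/2)) \<longlonglongrightarrow> of_real pi * \<i> / z" by (rule LIMSEQ_imp_Suc)
  qed
  note uniq = has_sum_unique[OF B1 this]
  have "zeta_sum 1 * (Eis 1 (- 1 / z) / z ^ Suc 1 - Eis 1 z) = zeta_sum 1 * (Eis 1 (- 1 / z) / z ^ Suc 1 - 1) - T"
    unfolding 1 by (simp only: right_diff_distrib) simp
  also have "\<dots> = - 2 * (of_real pi * \<i>) / z" unfolding uniq by simp
  finally have eq: "of_real pi ^ 2 / 3 * (Eis 1 (- 1 / z) / z ^ 2 - Eis 1 z) = - 2 * (of_real pi * \<i>) / z"
    unfolding zeta_sum_values Suc_1 .
  have "of_real pi ^ 2 * (Eis 1 (- 1 / z) - z ^ 2 * Eis 1 z) = - 6 * (of_real pi * \<i>) * z"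
  proof -
    have "of_real pi ^ 2 * (Eis 1 (- 1 / z) - z ^ 2 * Eis 1 z) = 
        3 * z ^ 2 * (of_real pi ^ 2 / 3 * (Eis 1 (- 1 / z) / z ^ 2 - Eis 1 z))"
      using z0 by (simp add: right_diff_distrib)
    also have "\<dots> = - 6 * (of_real pi * \<i>) * z"
      unfolding eq using z0 by (simp add: power2_eq_square)
    finally show ?thesis .
  qed
  hence "Eis 1 (- 1 / z) - z ^ 2 * Eis 1 z = - 6 * (of_real pi * \<i>) * z / of_real pi ^ 2"
    by (simp add: field_simps)
  also have "\<dots> = 6 * z / (of_real pi * \<i>)" by (simp add: field_simps power2_eq_square)
  finally show ?thesis by (simp add: algebra_simps)
qed

lemma E2_S: "z \<in> uhp \<Longrightarrow> E2 (- 1 / z) = z ^ 2 * E2 z + 6 * z / (of_real pi * \<i>)"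
  using Eis_S_1[of z] by (simp only: Eis_eq)

lemma E4_S: "z \<in> uhp \<Longrightarrow> E4 (- 1 / z) = z ^ 4 * E4 z"
  using Eis_S_abs[of z 3] by (simp add: Eis_eq del: power_Suc)

lemma E6_S: "z \<in> uhp \<Longrightarrow> E6 (- 1 / z) = z ^ 6 * E6 z"
  using Eis_S_abs[of z 5] by (simp add: Eis_eq del: power_Suc)

section \<open>Modular forms and expansions at the cusp\<close>

lemma open_uhp: "open uhp"
  unfolding uhp_def by (rule open_halfspace_Im_gt)

lemma convex_uhp: "convex uhp"
  unfolding uhp_def by (rule convex_halfspace_Im_gt)

lemma uhp_nonzero: "z \<in> uhp \<Longrightarrow> z \<noteq> 0"
  by (auto simp: uhp_def)

lemma uhp_shift: "z + of_int n \<in> uhp \<longleftrightarrow> z \<in> uhp" "z + 1 \<in> uhp \<longleftrightarrow> z \<in> uhp"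
  by (auto simp: uhp_def)

lemma qpar_shift: "qpar (z + of_int n) = qpar z" "qpar (z + 1) = qpar z"
proof -
  show "qpar (z + of_int n) = qpar z" for n
    unfolding qpar_def exp_eq by (intro exI[of _ n]) (simp add: algebra_simps)
  from this[of 1] show "qpar (z + 1) = qpar z" by simp
qed

lemma uhp_periodic_int:
  assumes T: "\<And>z. z \<in> uhp \<Longrightarrow> f (z + 1) = f z" and z: "z \<in> uhp"
  shows "f (z + of_int n) = f z"
proof -
  have nat: "f (z + of_nat n) = f z" if "z \<in> uhp" for z n
  proof (induction n)
    case (Suc n)
    have "z + of_nat n \<in> uhp" using that by (simp add: uhp_def)
    from T[OF this] Suc show ?case by (simp add: add_ac)
  qed simp
  show ?thesis
  proof (cases n rule: int_cases)
    case (nonneg k)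
    thus ?thesis using nat[OF z] by simp
  next
    case (neg k)
    have "z + of_int n \<in> uhp" using z by (simp add: uhp_def)
    from nat[OF this, of "Suc k"] show ?thesis by (simp add: neg)
  qed
qed

text \<open>All weights that occur are even and are halved: \<open>mf i\<close> is the space of modular forms of weight \<open>2i\<close>.\<close>

definition mf :: "nat \<Rightarrow> (complex \<Rightarrow> complex) \<Rightarrow> bool" where
  "mf i f \<longleftrightarrow> modular_form (2 * i) f"

lemma mf_T: "mf i f \<Longrightarrow> z \<in> uhp \<Longrightarrow> f (z + 1) = f z"
  unfolding mf_def modular_form_def
  by (elim conjE allE[of _ 1] allE[of _ 1] allE[of _ 0] allE[of _ 1]) simp

lemma mf_S: "mf i f \<Longrightarrow> z \<in> uhp \<Longrightarrow> f (- 1 / z) = z ^ (2 * i) * f z"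
  unfolding mf_def modular_form_def
  by (elim conjE allE[of _ 0] allE[of _ "-1"] allE[of _ 1] allE[of _ 0]) simp

lemma mf_holomorphic: "mf i f \<Longrightarrow> f holomorphic_on uhp"
  by (simp add: mf_def modular_form_def)

text \<open>\<open>SL(2,\<int>)\<close> is generated by \<open>S\<close> and \<open>T\<close>: Euclid's algorithm on the lower row.\<close>

lemma mfI:
  assumes hol: "f holomorphic_on uhp"
    and T: "\<And>z. z \<in> uhp \<Longrightarrow> f (z + 1) = f z"
    and S: "\<And>z. z \<in> uhp \<Longrightarrow> f (- 1 / z) = z ^ (2 * i) * f z"
    and bd: "\<exists>B. \<forall>z. Im z \<ge> 1 \<longrightarrow> norm (f z) \<le> B"
  shows "mf i f"
proof -
  have Ti: "f (z + of_int n) = f z" if "z \<in> uhp" for z n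
    by (rule uhp_periodic_int[where f = f, OF _ that]) (rule T)
  have "f ((of_int a * z + of_int b) / (of_int c * z + of_int d)) = (of_int c * z + of_int d) ^ (2 * i) * f z"
    if "a * d - b * c = 1" "z \<in> uhp" for a b c d :: int and z
    using that
  proof (induction "nat \<bar>c\<bar>" arbitrary: a b c d z rule: less_induct)
    case less
    show ?case
    proof (cases "c = 0")
      case True
      hence "a * d = 1" using less.prems by simp
      hence "(a = 1 \<and> d = 1) \<or> (a = -1 \<and> d = -1)" by (simp add: zmult_eq_1_iff)
      thus ?thesis
      proof
        assume "a = 1 \<and> d = 1"
        thus ?thesis using True Ti[OF less.prems(2), of b] by simp
      next
        assume ad: "a = -1 \<and> d = -1"
        hence "(of_int a * z + of_int b) / (of_int c * z + of_int d) = z + of_int (- b)" using True by simp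
        moreover have "(-1 :: complex) ^ (2 * i) = 1" by simp
        ultimately show ?thesis using True ad Ti[OF less.prems(2), of "-b"] by simp
      qed
    next
      case False
      \<comment> \<open>Translating by the quotient n leaves the lower row (c, r), and S turns it
        into (r, -c), whose first entry is smaller in absolute value.\<close>
      define n r where "n = d div c" and "r = d mod c"
      have d: "d = n * c + r" by (simp add: n_def r_def)
      have lt: "nat \<bar>- r\<bar> < nat \<bar>c\<bar>" using False abs_mod_less[of c d] by (simp add: r_def)
      define z' where "z' = z + of_int n"
      have z': "z' \<in> uhp" using less.prems(2) by (auto simp: z'_def uhp_def)
      have z'0: "z' \<noteq> 0" by (rule uhp_nonzero[OF z'])
      define w where "w = - 1 / z'"
      have w: "w \<in> uhp" unfolding w_def by (rule uhp_inverse[OF z'])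
      have det: "(b - n * a) * (- c) - (- a) * r = 1" using less.prems(1) by (simp add: d algebra_simps)
      have "f ((of_int (b - n * a) * w + of_int (- a)) / (of_int r * w + of_int (- c))) = 
          (of_int r * w + of_int (- c)) ^ (2 * i) * f w"
      proof (rule less.hyps[OF _ det w])
        show "nat \<bar>r\<bar> < nat \<bar>c\<bar>" using lt by simp
      qed
      also have "(of_int (b - n * a) * w + of_int (- a)) / (of_int r * w + of_int (- c)) = 
          (of_int a * z + of_int b) / (of_int c * z + of_int d)"
      proof -
        have 1: "(of_int (b - n * a) * w + of_int (- a)) * z' = - (of_int a * z + of_int b)"
          using z'0 by (simp add: w_def algebra_simps) (simp add: z'_def algebra_simps)
        have 2: "(of_int r * w + of_int (- c)) * z' = - (of_int c * z + of_int d)"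
          using z'0 by (simp add: w_def algebra_simps) (simp add: z'_def d algebra_simps)
        have "(of_int (b - n * a) * w + of_int (- a)) / (of_int r * w + of_int (- c)) = 
            ((of_int (b - n * a) * w + of_int (- a)) * z') / ((of_int r * w + of_int (- c)) * z')"
          using z'0 by simp
        also have "\<dots> = (of_int a * z + of_int b) / (of_int c * z + of_int d)" 
          unfolding 1 2 by (simp only: minus_divide_left[symmetric] minus_divide_right[symmetric] minus_minus)
        finally show ?thesis .
      qed
      also have "(of_int r * w + of_int (- c)) ^ (2 * i) * f w = (of_int c * z + of_int d) ^ (2 * i) * f z"
      proof -
        have 2: "(of_int r * w + of_int (- c)) * z' = - (of_int c * z + of_int d)"
          using z'0 by (simp add: w_def algebra_simps) (simp add: z'_def d algebra_simps)
        have "f w = z' ^ (2 * i) * f z'" unfolding w_def by (rule S[OF z'])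
        hence "(of_int r * w + of_int (- c)) ^ (2 * i) * f w = ((of_int r * w + of_int (- c)) * z') ^ (2 * i) * f z'"
          by (simp add: power_mult_distrib)
        also have "\<dots> = (of_int c * z + of_int d) ^ (2 * i) * f z'"
          unfolding 2 power_mult power2_minus ..
        also have "f z' = f z" unfolding z'_def by (rule Ti[OF less.prems(2)])
        finally show ?thesis .
      qed
      finally show ?thesis .
    qed
  qed
  thus ?thesis using hol bd by (simp add: mf_def modular_form_def)
qed

text \<open>\<open>F\<close> is recorded together with \<open>f\<close> because \<open>F 0\<close>
  and \<open>deriv F 0\<close> are the value and the first coefficient at the cusp, which lies
  outside \<open>uhp\<close>.\<close>

definition qexp :: "(complex \<Rightarrow> complex) \<Rightarrow> (complex \<Rightarrow> complex) \<Rightarrow> bool" where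
  "qexp f F \<longleftrightarrow> F holomorphic_on ball 0 1 \<and> (\<forall>z\<in>uhp. f z = F (qpar z))"

lemma qpar_in_ball: "z \<in> uhp \<Longrightarrow> qpar z \<in> ball 0 1"
  using norm_qpar_less_1 by simp

lemma qpar_surj:
  assumes "q \<in> ball 0 1" "q \<noteq> 0"
  obtains z where "z \<in> uhp" "qpar z = q" "z = Ln q / (2 * of_real pi * \<i>)" "Im z = - ln (norm q) / (2 * pi)"
proof
  let ?z = "Ln q / (2 * of_real pi * \<i>)"
  show *: "Im ?z = - ln (norm q) / (2 * pi)" using assms by (simp add: Im_divide field_simps power2_eq_square)
  have "ln (norm q) < 0" using assms by simp
  hence "- ln (norm q) / (2 * pi) > 0" by (intro divide_pos_pos) auto
  thus "?z \<in> uhp" using * by (simp add: uhp_def)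
  show "qpar ?z = q" using assms by (simp add: qpar_def)
qed (rule refl)

text \<open>The image of \<open>uhp\<close> under \<open>qpar\<close> is the punctured disc;
  continuity supplies q = 0.\<close>

lemma qexp_unique_0:
  assumes "F holomorphic_on ball 0 1" "G holomorphic_on ball 0 1" "\<And>z. z \<in> uhp \<Longrightarrow> F (qpar z) = G (qpar z)"
    and q: "q \<in> ball 0 1"
  shows "F q = G q"
proof -
  have *: "F q = G q" if "q \<in> ball 0 1 - {0}" for q
    using that assms(3) by (metis Diff_iff insertI1 qpar_surj)
  have cont: "continuous_on (ball 0 1) (\<lambda>q. F q - G q)"
    using assms by (intro continuous_intros holomorphic_on_imp_continuous_on)
  have "F 0 - G 0 = 0"
  proof (rule tendsto_unique[of "at 0"])
    show "((\<lambda>q. F q - G q) \<longlongrightarrow> F 0 - G 0) (at 0)"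
      using cont unfolding continuous_on_eq_continuous_at[OF open_ball] isCont_def by simp
    show "((\<lambda>q. F q - G q) \<longlongrightarrow> 0) (at 0)"
    proof (rule Lim_transform_within_open[OF tendsto_const open_ball])
      show "0 \<in> ball (0::complex) 1" by simp
      show "0 = F x - G x" if "x \<in> ball 0 1" "x \<noteq> 0" for x using *[of x] that by simp
    qed
  qed auto
  thus ?thesis using *[of q] q by (cases "q = 0") auto
qed

text \<open>The branch cut of \<open>Ln\<close> is harmless: near every q0 a branch \<open>h\<close>
  through a preimage of q0 gives the same values by periodicity. Boundedness near the cusp makes the
  singularity at q = 0 removable.\<close>

lemma qexp_exists:
  assumes hol: "f holomorphic_on uhp"
    and T: "\<And>z. z \<in> uhp \<Longrightarrow> f (z + 1) = f z"
    and bd: "\<exists>B. \<forall>z. Im z \<ge> 1 \<longrightarrow> norm (f z) \<le> B"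
  shows "\<exists>F. qexp f F"
proof -
  let ?c = "2 * of_real pi * \<i> :: complex"
  define F where "F = (\<lambda>q. f (Ln q / ?c))"
  have Ti: "f (z + of_int n) = f z" if "z \<in> uhp" for z n
    by (rule uhp_periodic_int[where f = f, OF _ that]) (rule T)
  have eq: "f z = f w" if "z \<in> uhp" "qpar w = qpar z" for z w
  proof -
    from that obtain n :: int where "?c * w = ?c * z + (of_int (2 * n) * pi) * \<i>"
      unfolding qpar_def exp_eq by blast
    hence "?c * w = ?c * (z + of_int n)" by (simp add: algebra_simps)
    hence "w = z + of_int n" by simp
    thus ?thesis using Ti[OF that(1)] by simp
  qed
  have fF: "f z = F (qpar z)" if z: "z \<in> uhp" for z
  proof -
    have "qpar (Ln (qpar z) / ?c) = qpar z" by (simp add: qpar_def[of "_ / _"])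
    thus ?thesis unfolding F_def by (intro eq z)
  qed
  have "F field_differentiable at q0" if q0: "q0 \<in> ball 0 1 - {0}" for q0
  proof -
    from q0 obtain z0 where z0: "z0 \<in> uhp" "qpar z0 = q0" using qpar_surj by (metis Diff_iff insertI1)
    define r where "r = min (norm q0) (1 - norm q0)"
    have r: "r > 0" using q0 by (simp add: r_def)
    define h where "h = (\<lambda>q. z0 + Ln (q / q0) / ?c)"
    have near: "q / q0 \<notin> \<real>\<^sub>\<le>\<^sub>0" "q \<noteq> 0" "norm q < 1" if "q \<in> ball q0 r" for q
    proof -
      have d: "norm (q - q0) < norm q0" "norm (q - q0) < 1 - norm q0" 
        using that by (auto simp: r_def dist_norm norm_minus_commute)
      have "norm q \<le> norm (q - q0) + norm q0" using norm_triangle_ineq[of "q - q0" q0] by simp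
      thus "norm q < 1" using d by simp
      show "q \<noteq> 0" using d by auto
      have "norm (q / q0 - 1) = norm (q - q0) / norm q0" using q0 by (simp add: diff_divide_distrib flip: norm_divide)
      also have "\<dots> < 1" using d q0 by (simp add: divide_less_eq)
      finally have "\<bar>Re (q / q0 - 1)\<bar> < 1" using abs_Re_le_cmod[of "q / q0 - 1"] by linarith
      hence "Re (q / q0) > 0" by simp
      thus "q / q0 \<notin> \<real>\<^sub>\<le>\<^sub>0" by (auto simp: complex_nonpos_Reals_iff)
    qed
    have hq: "qpar (h q) = q" if "q \<in> ball q0 r" for q
    proof -
      have "qpar (h q) = qpar z0 * exp (Ln (q / q0))" by (simp add: h_def qpar_def ring_distribs exp_add)
      also have "\<dots> = q" using near(2)[OF that] q0 z0 by simp
      finally show ?thesis .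
    qed
    have huhp: "h q \<in> uhp" if "q \<in> ball q0 r" for q
    proof -
      have "exp (- 2 * pi * Im (h q)) < 1" using norm_qpar[of "h q"] hq[OF that] near(3)[OF that] by simp
      thus ?thesis by (simp add: uhp_def zero_less_mult_iff)
    qed
    have "h holomorphic_on ball q0 r" unfolding h_def using near q0
      by (intro holomorphic_intros) auto
    hence "(f \<circ> h) holomorphic_on ball q0 r"
      by (rule holomorphic_on_compose_gen[OF _ hol]) (use huhp in auto)
    hence "(f \<circ> h) field_differentiable at q0"
      using r holomorphic_on_imp_differentiable_at[OF _ open_ball] by simp
    moreover have "(f \<circ> h) q = F q" if "q \<in> ball q0 r" for q
      using fF[OF huhp[OF that]] hq[OF that] by simp
    ultimately show ?thesis
      using has_field_derivative_transform_within_open[of "f \<circ> h" _ q0 "ball q0 r" F] r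
      unfolding field_differentiable_def by (metis centre_in_ball open_ball)
  qed
  hence "F holomorphic_on ball 0 1 - {0}"
    by (auto simp: holomorphic_on_def intro: field_differentiable_at_within)
  moreover have "\<exists>B. \<forall>\<^sub>F q in at 0. norm (F q) \<le> B"
  proof -
    from bd obtain B where B: "\<And>z. Im z \<ge> 1 \<Longrightarrow> norm (f z) \<le> B" by blast
    have "\<forall>\<^sub>F q in nhds (0::complex). q \<in> ball 0 (exp (- 2 * pi))"
      by (rule eventually_nhds_in_open) auto
    hence "\<forall>\<^sub>F q in at (0::complex). q \<in> ball 0 (exp (- 2 * pi)) \<and> q \<noteq> 0"
      unfolding eventually_at_filter by eventually_elim simp
    hence "\<forall>\<^sub>F q in at 0. norm (F q) \<le> B"
    proof eventually_elim
      case (elim q)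
      hence "ln (norm q) \<le> ln (exp (- 2 * pi))" by (subst ln_le_cancel_iff) auto
      hence "- ln (norm q) / (2 * pi) \<ge> 1" by (simp add: field_simps)
      moreover have "norm q < 1" 
      proof -
        have "exp (- 2 * pi) < 1" by simp
        moreover have "norm q < exp (- 2 * pi)" using elim by simp
        ultimately show ?thesis by linarith
      qed
      ultimately have "Im (Ln q / ?c) \<ge> 1" using elim qpar_surj[of q] by (metis dist_0_norm mem_ball)
      thus ?case unfolding F_def by (rule B)
    qed
    thus ?thesis by blast
  qed
  ultimately have "\<exists>g. g holomorphic_on ball 0 1 \<and> (\<forall>z \<in> ball 0 1 - {0}. g z = F z)"
    by (subst holomorphic_on_extend_bounded) auto
  then obtain g where "g holomorphic_on ball 0 1" "\<And>q. q \<in> ball 0 1 - {0} \<Longrightarrow> g q = F q" by blast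
  hence "qexp f g" unfolding qexp_def using fF qpar_in_ball by simp
  thus ?thesis by blast
qed

lemma mf_qexp: "mf i f \<Longrightarrow> \<exists>F. qexp f F"
  by (rule qexp_exists) (simp_all add: mf_T mf_holomorphic, simp add: mf_def modular_form_def)

lemma qexp_bounded:
  assumes "qexp f F" shows "\<exists>B. \<forall>z. Im z \<ge> 1 \<longrightarrow> norm (f z) \<le> B"
proof -
  have lt: "exp (- 2 * pi) < 1" by simp
  have "continuous_on (ball 0 1) F"
    using assms unfolding qexp_def by (intro holomorphic_on_imp_continuous_on) auto
  hence "continuous_on (cball 0 (exp (- 2 * pi))) F"
    by (rule continuous_on_subset) (use lt in \<open>auto simp del: exp_less_one_iff\<close>)
  hence "bounded (F ` cball 0 (exp (- 2 * pi)))"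
    by (intro compact_imp_bounded compact_continuous_image) auto
  then obtain B where B: "\<And>q. norm q \<le> exp (- 2 * pi) \<Longrightarrow> norm (F q) \<le> B"
    unfolding bounded_iff by (metis imageI mem_cball_0)
  have "norm (f z) \<le> B" if "Im z \<ge> 1" for z
  proof -
    have "z \<in> uhp" using that by (simp add: uhp_def)
    hence "f z = F (qpar z)" using assms by (simp add: qexp_def)
    moreover have "norm (qpar z) \<le> exp (- 2 * pi)" using that by (simp add: norm_qpar)
    ultimately show ?thesis using B by simp
  qed
  thus ?thesis by blast
qed

lemma qexp_holomorphic:
  assumes "qexp f F" shows "f holomorphic_on uhp"
proof -
  have "(F \<circ> qpar) holomorphic_on uhp"
    using assms unfolding qexp_def
    by (intro holomorphic_on_compose_gen[of qpar uhp F "ball 0 1"])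
       (auto simp: qpar_def[abs_def] qpar_in_ball[unfolded qpar_def] uhp_def intro!: holomorphic_intros)
  thus ?thesis using assms unfolding qexp_def by (auto elim!: holomorphic_transform)
qed

lemma qexp_T: "qexp f F \<Longrightarrow> z \<in> uhp \<Longrightarrow> f (z + 1) = f z"
  by (simp add: qexp_def uhp_shift qpar_shift)

text \<open>Holomorphy, period 1 and boundedness at the cusp all come with the expansion; the
  condition that remains is the one for S.\<close>

lemma mf_qexpI:
  assumes "qexp f F" "\<And>z. z \<in> uhp \<Longrightarrow> f (- 1 / z) = z ^ (2 * i) * f z"
  shows "mf i f"
  using assms by (intro mfI qexp_holomorphic qexp_bounded qexp_T)

lemma qexp_const: "qexp (\<lambda>_. c) (\<lambda>_. c)" by (simp add: qexp_def)
lemma qexp_add: "qexp f F \<Longrightarrow> qexp g G \<Longrightarrow> qexp (\<lambda>z. f z + g z) (\<lambda>z. F z + G z)"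
  by (auto simp: qexp_def intro!: holomorphic_intros)
lemma qexp_diff: "qexp f F \<Longrightarrow> qexp g G \<Longrightarrow> qexp (\<lambda>z. f z - g z) (\<lambda>z. F z - G z)"
  by (auto simp: qexp_def intro!: holomorphic_intros)
lemma qexp_mult: "qexp f F \<Longrightarrow> qexp g G \<Longrightarrow> qexp (\<lambda>z. f z * g z) (\<lambda>z. F z * G z)"
  by (auto simp: qexp_def intro!: holomorphic_intros)
lemma qexp_power: "qexp f F \<Longrightarrow> qexp (\<lambda>z. f z ^ n) (\<lambda>z. F z ^ n)"
  by (auto simp: qexp_def intro!: holomorphic_intros)

lemma qexp_nderiv:
  assumes "qexp f F" shows "qexp (nderiv f) (\<lambda>q. q * deriv F q)"
proof -
  have F: "F holomorphic_on ball 0 1" using assms by (simp add: qexp_def)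
  have "nderiv f z = qpar z * deriv F (qpar z)" if z: "z \<in> uhp" for z
  proof -
    have "(F has_field_derivative deriv F (qpar z)) (at (qpar z))"
      by (rule holomorphic_derivI[OF F open_ball qpar_in_ball[OF z]])
    moreover have "(qpar has_field_derivative 2 * of_real pi * \<i> * qpar z) (at z)"
      unfolding qpar_def by (auto intro!: derivative_eq_intros)
    ultimately have "((\<lambda>z. F (qpar z)) has_field_derivative deriv F (qpar z) * (2 * of_real pi * \<i> * qpar z)) (at z)"
      by (rule DERIV_chain2)
    hence "(f has_field_derivative deriv F (qpar z) * (2 * of_real pi * \<i> * qpar z)) (at z)"
      by (rule has_field_derivative_transform_within_open[OF _ open_uhp z])
         (use assms in \<open>auto simp: qexp_def\<close>)
    hence "deriv f z = deriv F (qpar z) * (2 * of_real pi * \<i> * qpar z)" by (rule DERIV_imp_deriv)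
    thus ?thesis unfolding nderiv_def by (simp add: field_simps)
  qed
  moreover have "(\<lambda>q. q * deriv F q) holomorphic_on ball 0 1"
    by (intro holomorphic_intros holomorphic_deriv F) auto
  ultimately show ?thesis by (simp add: qexp_def)
qed

text \<open>Convergence follows from the crude bound n^(k+1) on the divisor sum. The first
  coefficient 1 is used for the simple zero of \<open>Discq\<close>.\<close>

lemma eis_series_holomorphic: "eis_series k holomorphic_on ball 0 1"
  and eis_series_0: "eis_series k 0 = 0"
  and eis_series_deriv_0: "deriv (eis_series k) 0 = 1"
proof -
  define a where "a = (\<lambda>n. of_nat (divisor_sigma k n) :: complex)"
  \<comment> \<open>Every number divides 0, and the sum over this infinite set is 0 by
    convention.\<close>
  have a0: "a 0 = 0" by (simp add: a_def divisor_sigma_def infinite_UNIV_nat)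
  have "{d. d dvd (1::nat)} = {1}" by auto
  hence a1: "a 1 = 1" by (simp add: a_def divisor_sigma_def)
  have le: "divisor_sigma k n \<le> n ^ Suc k" if "n > 0" for n
  proof -
    have "{d. d dvd n} \<subseteq> {1..n}" using that by (auto dest: dvd_imp_le intro!: Nat.gr0I simp: Suc_le_eq)
    hence "divisor_sigma k n \<le> (\<Sum>d\<in>{1..n}. n ^ k)"
      unfolding divisor_sigma_def by (intro order_trans[OF sum_mono2 sum_mono]) (auto intro: power_mono)
    thus ?thesis by simp
  qed
  have s: "summable (\<lambda>n. a n * q ^ n)" if q: "norm q < 1" for q
  proof (rule summable_comparison_test)
    show "summable (\<lambda>n. norm (of_nat n ^ Suc k * q ^ n))" by (rule summable_norm_power_geometric[OF q])
    show "\<exists>N. \<forall>n\<ge>N. norm (a n * q ^ n) \<le> norm (of_nat n ^ Suc k * q ^ n)"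
    proof (intro exI[of _ 1] allI impI)
      fix n :: nat assume "n \<ge> 1"
      hence "real (divisor_sigma k n) \<le> real n ^ Suc k" using le[of n] by (metis Suc_le_eq One_nat_def of_nat_le_iff of_nat_power)
      thus "norm (a n * q ^ n) \<le> norm (of_nat n ^ Suc k * q ^ n)"
        unfolding norm_mult by (intro mult_right_mono) (auto simp: a_def norm_power norm_mult)
    qed
  qed
  have eq: "eis_series k q = (\<Sum>n. a n * q ^ n)" if q: "norm q < 1" for q
    using suminf_split_head[OF s[OF q]] by (simp add: eis_series_def a0) (simp add: a_def)
  have D: "(eis_series k has_field_derivative (\<Sum>n. diffs a n * q ^ n)) (at q)" if q: "norm q < 1" for q
  proof (rule has_field_derivative_transform_within_open[OF _ open_ball])
    show "((\<lambda>q. \<Sum>n. a n * q ^ n) has_field_derivative (\<Sum>n. diffs a n * q ^ n)) (at q)"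
      by (rule termdiffs_strong'[OF s q])
    show "q \<in> ball 0 1" using q by simp
  qed (simp add: eq)
  show "eis_series k holomorphic_on ball 0 1"
    by (rule holomorphic_onI) (use D[THEN has_field_derivative_at_within] in \<open>auto simp: field_differentiable_def\<close>)
  show "eis_series k 0 = 0" by (simp add: eis_series_def)
  have "(\<Sum>n. diffs a n * 0 ^ n) = diffs a 0" by (rule powser_zero)
  also have "\<dots> = 1" using a1 by (simp add: diffs_def)
  finally show "deriv (eis_series k) 0 = 1" using D[of 0] by (simp add: DERIV_imp_deriv)
qed

section \<open>Vanishing of cusp forms of small weight\<close>

lemma Im_moebius:
  assumes "a * d - b * c = (1 :: int)"
  shows "Im ((of_int a * z + of_int b) / (of_int c * z + of_int d)) = Im z / (norm (of_int c * z + of_int d))\<^sup>2"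
proof -
  have "Im ((of_int a * z + of_int b) / (of_int c * z + of_int d)) = 
      Im ((of_int a * z + of_int b) * cnj (of_int c * z + of_int d)) / (norm (of_int c * z + of_int d))\<^sup>2"
    unfolding complex_div_cnj[of "of_int a * z + of_int b"] by (simp only: Im_divide_of_real flip: of_real_power)
  also have "Im ((of_int a * z + of_int b) * cnj (of_int c * z + of_int d)) = of_int (a * d - b * c) * Im z"
    by (simp add: algebra_simps)
  finally show ?thesis using assms by simp
qed

text \<open>Choose a point of maximal imaginary part in the orbit.\<close>

lemma fundamental_domain:
  assumes z: "z \<in> uhp"
  obtains a b c d :: int where "a * d - b * c = 1"
    "\<bar>Re ((of_int a * z + of_int b) / (of_int c * z + of_int d))\<bar> \<le> 1/2"
    "Im ((of_int a * z + of_int b) / (of_int c * z + of_int d)) \<ge> sqrt 3 / 2"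
proof -
  define N where "N = (\<lambda>(c::int, d::int). norm (of_int c * z + of_int d))"
  \<comment> \<open>Lower rows at least as good as (0, 1). There are finitely many, so |cz + d| has
    a least value on them, and Im z / |cz + d|^2 is then largest.\<close>
  define P where "P = {(c, d). \<exists>a b. a * d - b * c = 1 \<and> N (c, d) \<le> 1}"
  have y: "Im z > 0" using z by (simp add: uhp_def)
  have "finite P"
  proof (rule finite_subset)
    show "P \<subseteq> {- \<lceil>1 / Im z\<rceil>..\<lceil>1 / Im z\<rceil>} \<times> {- \<lceil>1 + 1 / Im z * norm z\<rceil>..\<lceil>1 + 1 / Im z * norm z\<rceil>}"
    proof (rule subsetI)
      fix x assume "x \<in> P"
      then obtain c d where x: "x = (c, d)" and le: "norm (of_int c * z + of_int d) \<le> 1" by (auto simp: P_def N_def)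
      have "\<bar>Im (of_int c * z + of_int d)\<bar> \<le> 1" using abs_Im_le_cmod le by (rule order_trans)
      hence c: "\<bar>of_int c\<bar> \<le> 1 / Im z" using y by (simp add: abs_mult field_simps)
      have "\<bar>of_int d\<bar> = norm ((of_int c * z + of_int d) - of_int c * z)" by simp
      also have "\<dots> \<le> norm (of_int c * z + of_int d) + norm (of_int c * z)" by (rule norm_triangle_ineq4)
      also have "\<dots> \<le> 1 + 1 / Im z * norm z"
        using le mult_right_mono[OF c norm_ge_zero[of z]] by (simp add: norm_mult)
      finally have d: "\<bar>of_int d\<bar> \<le> 1 + 1 / Im z * norm z" .
      show "x \<in> {- \<lceil>1 / Im z\<rceil>..\<lceil>1 / Im z\<rceil>} \<times> {- \<lceil>1 + 1 / Im z * norm z\<rceil>..\<lceil>1 + 1 / Im z * norm z\<rceil>}"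
        using c d unfolding x by (simp add: abs_le_iff) linarith
    qed
  qed auto
  moreover have "(0, 1) \<in> P" by (auto simp: P_def N_def intro!: exI[of _ 1])
  ultimately obtain p where p: "p \<in> P" "\<And>p'. p' \<in> P \<Longrightarrow> N p \<le> N p'"
    by (metis arg_min_if_finite(1) arg_min_least empty_iff)
  then obtain a b c d where abcd: "p = (c, d)" "a * d - b * c = 1" "N (c, d) \<le> 1" by (auto simp: P_def)
  define w where "w = (of_int a * z + of_int b) / (of_int c * z + of_int d)"
  define n where "n = - round (Re w)"
  have nz: "of_int c * z + of_int d \<noteq> 0"
  proof
    assume "of_int c * z + of_int d = 0"
    hence "c = 0 \<and> d = 0" using y by (auto simp: complex_eq_iff)
    thus False using abcd by simp
  qed
  define w' where "w' = w + of_int n"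
  have w': "w' = (of_int (a + n * c) * z + of_int (b + n * d)) / (of_int c * z + of_int d)"
    using nz by (simp add: w'_def w_def field_simps)
  have det: "(a + n * c) * d - (b + n * d) * c = 1" using abcd by (simp add: algebra_simps)
  have "Re w' = Re w - of_int (round (Re w))" by (simp add: w'_def n_def)
  hence re: "\<bar>Re w'\<bar> \<le> 1/2" using of_int_round_abs_le[of "Re w"] by (simp add: abs_minus_commute)
  have im: "Im w' = Im z / (N (c, d))\<^sup>2" unfolding w' Im_moebius[OF det] by (simp add: N_def)
  have Npos: "N (c, d) > 0" using nz by (simp add: N_def)
  hence im_pos: "Im w' > 0" using im y by simp
  have "norm w' \<ge> 1"
  proof (rule ccontr)
    \<comment> \<open>Applying S changes the lower row to (a + nc, b + nd), whose norm is smaller by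
      the factor |w'|.\<close>
    assume less: "\<not> norm w' \<ge> 1"
    have "N (a + n * c, b + n * d) = norm w' * N (c, d)"
      using nz by (simp add: w' N_def norm_divide)
    hence lt: "N (a + n * c, b + n * d) < N (c, d)" using less Npos by simp
    have "(- c) * (b + n * d) - (- d) * (a + n * c) = 1" using det by (simp add: algebra_simps)
    hence "\<exists>a' b'. a' * (b + n * d) - b' * (a + n * c) = 1" by blast
    hence "(a + n * c, b + n * d) \<in> P" unfolding P_def using lt abcd(3) by auto
    from p(2)[OF this] lt abcd(1) show False by simp
  qed
  hence "1 \<le> (norm w')\<^sup>2" by (simp add: one_le_power)
  also have "\<dots> = (Re w')\<^sup>2 + (Im w')\<^sup>2" by (simp add: cmod_power2)
  also have "(Re w')\<^sup>2 \<le> (1/2)\<^sup>2" using re by (metis abs_le_square_iff abs_of_nonneg zero_le_divide_1_iff zero_le_numeral)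
  finally have "(Im w')\<^sup>2 \<ge> 3/4" by (simp add: power2_eq_square)
  hence "(sqrt 3 / 2)\<^sup>2 \<le> (Im w')\<^sup>2" by (simp add: power_divide)
  hence "sqrt 3 / 2 \<le> Im w'" using im_pos by (meson less_imp_le power2_le_imp_le)
  thus ?thesis using that[OF det] re unfolding w' by blast
qed

lemma mf_norm_invariant:
  assumes "mf i f" "z \<in> uhp" "a * d - b * c = 1" "w = (of_int a * z + of_int b) / (of_int c * z + of_int d)"
  shows "norm (f w) * Im w ^ i = norm (f z) * Im z ^ i"
proof -
  let ?N = "norm (of_int c * z + of_int d)"
  have nz: "of_int c * z + of_int d \<noteq> 0"
  proof
    assume "of_int c * z + of_int d = 0"
    hence "c = 0 \<and> d = 0" using assms(2) by (auto simp: complex_eq_iff uhp_def)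
    thus False using assms by simp
  qed
  have "f w = (of_int c * z + of_int d) ^ (2 * i) * f z" using assms by (simp add: mf_def modular_form_def)
  moreover have "Im w ^ i = Im z ^ i / ?N ^ (2 * i)"
    unfolding assms(4) Im_moebius[OF assms(3)] by (simp add: power_divide power_mult)
  ultimately show ?thesis using nz by (simp add: norm_mult norm_power)
qed

lemma holomorphic_factor_zero:
  assumes "F holomorphic_on ball 0 1" "F 0 = 0"
  obtains H where "H holomorphic_on ball 0 1" "\<And>q. F q = q * H q" "H 0 = deriv F 0"
proof
  let ?H = "\<lambda>z. if z = 0 then deriv F 0 else (F z - F 0) / (z - 0)"
  show "?H holomorphic_on ball 0 1" by (rule pole_lemma[OF assms(1)]) auto
qed (use assms(2) in auto)

text \<open>Siegel's argument: \<open>|f| y\<^sup>i\<close> attains its maximum at some \<open>z\<^sub>0\<close> with \<open>Im z\<^sub>0 \<ge> \<surd>3/2\<close>; the maximum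
  principle for \<open>f/q\<close> on a slightly larger horoball then forces \<open>i \<ge> 2\<pi> Im z\<^sub>0 > 5\<close>.\<close>

lemma cusp_form_small_weight:
  assumes f: "mf i f" and F: "qexp f F" and F0: "F 0 = 0" and i: "i \<le> 5" and z: "z \<in> uhp"
  shows "f z = 0"
proof (rule ccontr)
  assume nz: "f z \<noteq> 0"
  define \<phi> where "\<phi> = (\<lambda>z. norm (f z) * Im z ^ i)"
  obtain H where H: "H holomorphic_on ball 0 1" "\<And>q. F q = q * H q"
    using holomorphic_factor_zero[of F] F F0 unfolding qexp_def by metis
  have fH: "f w = qpar w * H (qpar w)" if "w \<in> uhp" for w using F H that by (simp add: qexp_def)
  have red: "\<exists>w. \<bar>Re w\<bar> \<le> 1/2 \<and> Im w \<ge> sqrt 3 / 2 \<and> \<phi> w = \<phi> z" if "z \<in> uhp" for z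
    using fundamental_domain[OF that] mf_norm_invariant[OF f that] unfolding \<phi>_def by metis
  obtain z1 where z1: "\<bar>Re z1\<bar> \<le> 1/2" "Im z1 \<ge> sqrt 3 / 2" "\<phi> z1 = \<phi> z" using red[OF z] by blast
  have "Im z ^ i > 0" using z by (simp add: uhp_def)
  hence pos: "\<phi> z1 > 0" using nz z1 by (simp add: \<phi>_def)
  \<comment> \<open>f/q is bounded at the cusp, so f decays like exp(-2 pi y), faster than y^i
    grows; the supremum is thus attained in a compact box.\<close>
  obtain Y where Y: "\<And>w. Im w \<ge> Y \<Longrightarrow> \<phi> w < \<phi> z1"
  proof -
    have "qexp (\<lambda>z. H (qpar z)) H" using H by (simp add: qexp_def)
    from qexp_bounded[OF this] obtain B where B: "\<And>z. Im z \<ge> 1 \<Longrightarrow> norm (H (qpar z)) \<le> B" by blast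
    have "((\<lambda>y::real. exp (- (2 * pi) * y) * \<bar>B\<bar> * y ^ i) \<longlongrightarrow> 0) at_top"
    proof -
      have "filterlim (\<lambda>y::real. 2 * pi * y) at_top at_top"
        by (intro filterlim_tendsto_pos_mult_at_top[OF tendsto_const] filterlim_ident) auto
      from tendsto_mult[OF tendsto_const[of "\<bar>B\<bar> / (2 * pi) ^ i"] filterlim_compose[OF tendsto_power_div_exp_0[of i] this]]
      show ?thesis by (simp add: power_mult_distrib exp_minus field_simps)
    qed
    hence "\<forall>\<^sub>F y in at_top. exp (- (2 * pi) * y) * \<bar>B\<bar> * y ^ i < \<phi> z1" using pos by (rule order_tendstoD)
    then obtain Y where Y: "\<And>y. y \<ge> Y \<Longrightarrow> exp (- (2 * pi) * y) * \<bar>B\<bar> * y ^ i < \<phi> z1"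
      by (auto simp: eventually_at_top_linorder)
    have "\<phi> w < \<phi> z1" if w: "Im w \<ge> max Y 1" for w
    proof -
      have wu: "w \<in> uhp" using w by (simp add: uhp_def)
      have "\<phi> w = exp (- (2 * pi) * Im w) * norm (H (qpar w)) * Im w ^ i"
        by (simp add: \<phi>_def fH[OF wu] norm_mult norm_qpar)
      also have "\<dots> \<le> exp (- (2 * pi) * Im w) * \<bar>B\<bar> * Im w ^ i"
        using B[of w] w by (intro mult_right_mono mult_left_mono) auto
      also have "\<dots> < \<phi> z1" using w by (intro Y) auto
      finally show ?thesis .
    qed
    thus ?thesis using that by blast
  qed
  define K where "K = cbox (Complex (-1/2) (sqrt 3 / 2)) (Complex (1/2) Y)"
  have K: "w \<in> K \<longleftrightarrow> \<bar>Re w\<bar> \<le> 1/2 \<and> sqrt 3 / 2 \<le> Im w \<and> Im w \<le> Y" for w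
    by (auto simp: K_def in_cbox_complex_iff)
  have s3: "sqrt 3 / 2 > (0::real)" by simp
  have Ku: "K \<subseteq> uhp"
  proof
    fix w assume "w \<in> K"
    hence "Im w \<ge> sqrt 3 / 2" by (simp add: K)
    with s3 show "w \<in> uhp" unfolding uhp_def mem_Collect_eq by linarith
  qed
  have "z1 \<in> K" using z1 Y[of z1] by (force simp: K)
  have "continuous_on K \<phi>" unfolding \<phi>_def
    using continuous_on_subset[OF holomorphic_on_imp_continuous_on[OF mf_holomorphic[OF f]] Ku]
    by (intro continuous_intros)
  then obtain z0 where z0: "z0 \<in> K" "\<And>w. w \<in> K \<Longrightarrow> \<phi> w \<le> \<phi> z0"
    using continuous_attains_sup[of K \<phi>] \<open>z1 \<in> K\<close> by (auto simp: K_def)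
  have max: "\<phi> w \<le> \<phi> z0" if w: "w \<in> uhp" for w
  proof -
    obtain w' where w': "\<bar>Re w'\<bar> \<le> 1/2" "Im w' \<ge> sqrt 3 / 2" "\<phi> w' = \<phi> w" using red[OF w] by blast
    show ?thesis
    proof (cases "Im w' \<le> Y")
      case True
      hence "w' \<in> K" using w' by (simp add: K)
      thus ?thesis using z0(2) w'(3) by fastforce
    next
      case False
      hence "\<phi> w' < \<phi> z1" by (intro Y) auto
      thus ?thesis using z0(2)[OF \<open>z1 \<in> K\<close>] w'(3) by simp
    qed
  qed
  define y0 where "y0 = Im z0"
  have z0u: "z0 \<in> uhp" using z0 Ku by auto
  have y0: "y0 \<ge> sqrt 3 / 2" "y0 > 0" using z0 z0u by (auto simp: y0_def K uhp_def)
  have f0: "norm (f z0) > 0" using z0(2)[OF \<open>z1 \<in> K\<close>] pos by (auto simp: \<phi>_def)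
  \<comment> \<open>The midpoint of i/(2 pi y0) and 1. The maximum principle will yield t <= i/(2 pi
    y0), a contradiction.\<close>
  define t where "t = (1 + real i / (2 * pi * y0)) / 2"
  \<comment> \<open>From sqrt 3 > 1.7 and pi > 3 one gets 2 pi y0 > 5.1; this bound is what limits
    the weight to 10.\<close>
  have a5: "2 * pi * y0 > 5"
  proof -
    have "sqrt 3 > 17/10" by (rule real_less_rsqrt) (simp add: power2_eq_square)
    hence "y0 > 17/20" using y0 by simp
    moreover have "pi > 3" using pi_gt3 .
    ultimately have "pi * y0 > 3 * (17/20)" by (intro mult_strict_mono) auto
    thus ?thesis by simp
  qed
  hence ia: "real i / (2 * pi * y0) < 1" using i by simp
  have t: "t > 0" "t < 1" "real i / (2 * pi * y0) < t" 
    using ia y0 by (auto simp: t_def add_pos_nonneg field_simps)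
  define r where "r = exp (- 2 * pi * (t * y0))"
  have r1: "0 < r" "r < 1" using t y0 by (auto simp: r_def)
  have q0r: "norm (qpar z0) < r" unfolding norm_qpar r_def y0_def[symmetric] using t y0 by (simp add: field_simps)
  have "norm (H (qpar z0)) \<le> norm (f z0) / t ^ i * exp (2 * pi * (t * y0))"
  proof (rule maximum_modulus_frontier[of H "ball 0 r"])
    show "H holomorphic_on interior (ball 0 r)"
      by (rule holomorphic_on_subset[OF H(1)]) (use r1 in auto)
    show "continuous_on (closure (ball 0 r)) H"
      by (rule continuous_on_subset[OF holomorphic_on_imp_continuous_on[OF H(1)]]) (use r1 in auto)
    show "qpar z0 \<in> ball 0 r" using q0r by simp
    fix q :: complex assume "q \<in> frontier (ball 0 r)"
    hence q: "norm q = r" using r1 by simp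
    then obtain w where w: "w \<in> uhp" "qpar w = q" "Im w = - ln (norm q) / (2 * pi)"
      using qpar_surj[of q] r1 by force
    have imw: "Im w = t * y0" using w(3) unfolding q r_def by simp
    have "norm (f w) * (t * y0) ^ i \<le> norm (f z0) * y0 ^ i"
      using max[OF w(1)] by (simp add: \<phi>_def imw y0_def)
    hence "norm (f w) \<le> norm (f z0) / t ^ i" using t y0 by (simp add: power_mult_distrib field_simps)
    moreover have "norm (H q) = norm (f w) * exp (2 * pi * (t * y0))"
      using fH[OF w(1)] by (simp add: w(2) norm_mult q r_def exp_minus field_simps)
    ultimately show "norm (H q) \<le> norm (f z0) / t ^ i * exp (2 * pi * (t * y0))"
      by (metis exp_ge_zero mult_right_mono)
  qed auto
  moreover have "norm (f z0) = exp (- (2 * pi * y0)) * norm (H (qpar z0))"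
    using fH[OF z0u] by (simp add: norm_mult norm_qpar y0_def)
  ultimately have "norm (f z0) \<le> exp (- (2 * pi * y0)) * (norm (f z0) / t ^ i * exp (2 * pi * (t * y0)))"
    by (metis exp_ge_zero mult_left_mono)
  hence "norm (f z0) * t ^ i \<le> norm (f z0) * exp (2 * pi * (t * y0) - 2 * pi * y0)"
    using t by (simp add: exp_diff exp_minus field_simps)
  hence "t ^ i \<le> exp (2 * pi * (t * y0) - 2 * pi * y0)" using f0 by simp
  hence "ln (t ^ i) \<le> 2 * pi * (t * y0) - 2 * pi * y0" 
    using t by (metis ln_exp ln_mono zero_less_power)
  hence le: "real i * ln t \<le> - (2 * pi * y0) * (1 - t)" using t by (simp add: ln_realpow algebra_simps)
  \<comment> \<open>Replacing the logarithm by this bound lets the factor 1 - t be cancelled, which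
    leaves 2 pi y0 t <= i.\<close>
  have "ln (1 / t) \<le> 1 / t - 1" using t by (intro ln_le_minus_one) auto
  hence "ln t \<ge> 1 - 1 / t" using t by (simp add: ln_div)
  hence "real i * (1 - 1 / t) \<le> real i * ln t" by (intro mult_left_mono) auto
  with le have "real i * (1 - 1 / t) \<le> - (2 * pi * y0) * (1 - t)" by linarith
  hence "(1 - t) * (2 * pi * y0 * t) \<le> (1 - t) * real i" using t by (simp add: field_simps)
  hence "2 * pi * y0 * t \<le> real i" using t by simp
  moreover have "real i < 2 * pi * y0 * t" using t(3) y0 by (simp add: field_simps)
  ultimately show False by simp
qed

section \<open>Ramanujan's differential equations and the discriminant\<close>

lemma mf_zero: "mf i (\<lambda>_. 0)"
  by (auto simp: mf_def modular_form_def)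

lemma mf_cong:
  assumes "mf i f" "\<And>z. z \<in> uhp \<Longrightarrow> f z = g z"
  shows "mf i g"
proof -
  obtain F where "qexp f F" using mf_qexp[OF assms(1)] by blast
  hence "qexp g F" using assms(2) by (simp add: qexp_def)
  thus ?thesis
    by (rule mf_qexpI) (use mf_S[OF assms(1)] assms(2) uhp_inverse in metis)
qed

lemma mf_const: "mf 0 (\<lambda>_. c)"
  by (rule mf_qexpI[OF qexp_const]) simp

lemma mf_add:
  assumes "mf i f" "mf i g" shows "mf i (\<lambda>z. f z + g z)"
proof -
  obtain F G where "qexp f F" "qexp g G" using assms mf_qexp by blast
  thus ?thesis
    by (rule mf_qexpI[OF qexp_add]) (simp add: mf_S[OF assms(1), simplified] mf_S[OF assms(2), simplified] algebra_simps)
qed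

lemma mf_mult:
  assumes "mf i f" "mf j g" shows "mf (i + j) (\<lambda>z. f z * g z)"
proof -
  obtain F G where "qexp f F" "qexp g G" using assms mf_qexp by blast
  thus ?thesis
    by (rule mf_qexpI[OF qexp_mult]) (simp add: mf_S[OF assms(1), simplified] mf_S[OF assms(2), simplified] algebra_simps power_add)
qed

lemma mf_cmult: "mf i f \<Longrightarrow> mf i (\<lambda>z. c * f z)"
  using mf_mult[OF mf_const, of i f c] by simp

lemma mf_diff: "mf i f \<Longrightarrow> mf i g \<Longrightarrow> mf i (\<lambda>z. f z - g z)"
  using mf_add[of i f "\<lambda>z. (-1) * g z"] mf_cmult[of i g "-1"] by simp

lemma mf_power: "mf i f \<Longrightarrow> mf (n * i) (\<lambda>z. f z ^ n)"
  by (induction n) (use mf_const[of 1] mf_mult[of i f] in auto)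

definition E2q :: "complex \<Rightarrow> complex" where "E2q q = 1 - 24 * eis_series 1 q"
definition E4q :: "complex \<Rightarrow> complex" where "E4q q = 1 + 240 * eis_series 3 q"
definition E6q :: "complex \<Rightarrow> complex" where "E6q q = 1 - 504 * eis_series 5 q"

lemma qexp_E2: "qexp E2 E2q" and qexp_E4: "qexp E4 E4q" and qexp_E6: "qexp E6 E6q"
  unfolding qexp_def E2_def E4_def E6_def E2q_def[abs_def] E4q_def[abs_def] E6q_def[abs_def] eis_series_def[symmetric]
  by (auto intro!: holomorphic_intros eis_series_holomorphic)

lemma Eq_0: "E2q 0 = 1" "E4q 0 = 1" "E6q 0 = 1"
  by (simp_all add: E2q_def E4q_def E6q_def eis_series_0)

lemma mf_E4: "mf 2 E4" and mf_E6: "mf 3 E6"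
  by (rule mf_qexpI[OF qexp_E4], simp add: E4_S[simplified]) (rule mf_qexpI[OF qexp_E6], simp add: E6_S[simplified])

lemma E2_holomorphic: "E2 holomorphic_on uhp" and E4_holomorphic: "E4 holomorphic_on uhp"
  and E6_holomorphic: "E6 holomorphic_on uhp"
  using qexp_E2 qexp_E4 qexp_E6 by (auto intro: qexp_holomorphic)

lemma uhp_derivI: "f holomorphic_on uhp \<Longrightarrow> z \<in> uhp \<Longrightarrow> (f has_field_derivative deriv f z) (at z)"
  by (rule holomorphic_derivI[OF _ open_uhp])

lemma qexp_serre_D:
  assumes "qexp f F" 
  shows "qexp (serre_D k f) (\<lambda>q. q * deriv F q - of_real k / 12 * E2q q * F q)"
  unfolding serre_D_def[abs_def] by (intro qexp_diff qexp_nderiv qexp_mult qexp_const qexp_E2 assms)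

text \<open>The term with \<open>c\<close> is needed only for \<open>f = E\<^sub>2\<close>.\<close>

lemma nderiv_S:
  assumes f: "f holomorphic_on uhp" and S: "\<And>z. z \<in> uhp \<Longrightarrow> f (- 1 / z) = z ^ w * f z + c * z ^ (w - 1)"
    and z: "z \<in> uhp"
  shows "nderiv f (- 1 / z) = z ^ (w + 2) * nderiv f z + 
     (of_nat w * z ^ (w + 1) * f z + c * of_nat (w - 1) * z ^ w) / (2 * of_real pi * \<i>)"
proof -
  have z0: "z \<noteq> 0" by (rule uhp_nonzero[OF z])
  have "((\<lambda>z. f (- 1 / z)) has_field_derivative deriv f (- 1 / z) * (1 / z ^ 2)) (at z)"
    by (rule DERIV_chain2[where f = f and g = "\<lambda>z. - 1 / z", OF uhp_derivI[OF f uhp_inverse[OF z]]])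
       (use z0 in \<open>auto intro!: derivative_eq_intros simp: power2_eq_square\<close>)
  moreover have "((\<lambda>z. f (- 1 / z)) has_field_derivative 
     of_nat w * z ^ (w - 1) * f z + z ^ w * deriv f z + c * (of_nat (w - 1) * z ^ (w - 1 - 1))) (at z)"
  proof (rule has_field_derivative_transform_within_open[OF _ open_uhp z])
    show "((\<lambda>z. z ^ w * f z + c * z ^ (w - 1)) has_field_derivative 
     of_nat w * z ^ (w - 1) * f z + z ^ w * deriv f z + c * (of_nat (w - 1) * z ^ (w - 1 - 1))) (at z)"
      by (rule derivative_eq_intros uhp_derivI[OF f z] refl | simp)+
  qed (use S in auto)
  ultimately have "deriv f (- 1 / z) * (1 / z ^ 2) = 
     of_nat w * z ^ (w - 1) * f z + z ^ w * deriv f z + c * (of_nat (w - 1) * z ^ (w - 1 - 1))"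
    by (rule DERIV_unique)
  hence "deriv f (- 1 / z) * (1 / z ^ 2) * z ^ 2 = 
     (of_nat w * z ^ (w - 1) * f z + z ^ w * deriv f z + c * (of_nat (w - 1) * z ^ (w - 1 - 1))) * z ^ 2"
    by (simp only:)
  also have "\<dots> = of_nat w * z ^ (w - 1) * z ^ 2 * f z + (z ^ w * z ^ 2) * deriv f z + c * (of_nat (w - 1) * z ^ (w - 1 - 1) * z ^ 2)"
    by (simp only: distrib_right) (simp only: mult_ac)
  also have "deriv f (- 1 / z) * (1 / z ^ 2) * z ^ 2 = deriv f (- 1 / z)" using z0 by simp
  also have "of_nat w * z ^ (w - 1) * z ^ 2 = of_nat w * z ^ (w + 1)"
    by (cases w) (simp_all add: power2_eq_square)
  also have "z ^ w * z ^ 2 = z ^ (w + 2)" by (simp flip: power_add)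
  also have "of_nat (w - 1) * z ^ (w - 1 - 1) * z ^ 2 = of_nat (w - 1) * z ^ w"
  proof (cases "w \<le> 1")
    case False
    define v where "v = w - 2"
    have "w = Suc (Suc v)" using False by (simp add: v_def)
    thus ?thesis by (simp add: power2_eq_square)
  qed auto
  finally have "deriv f (- 1 / z) = z ^ (w + 2) * deriv f z + (of_nat w * z ^ (w + 1) * f z + c * of_nat (w - 1) * z ^ w)"
    by (simp only: add_ac mult_ac)
  thus ?thesis by (simp add: nderiv_def add_divide_distrib)
qed

lemma mf_serre_D:
  assumes f: "mf i f"
  shows "mf (i + 1) (serre_D (2 * real i) f)"
proof -
  obtain F where F: "qexp f F" using mf_qexp[OF f] by blast
  show ?thesis
  proof (rule mf_qexpI[OF qexp_serre_D[OF F]])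
    fix z assume z: "z \<in> uhp"
    have Sf: "f (- 1 / z) = z ^ (2 * i) * f z" if "z \<in> uhp" for z by (rule mf_S[OF f that])
    show "serre_D (2 * real i) f (- 1 / z) = z ^ (2 * (i + 1)) * serre_D (2 * real i) f z"
    proof -
      have D: "nderiv f (- 1 / z) = z ^ (2 * i + 2) * nderiv f z + of_nat (2 * i) * z ^ (2 * i + 1) * f z / (2 * of_real pi * \<i>)"
        using nderiv_S[OF mf_holomorphic[OF f], of "2 * i" 0 z] Sf z by simp
      have "serre_D (2 * real i) f (- 1 / z) = nderiv f (- 1 / z) - of_nat i / 6 * (z ^ 2 * E2 z + 6 * z / (of_real pi * \<i>)) * (z ^ (2 * i) * f z)"
        unfolding serre_D_def E2_S[OF z] Sf[OF z] by simp
      also have "\<dots> = z ^ (2 * (i + 1)) * serre_D (2 * real i) f z"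
        unfolding D serre_D_def by (simp add: field_simps power_add power2_eq_square)
      finally show ?thesis .
    qed
  qed
qed

text \<open>\<open>serre_D 4 E4 + E6 / 3\<close> has weight 6 and constant term -4/12 + 1/3 = 0, so
  it is a cusp form of small weight.\<close>

lemma ramanujan_E4:
  assumes z: "z \<in> uhp" shows "serre_D 4 E4 z = - E6 z / 3"
proof -
  have m: "mf 3 (\<lambda>z. serre_D 4 E4 z + 1/3 * E6 z)"
    using mf_serre_D[OF mf_E4] by (intro mf_add mf_cmult mf_E6) simp
  have q: "qexp (\<lambda>z. serre_D 4 E4 z + 1/3 * E6 z) (\<lambda>q. (q * deriv E4q q - of_real 4 / 12 * E2q q * E4q q) + 1/3 * E6q q)"
    by (intro qexp_add qexp_mult qexp_const qexp_serre_D qexp_E4 qexp_E6)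
  have "serre_D 4 E4 z + 1/3 * E6 z = 0"
    by (rule cusp_form_small_weight[OF m q _ _ z]) (simp_all add: Eq_0)
  thus ?thesis by (simp add: algebra_simps eq_neg_iff_add_eq_0)
qed

lemma ramanujan_E6:
  assumes z: "z \<in> uhp" shows "serre_D 6 E6 z = - (E4 z ^ 2) / 2"
proof -
  have m: "mf 4 (\<lambda>z. serre_D 6 E6 z + 1/2 * E4 z ^ 2)"
    using mf_serre_D[OF mf_E6] mf_power[OF mf_E4, of 2] by (intro mf_add mf_cmult) simp_all
  have q: "qexp (\<lambda>z. serre_D 6 E6 z + 1/2 * E4 z ^ 2) (\<lambda>q. (q * deriv E6q q - of_real 6 / 12 * E2q q * E6q q) + 1/2 * E4q q ^ 2)"
    by (intro qexp_add qexp_mult qexp_const qexp_power qexp_serre_D qexp_E4 qexp_E6)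
  have "serre_D 6 E6 z + 1/2 * E4 z ^ 2 = 0"
    by (rule cusp_form_small_weight[OF m q _ _ z]) (simp_all add: Eq_0)
  thus ?thesis by (simp add: algebra_simps eq_neg_iff_add_eq_0)
qed

text \<open>Neither the derivative nor the square of \<open>E2\<close> is modular, but in E2' -
  E2^2/12 the extra terms cancel; adding E4/12 removes the constant term.\<close>

lemma ramanujan_E2:
  assumes z: "z \<in> uhp" shows "nderiv E2 z = (E2 z ^ 2 - E4 z) / 12"
proof -
  have q: "qexp (\<lambda>z. (nderiv E2 z - 1/12 * E2 z ^ 2) + 1/12 * E4 z) (\<lambda>q. (q * deriv E2q q - 1/12 * E2q q ^ 2) + 1/12 * E4q q)"
    by (intro qexp_add qexp_diff qexp_mult qexp_const qexp_power qexp_nderiv qexp_E4 qexp_E2)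
  have m: "mf 2 (\<lambda>z. (nderiv E2 z - 1/12 * E2 z ^ 2) + 1/12 * E4 z)"
  proof (rule mf_qexpI[OF q])
    fix z assume z: "z \<in> uhp"
    let ?p = "of_real pi * \<i> :: complex"
    have "E2 (- 1 / z) = z ^ 2 * E2 z + 6 / ?p * z ^ (2 - 1)" if "z \<in> uhp" for z
      using E2_S[OF that] by simp
    hence D: "nderiv E2 (- 1 / z) = z ^ 4 * nderiv E2 z + (2 * z ^ 3 * E2 z + 6 / ?p * z ^ 2) / (2 * ?p)"
      using nderiv_S[OF E2_holomorphic, of 2 "6 / ?p" z] z by (simp add: mult.assoc)
    show "nderiv E2 (- 1 / z) - 1/12 * E2 (- 1 / z) ^ 2 + 1/12 * E4 (- 1 / z) = 
        z ^ (2 * 2) * (nderiv E2 z - 1/12 * E2 z ^ 2 + 1/12 * E4 z)"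
      unfolding D E2_S[OF z] E4_S[OF z] 
      by (simp add: field_simps eval_nat_numeral)
  qed
  have "(nderiv E2 z - 1/12 * E2 z ^ 2) + 1/12 * E4 z = 0"
    by (rule cusp_form_small_weight[OF m q _ _ z]) (simp_all add: Eq_0)
  thus ?thesis by (simp add: field_simps)
qed

definition Disc :: "complex \<Rightarrow> complex" where "Disc z = (E4 z ^ 3 - E6 z ^ 2) / 1728"
definition Discq :: "complex \<Rightarrow> complex" where "Discq q = (E4q q ^ 3 - E6q q ^ 2) / 1728"

lemma mf_Disc: "mf 6 Disc"
proof -
  have "mf 6 (\<lambda>z. 1 / 1728 * (E4 z ^ 3 - E6 z ^ 2))"
    using mf_power[OF mf_E4, of 3] mf_power[OF mf_E6, of 2] by (intro mf_cmult mf_diff) simp_all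
  thus ?thesis by (simp add: Disc_def[abs_def])
qed

lemma qexp_Disc: "qexp Disc Discq"
proof -
  have "qexp (\<lambda>z. 1 / 1728 * (E4 z ^ 3 - E6 z ^ 2)) (\<lambda>q. 1 / 1728 * (E4q q ^ 3 - E6q q ^ 2))"
    by (intro qexp_mult qexp_const qexp_diff qexp_power qexp_E4 qexp_E6)
  thus ?thesis by (simp add: Disc_def[abs_def] Discq_def[abs_def])
qed

text \<open>A simple zero at the cusp. It shows that \<open>Disc\<close> is not identically zero,
  and that division by it costs a single factor q.\<close>

lemma Discq_0: "Discq 0 = 0" "deriv Discq 0 = 1"
proof -
  show "Discq 0 = 0" by (simp add: Discq_def Eq_0)
  have e: "(eis_series k has_field_derivative 1) (at 0)" for k
    using holomorphic_derivI[OF eis_series_holomorphic open_ball, of 0] by (simp add: eis_series_deriv_0)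
  have "(Discq has_field_derivative (3 * 240 + 2 * 504) / 1728) (at 0)"
    unfolding Discq_def[abs_def] E4q_def E6q_def
    by (rule derivative_eq_intros e refl | simp add: eis_series_0)+
  thus "deriv Discq 0 = 1" by (simp add: DERIV_imp_deriv)
qed

lemma nderiv_Disc:
  assumes z: "z \<in> uhp" shows "deriv Disc z = 2 * of_real pi * \<i> * E2 z * Disc z"
proof -
  let ?c = "2 * of_real pi * \<i> :: complex"
  have 4: "deriv E4 z = ?c * ((E2 z * E4 z - E6 z) / 3)" and 6: "deriv E6 z = ?c * ((E2 z * E6 z - E4 z ^ 2) / 2)"
  proof -
    have n: "nderiv E4 z = (E2 z * E4 z - E6 z) / 3" "nderiv E6 z = (E2 z * E6 z - E4 z ^ 2) / 2"
      using ramanujan_E4[OF z] ramanujan_E6[OF z] by (simp_all add: serre_D_def field_simps)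
    have "deriv f z = ?c * nderiv f z" for f by (simp add: nderiv_def)
    from this[of E4] this[of E6]
    show "deriv E4 z = ?c * ((E2 z * E4 z - E6 z) / 3)" "deriv E6 z = ?c * ((E2 z * E6 z - E4 z ^ 2) / 2)"
      unfolding n by simp_all
  qed
  have "(Disc has_field_derivative (3 * E4 z ^ 2 * deriv E4 z - 2 * E6 z * deriv E6 z) / 1728) (at z)"
    unfolding Disc_def[abs_def]
    by (rule derivative_eq_intros uhp_derivI[OF E4_holomorphic z] uhp_derivI[OF E6_holomorphic z] refl | simp)+
  hence "deriv Disc z = (3 * E4 z ^ 2 * deriv E4 z - 2 * E6 z * deriv E6 z) / 1728" by (rule DERIV_imp_deriv)
  also have "\<dots> = ?c * E2 z * Disc z" unfolding 4 6 Disc_def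
    by (simp add: field_simps eval_nat_numeral)
  finally show ?thesis .
qed

text \<open>\<open>\<Delta>\<close> solves the linear equation \<open>\<Delta>' = E\<^sub>2 \<Delta>\<close>, so a zero would make it vanish identically.\<close>

lemma Disc_nonzero:
  assumes z: "z \<in> uhp" shows "Disc z \<noteq> 0"
proof
  assume z0: "Disc z = 0"
  have "(\<lambda>z. 2 * of_real pi * \<i> * E2 z) holomorphic_on uhp"
    by (intro holomorphic_intros E2_holomorphic)
  then obtain g where g: "\<And>z. z \<in> uhp \<Longrightarrow> (g has_field_derivative 2 * of_real pi * \<i> * E2 z) (at z within uhp)"
    using holomorphic_convex_primitive'[OF convex_uhp open_uhp] by blast
  have g': "(g has_field_derivative 2 * of_real pi * \<i> * E2 w) (at w)" if "w \<in> uhp" for w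
    using g[OF that] at_within_open[OF that open_uhp] by simp
  have "((\<lambda>w. Disc w * exp (- g w)) has_field_derivative 0) (at w within uhp)" if w: "w \<in> uhp" for w
  proof (rule has_field_derivative_at_within)
    have "((\<lambda>w. Disc w * exp (- g w)) has_field_derivative
       deriv Disc w * exp (- g w) + exp (- g w) * (- (2 * of_real pi * \<i> * E2 w)) * Disc w) (at w)"
      by (rule derivative_eq_intros uhp_derivI[OF mf_holomorphic[OF mf_Disc] w] g'[OF w] refl | simp)+
    thus "((\<lambda>w. Disc w * exp (- g w)) has_field_derivative 0) (at w)"
      unfolding nderiv_Disc[OF w] by (simp add: algebra_simps)
  qed
  then obtain C where C: "\<And>w. w \<in> uhp \<Longrightarrow> Disc w * exp (- g w) = C"
    using has_field_derivative_zero_constant[OF convex_uhp, of "\<lambda>w. Disc w * exp (- g w)"] by auto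
  from C[OF z] z0 have "C = 0" by simp
  hence "Disc w = 0" if "w \<in> uhp" for w using C[OF that] by simp
  hence "Discq (qpar w) = 0" if "w \<in> uhp" for w using qexp_Disc that by (simp add: qexp_def)
  hence *: "Discq q = 0" if "q \<in> ball 0 1" for q
    using qexp_unique_0[of Discq "\<lambda>_. 0"] qexp_Disc that by (simp add: qexp_def)
  have "(Discq has_field_derivative 0) (at 0)"
    by (rule has_field_derivative_transform_within_open[OF DERIV_const[of 0] open_ball[of 0 1]]) (use * in auto)
  thus False using Discq_0 by (simp add: DERIV_imp_deriv)
qed

text \<open>In the disc \<open>Discq\<close> vanishes only at q = 0, and simply; a cusp form
  vanishes there too, so the quotient is holomorphic at the cusp.\<close>

lemma cusp_form_quotient:
  assumes f: "mf (i + 6) f" and F: "qexp f F" "F 0 = 0"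
  obtains g where "mf i g" "\<And>z. z \<in> uhp \<Longrightarrow> f z = Disc z * g z"
proof -
  obtain H where H: "H holomorphic_on ball 0 1" "\<And>q. F q = q * H q"
    using holomorphic_factor_zero[of F] F unfolding qexp_def by metis
  obtain G where G: "G holomorphic_on ball 0 1" "\<And>q. Discq q = q * G q" "G 0 = 1"
    using holomorphic_factor_zero[of Discq] qexp_Disc Discq_0 unfolding qexp_def by metis
  have Gnz: "G q \<noteq> 0" if q: "q \<in> ball 0 1" for q
  proof (cases "q = 0")
    case False
    obtain z where "z \<in> uhp" "qpar z = q" using qpar_surj[OF q False] by blast
    hence "Discq q \<noteq> 0" using Disc_nonzero[of z] qexp_Disc by (simp add: qexp_def)
    thus ?thesis using G(2)[of q] by simp
  qed (simp add: G)
  define g where "g = (\<lambda>z. f z / Disc z)"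
  have q: "qexp g (\<lambda>q. H q / G q)"
    unfolding qexp_def
  proof (intro conjI ballI)
    show "(\<lambda>q. H q / G q) holomorphic_on ball 0 1" by (intro holomorphic_intros H G Gnz)
    fix z assume z: "z \<in> uhp"
    have "f z = qpar z * H (qpar z)" "Disc z = qpar z * G (qpar z)"
      using F H(2) G(2) qexp_Disc z by (simp_all add: qexp_def)
    thus "g z = H (qpar z) / G (qpar z)" by (simp add: g_def)
  qed
  have "mf i g"
  proof (rule mf_qexpI[OF q])
    fix z assume z: "z \<in> uhp"
    have "f (- 1 / z) = z ^ (2 * (i + 6)) * f z" "Disc (- 1 / z) = z ^ (2 * 6) * Disc z"
      by (rule mf_S[OF f z] mf_S[OF mf_Disc z])+
    moreover have "z ^ (2 * (i + 6)) = z ^ (2 * i) * z ^ (2 * 6)" by (simp flip: power_add)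
    ultimately show "g (- 1 / z) = z ^ (2 * i) * g z"
      using uhp_nonzero[OF z] Disc_nonzero[OF z] by (simp add: g_def del: power_Suc)
  qed
  moreover have "f z = Disc z * g z" if "z \<in> uhp" for z using Disc_nonzero[OF that] by (simp add: g_def)
  ultimately show ?thesis using that by blast
qed

section \<open>Modules over the ring of modular forms\<close>

text \<open>\<open>espan I v d e f\<close>: \<open>f\<close> is a homogeneous combination of the \<open>v i\<close> over \<open>\<complex>[E\<^sub>4, E\<^sub>6]\<close>, of
  half-weight \<open>e\<close> when \<open>v i\<close> is given the half-weight \<open>d i\<close>.\<close>

inductive espan :: "'i set \<Rightarrow> ('i \<Rightarrow> complex \<Rightarrow> complex) \<Rightarrow> ('i \<Rightarrow> nat) \<Rightarrow> nat \<Rightarrow> (complex \<Rightarrow> complex) \<Rightarrow> bool"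
  for I v d e where
  zero: "(\<And>z. z \<in> uhp \<Longrightarrow> f z = 0) \<Longrightarrow> espan I v d e f"
| step: "espan I v d e g \<Longrightarrow> i \<in> I \<Longrightarrow> d i + 2 * a + 3 * b = e \<Longrightarrow>
    (\<And>z. z \<in> uhp \<Longrightarrow> f z = c * E4 z ^ a * E6 z ^ b * v i z + g z) \<Longrightarrow> espan I v d e f"

lemma espan_cong: "espan I v d e f \<Longrightarrow> (\<And>z. z \<in> uhp \<Longrightarrow> f z = g z) \<Longrightarrow> espan I v d e g"
  by (cases rule: espan.cases, assumption) (auto intro: espan.intros)

lemma espan_add: "espan I v d e f \<Longrightarrow> espan I v d e g \<Longrightarrow> espan I v d e (\<lambda>z. f z + g z)"
proof (induction rule: espan.induct)
  case (zero f)
  show ?case by (rule espan_cong[OF zero(2)]) (simp add: zero(1))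
next
  case (step g' i a b f c)
  show ?case by (rule espan.step[OF step.IH[OF step.prems] step.hyps(2,3), of _ c]) (simp add: step.hyps(4))
qed

lemma espan_monom: "i \<in> I \<Longrightarrow> d i + 2 * a + 3 * b = e \<Longrightarrow> espan I v d e (\<lambda>z. c * E4 z ^ a * E6 z ^ b * v i z)"
  by (rule espan.step[OF espan.zero[of "\<lambda>_. 0"]]) auto

lemma espan_gen: "i \<in> I \<Longrightarrow> espan I v d (d i) (v i)"
  using espan_monom[of i I d 0 0 "d i" v 1] by simp

lemma espan_monom_mult: "espan I v d e f \<Longrightarrow> espan I v d (e + 2 * p + 3 * q) (\<lambda>z. c * E4 z ^ p * E6 z ^ q * f z)"
proof (induction rule: espan.induct)
  case (zero f)
  thus ?case by (intro espan.zero) simp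
next
  case (step g i a b f c')
  show ?case
    by (rule espan.step[OF step.IH step.hyps(2), of "a + p" "b + q" _ "c * c'"])
       (use step.hyps(3) in \<open>simp_all add: step.hyps(4) power_add algebra_simps\<close>)
qed

lemma espan_cmult: "espan I v d e f \<Longrightarrow> espan I v d e (\<lambda>z. c * f z)"
  using espan_monom_mult[of I v d e f 0 0 c] by simp

lemma espan_sum: "finite A \<Longrightarrow> (\<And>x. x \<in> A \<Longrightarrow> espan I v d e (f x)) \<Longrightarrow> espan I v d e (\<lambda>z. \<Sum>x\<in>A. f x z)"
  by (induction A rule: finite_induct) (auto intro: espan_add espan.zero)

lemma espan_embed:
  assumes "espan I v d e f" "\<And>i. i \<in> I \<Longrightarrow> h i \<in> J \<and> v i = w (h i) \<and> d i = d' (h i)"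
  shows "espan J w d' e f"
  using assms(1)
proof (induction rule: espan.induct)
  case (zero f) thus ?case by (intro espan.zero)
next
  case (step g i a b f c)
  show ?case by (rule espan.step[OF step.IH, of "h i" a b _ c]) (use step.hyps assms(2)[of i] in auto)
qed

abbreviation ering :: "nat \<Rightarrow> (complex \<Rightarrow> complex) \<Rightarrow> bool" where
  "ering \<equiv> espan {()} (\<lambda>_ _. 1) (\<lambda>_. 0)"

text \<open>The products of f with E4 and E6 have weights 6 and 8 and are determined by their values
  at the cusp: f E4 = F(0) E6 and f E6 = F(0) E4^2. Eliminating f shows that F(0) times the
  discriminant is 0.\<close>

lemma mf_weight_2:
  assumes f: "mf 1 f" and z: "z \<in> uhp"
  shows "f z = 0"
proof -
  obtain F where F: "qexp f F" using mf_qexp[OF f] by blast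
  have m3: "mf 3 (\<lambda>z. f z * E4 z - F 0 * E6 z)"
    using mf_mult[OF f mf_E4] by (intro mf_diff mf_cmult mf_E6) (simp add: numeral_3_eq_3)
  have q3: "qexp (\<lambda>z. f z * E4 z - F 0 * E6 z) (\<lambda>q. F q * E4q q - F 0 * E6q q)"
    by (intro qexp_diff qexp_mult qexp_const F qexp_E4 qexp_E6)
  have 3: "f z * E4 z - F 0 * E6 z = 0"
    by (rule cusp_form_small_weight[OF m3 q3 _ _ z]) (simp_all add: Eq_0)
  have m4: "mf 4 (\<lambda>z. f z * E6 z - F 0 * E4 z ^ 2)"
    using mf_mult[OF f mf_E6] mf_power[OF mf_E4, of 2] by (intro mf_diff mf_cmult) simp_all
  have q4: "qexp (\<lambda>z. f z * E6 z - F 0 * E4 z ^ 2) (\<lambda>q. F q * E6q q - F 0 * E4q q ^ 2)"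
    by (intro qexp_diff qexp_mult qexp_const qexp_power F qexp_E4 qexp_E6)
  have 4: "f z * E6 z - F 0 * E4 z ^ 2 = 0"
    by (rule cusp_form_small_weight[OF m4 q4 _ _ z]) (simp_all add: Eq_0)
  have "F 0 * (E4 z ^ 3 - E6 z ^ 2) = E6 z * (f z * E4 z - F 0 * E6 z) - E4 z * (f z * E6 z - F 0 * E4 z ^ 2)"
    by (simp add: algebra_simps eval_nat_numeral)
  hence "F 0 * (1728 * Disc z) = 0" using 3 4 by (simp add: Disc_def)
  hence "F 0 = 0" using Disc_nonzero[OF z] by simp
  thus ?thesis by (intro cusp_form_small_weight[OF f F _ _ z]) auto
qed

text \<open>For every half-weight i \<noteq> 1 there is a monomial in E4 and E6, with constant term
  1. Subtracting a multiple of it leaves a cusp form, which is zero or \<open>Disc\<close> times a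
  form of half-weight i - 6.\<close>

lemma mf_imp_ering: "mf i f \<Longrightarrow> ering i f"
proof (induction i arbitrary: f rule: less_induct)
  case (less i)
  show ?case
  proof (cases "i = 1")
    case True
    thus ?thesis using mf_weight_2 less.prems by (intro espan.zero) auto
  next
    case False
    obtain a b where ab: "2 * a + 3 * b = i"
    proof (cases "even i")
      case True
      thus ?thesis using that[of "i div 2" 0] by simp
    next
      case odd: False
      hence "2 * ((i - 3) div 2) + 3 * 1 = i" using False by presburger
      thus ?thesis by (rule that)
    qed
    obtain F where F: "qexp f F" using mf_qexp[OF less.prems] by blast
    define g where "g = (\<lambda>z. f z - F 0 * (E4 z ^ a * E6 z ^ b))"
    have mono: "mf i (\<lambda>z. E4 z ^ a * E6 z ^ b)"
      using mf_mult[OF mf_power[OF mf_E4, of a] mf_power[OF mf_E6, of b]] ab by (simp add: mult.commute)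
    have g: "mf i g" unfolding g_def by (intro mf_diff mf_cmult mono less.prems)
    have G: "qexp g (\<lambda>q. F q - F 0 * (E4q q ^ a * E6q q ^ b))"
      unfolding g_def by (intro qexp_diff qexp_mult qexp_const qexp_power qexp_E4 qexp_E6 F)
    have G0: "F 0 - F 0 * (E4q 0 ^ a * E6q 0 ^ b) = 0" by (simp add: Eq_0)
    have "ering i g"
    proof (cases "i \<le> 5")
      case True
      thus ?thesis using cusp_form_small_weight[OF g G G0] by (intro espan.zero) auto
    next
      case big: False
      hence "mf ((i - 6) + 6) g" using g by simp
      then obtain h where h: "mf (i - 6) h" "\<And>z. z \<in> uhp \<Longrightarrow> g z = Disc z * h z"
        using cusp_form_quotient[OF _ G G0] by blast
      have "ering (i - 6) h" using h(1) big by (intro less.IH) auto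
      from espan_monom_mult[OF this, of 3 0 "1/1728"] espan_monom_mult[OF this, of 0 2 "-1/1728"] big
      have "ering i (\<lambda>z. 1/1728 * E4 z ^ 3 * E6 z ^ 0 * h z)" "ering i (\<lambda>z. -1/1728 * E4 z ^ 0 * E6 z ^ 2 * h z)"
        by simp_all
      from espan_add[OF this] show ?thesis
        by (rule espan_cong) (simp add: h(2) Disc_def field_simps)
    qed
    moreover have "ering i (\<lambda>z. F 0 * E4 z ^ a * E6 z ^ b * 1)"
      by (rule espan_monom) (use ab in auto)
    ultimately have "ering i (\<lambda>z. g z + F 0 * E4 z ^ a * E6 z ^ b * 1)" by (rule espan_add)
    thus ?thesis by (rule espan_cong) (simp add: g_def)
  qed
qed

text \<open>By the structure theorem, spans with polynomial coefficients are modules over all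
  modular forms, the coefficients that a monic MLDE allows.\<close>

lemma espan_mf_mult:
  assumes "mf j g" "espan I v d e f"
  shows "espan I v d (j + e) (\<lambda>z. g z * f z)"
  using mf_imp_ering[OF assms(1)]
proof (induction rule: espan.induct)
  case (zero g) thus ?case by (intro espan.zero) simp
next
  case (step g' i a b g c)
  have "espan I v d (j + e) (\<lambda>z. c * E4 z ^ a * E6 z ^ b * f z)"
    using espan_monom_mult[OF assms(2), of a b c] step.hyps(3) by (simp add: add_ac)
  from espan_add[OF this step.IH] show ?case
    by (rule espan_cong) (simp add: step.hyps(4) algebra_simps)
qed

lemma espan_holomorphic:
  assumes "espan I v d e f" "\<And>i. i \<in> I \<Longrightarrow> v i holomorphic_on uhp"
  shows "f holomorphic_on uhp"
  using assms(1)
proof (induction rule: espan.induct)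
  case (zero f)
  show ?case by (rule holomorphic_transform[of "\<lambda>_. 0"]) (auto simp: zero)
next
  case (step g i a b f c)
  show ?case
    by (rule holomorphic_transform[of "\<lambda>z. c * E4 z ^ a * E6 z ^ b * v i z + g z"])
       (auto simp: step.hyps intro!: holomorphic_intros E4_holomorphic E6_holomorphic assms step)
qed

section \<open>The Serre derivative and its action on modules\<close>

lemma deriv_cong_uhp:
  assumes "\<And>z. z \<in> uhp \<Longrightarrow> f z = g z" "z \<in> uhp"
  shows "deriv f z = deriv g z"
  by (rule deriv_cong_ev) (use assms in \<open>auto intro!: eventually_mono[OF eventually_nhds_in_open[OF open_uhp]]\<close>)

lemma serre_D_cong: "(\<And>z. z \<in> uhp \<Longrightarrow> f z = g z) \<Longrightarrow> z \<in> uhp \<Longrightarrow> serre_D k f z = serre_D k g z"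
  using deriv_cong_uhp[of f g z] by (simp add: serre_D_def nderiv_def)

lemma serre_D_holomorphic: "f holomorphic_on uhp \<Longrightarrow> serre_D k f holomorphic_on uhp"
  unfolding serre_D_def[abs_def] nderiv_def
  by (intro holomorphic_intros holomorphic_deriv open_uhp E2_holomorphic) auto

lemma serre_D_add:
  assumes "f holomorphic_on uhp" "g holomorphic_on uhp" "z \<in> uhp"
  shows "serre_D k (\<lambda>z. f z + g z) z = serre_D k f z + serre_D k g z"
proof -
  have "deriv (\<lambda>z. f z + g z) z = deriv f z + deriv g z"
    by (rule DERIV_imp_deriv[OF DERIV_add[OF uhp_derivI uhp_derivI]]) (use assms in auto)
  thus ?thesis by (simp add: serre_D_def nderiv_def add_divide_distrib algebra_simps)
qed

lemma serre_D_mult: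
  assumes "f holomorphic_on uhp" "g holomorphic_on uhp" "z \<in> uhp"
  shows "serre_D (k + l) (\<lambda>z. f z * g z) z = serre_D k f z * g z + f z * serre_D l g z"
proof -
  have "deriv (\<lambda>z. f z * g z) z = deriv f z * g z + deriv g z * f z"
    by (rule DERIV_imp_deriv[OF DERIV_mult[OF uhp_derivI uhp_derivI]]) (use assms in auto)
  thus ?thesis by (simp add: serre_D_def nderiv_def add_divide_distrib algebra_simps)
qed

lemma serre_D_zero: "(\<And>z. z \<in> uhp \<Longrightarrow> f z = 0) \<Longrightarrow> z \<in> uhp \<Longrightarrow> serre_D k f z = 0"
  using serre_D_cong[of f "\<lambda>_. 0" z k] by (simp add: serre_D_def nderiv_def)

text \<open>By the Leibniz rule it suffices to differentiate generators, since coefficients stay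
  modular under their own Serre derivative. The real offset \<open>k\<close> gives the i-th
  generator the weight \<open>k + 2 * d i\<close>, so half-weights in the module are natural numbers
  while the weights of functions are arbitrary.\<close>

lemma espan_serre_D:
  assumes v: "\<And>i. i \<in> I \<Longrightarrow> v i holomorphic_on uhp"
    and D: "\<And>i. i \<in> I \<Longrightarrow> espan I v d (d i + 1) (serre_D (k + 2 * real (d i)) (v i))"
    and f: "espan I v d e f"
  shows "espan I v d (e + 1) (serre_D (k + 2 * real e) f)"
  using f
proof (induction rule: espan.induct)
  case (zero f)
  thus ?case by (intro espan.zero) (rule serre_D_zero)
next
  case (step g i a b f c)
  define m where "m = (\<lambda>z. c * (E4 z ^ a * E6 z ^ b))"
  define w where "w = 2 * a + 3 * b"
  have m: "mf w m" unfolding m_def w_def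
    using mf_mult[OF mf_power[OF mf_E4, of a] mf_power[OF mf_E6, of b]] by (intro mf_cmult) (simp add: mult.commute)
  have hol: "m holomorphic_on uhp" "v i holomorphic_on uhp" "g holomorphic_on uhp"
    using mf_holomorphic[OF m] v step.hyps(2) espan_holomorphic[OF step.hyps(1) v] by auto
  have e: "w + d i = e" using step.hyps(3) by (simp add: w_def)
  have "espan I v d (w + 1 + d i) (\<lambda>z. serre_D (2 * real w) m z * v i z)"
    by (intro espan_mf_mult mf_serre_D m espan_gen step.hyps)
  moreover have "espan I v d (w + (d i + 1)) (\<lambda>z. m z * serre_D (k + 2 * real (d i)) (v i) z)"
    by (intro espan_mf_mult m D step.hyps)
  ultimately have "espan I v d (e + 1) (\<lambda>z. (serre_D (2 * real w) m z * v i z + m z * serre_D (k + 2 * real (d i)) (v i) z) + serre_D (k + 2 * real e) g z)"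
    using e by (intro espan_add step.IH) (simp_all add: add_ac)
  thus ?case
  proof (rule espan_cong)
    fix z assume z: "z \<in> uhp"
    have "serre_D (k + 2 * real e) f z = serre_D (k + 2 * real e) (\<lambda>z. m z * v i z + g z) z"
      by (rule serre_D_cong[OF _ z]) (simp add: step.hyps(4) m_def mult_ac)
    also have "\<dots> = serre_D (k + 2 * real e) (\<lambda>z. m z * v i z) z + serre_D (k + 2 * real e) g z"
      by (intro serre_D_add holomorphic_intros hol z)
    also have "k + 2 * real e = 2 * real w + (k + 2 * real (d i))" using e by auto
    also have "serre_D (2 * real w + (k + 2 * real (d i))) (\<lambda>z. m z * v i z) z = 
       serre_D (2 * real w) m z * v i z + m z * serre_D (k + 2 * real (d i)) (v i) z"
      by (intro serre_D_mult hol z)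
    finally show "(serre_D (2 * real w) m z * v i z + m z * serre_D (k + 2 * real (d i)) (v i) z) + serre_D (k + 2 * real e) g z
        = serre_D (k + 2 * real e) f z"
      using e by (auto simp: algebra_simps)
  qed
qed

section \<open>The Noetherian property\<close>

text \<open>\<open>G\<close> consists of the indices whose value is at most every later one. A
  minimum of each tail lies in it, so it is infinite.\<close>

lemma nondecreasing_subsequence:
  fixes f :: "nat \<Rightarrow> nat"
  obtains r where "strict_mono r" "incseq (f \<circ> r)"
proof -
  define G where "G = {n. \<forall>m\<ge>n. f n \<le> f m}"
  have "\<exists>n\<ge>N. n \<in> G" for N
  proof -
    define n where "n = (ARG_MIN f m. m \<ge> N)"
    have n: "n \<ge> N" "\<And>m. m \<ge> N \<Longrightarrow> f n \<le> f m"
      unfolding n_def using arg_min_nat_lemma[of "\<lambda>m. m \<ge> N" N f] by auto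
    thus ?thesis unfolding G_def by (intro exI[of _ n]) auto
  qed
  hence inf: "infinite G" unfolding infinite_nat_iff_unbounded_le by blast
  have "incseq (f \<circ> enumerate G)"
  proof (rule incseq_SucI)
    fix n
    have "enumerate G n \<in> G" by (rule enumerate_in_set[OF inf])
    thus "(f \<circ> enumerate G) n \<le> (f \<circ> enumerate G) (Suc n)"
      using enumerate_step[OF inf, of n] by (auto simp: G_def)
  qed
  thus ?thesis using that strict_mono_enumerate[OF inf] by blast
qed

text \<open>The pigeonhole principle handles the finite index set, and two passages to a
  nondecreasing subsequence handle the exponents.\<close>

lemma dickson:
  fixes t :: "nat \<Rightarrow> 'i \<times> nat \<times> nat"
  assumes "finite I" "\<And>n. fst (t n) \<in> I"
  obtains m n i a b a' b' where "m < n" "t m = (i, a, b)" "t n = (i, a', b')" "a \<le> a'" "b \<le> b'"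
proof -
  have "\<exists>i\<in>I. infinite {n. fst (t n) = i}"
  proof (rule ccontr)
    assume "\<not> ?thesis"
    hence "finite (\<Union>i\<in>I. {n. fst (t n) = i})" using assms(1) by auto
    moreover have "(\<Union>i\<in>I. {n. fst (t n) = i}) = UNIV" using assms(2) by auto
    ultimately show False by simp
  qed
  then obtain i where i: "infinite {n. fst (t n) = i}" by blast
  define u where "u = enumerate {n. fst (t n) = i}"
  have u: "strict_mono u" "\<And>n. fst (t (u n)) = i"
    unfolding u_def using strict_mono_enumerate[OF i] enumerate_in_set[OF i] by auto
  obtain r where r: "strict_mono r" "incseq ((\<lambda>n. fst (snd (t (u n)))) \<circ> r)"
    using nondecreasing_subsequence by blast
  obtain s where s: "strict_mono s" "incseq ((\<lambda>n. snd (snd (t (u (r n))))) \<circ> s)"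
    using nondecreasing_subsequence by blast
  define m n where "m = u (r (s 0))" and "n = u (r (s 1))"
  have s01: "s 0 < s 1" using s(1) by (simp add: strict_mono_def)
  hence rs: "r (s 0) < r (s 1)" using r(1) by (simp add: strict_mono_def)
  hence "m < n" using u(1) by (simp add: m_def n_def strict_mono_def)
  moreover have "fst (snd (t m)) \<le> fst (snd (t n))"
    using incseqD[OF r(2), of "s 0" "s 1"] s01 by (simp add: m_def n_def)
  moreover have "snd (snd (t m)) \<le> snd (snd (t n))"
    using incseqD[OF s(2), of 0 1] by (simp add: m_def n_def)
  moreover have "fst (t m) = i" "fst (t n) = i" by (simp_all add: m_def n_def u)
  ultimately show ?thesis using that[of m n i] by (metis prod.collapse)
qed

text \<open>Formal side of the Noetherian argument: homogeneous elements of the free module over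
  \<open>\<complex>[E\<^sub>4, E\<^sub>6]\<close> with basis \<open>I\<close> are coefficient functions on monomials \<open>(i, a, b)\<close>,
  standing for \<open>E\<^sub>4\<^sup>a E\<^sub>6\<^sup>b\<close> times the \<open>i\<close>-th basis vector.\<close>

definition mons :: "'i set \<Rightarrow> ('i \<Rightarrow> nat) \<Rightarrow> nat \<Rightarrow> ('i \<times> nat \<times> nat) set" where
  "mons I d e = {(i, a, b). i \<in> I \<and> d i + 2 * a + 3 * b = e}"

text \<open>Multiplication by E4^p E6^q on coefficient functions.\<close>

definition shift :: "nat \<Rightarrow> nat \<Rightarrow> ('i \<times> nat \<times> nat \<Rightarrow> complex) \<Rightarrow> 'i \<times> nat \<times> nat \<Rightarrow> complex" where
  "shift p q x = (\<lambda>(i, a, b). if p \<le> a \<and> q \<le> b then x (i, a - p, b - q) else 0)"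

text \<open>The part of degree \<open>w\<close> of the submodule generated by \<open>c 0\<close>,
  ..., \<open>c (m - 1)\<close>. The index of a generator is also its degree, as for the iterated
  derivatives to which this is applied.\<close>

inductive subm :: "(nat \<Rightarrow> 'i \<times> nat \<times> nat \<Rightarrow> complex) \<Rightarrow> nat \<Rightarrow> nat \<Rightarrow> ('i \<times> nat \<times> nat \<Rightarrow> complex) \<Rightarrow> bool"
  for c m where
  zero: "subm c m w (\<lambda>_. 0)"
| step: "subm c m w x \<Longrightarrow> j < m \<Longrightarrow> j + 2 * p + 3 * q = w \<Longrightarrow> subm c m w (\<lambda>t. \<alpha> * shift p q (c j) t + x t)"

lemma finite_mons: "finite I \<Longrightarrow> finite (mons I d e)"
  by (rule finite_subset[of _ "I \<times> {..e} \<times> {..e}"]) (auto simp: mons_def)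

lemma shift_mons: "(\<And>t. x t \<noteq> 0 \<Longrightarrow> t \<in> mons I d e) \<Longrightarrow> shift p q x t \<noteq> 0 \<Longrightarrow> t \<in> mons I d (e + 2 * p + 3 * q)"
  by (force simp: shift_def mons_def split: prod.splits if_splits)

lemma shift_zero: "shift p q (\<lambda>_. 0) = (\<lambda>_. 0)"
  by (auto simp: shift_def)

lemma shift_linear: "shift p q (\<lambda>t. \<alpha> * x t + y t) = (\<lambda>t. \<alpha> * shift p q x t + shift p q y t)"
  by (rule ext) (auto simp: shift_def split: prod.splits)

lemma shift_shift: "shift p q (shift p' q' x) = shift (p + p') (q + q') x"
proof
  fix t :: "'a \<times> nat \<times> nat"
  obtain i a b where t: "t = (i, a, b)" by (cases t)
  have "p \<le> a \<and> p' \<le> a - p \<longleftrightarrow> p + p' \<le> a" "q \<le> b \<and> q' \<le> b - q \<longleftrightarrow> q + q' \<le> b" by auto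
  thus "shift p q (shift p' q' x) t = shift (p + p') (q + q') x t"
    unfolding t shift_def by auto
qed

lemma subm_add: "subm c m w x \<Longrightarrow> subm c m w y \<Longrightarrow> subm c m w (\<lambda>t. x t + y t)"
proof (induction rule: subm.induct)
  case (step w x j p q \<alpha>)
  from subm.step[OF step.IH[OF step.prems] step.hyps(2,3), of \<alpha>] show ?case by (simp add: add_ac)
qed simp

lemma subm_scale: "subm c m w x \<Longrightarrow> subm c m w (\<lambda>t. \<beta> * x t)"
proof (induction rule: subm.induct)
  case (step w x j p q \<alpha>)
  from subm.step[OF step.IH step.hyps(2,3), of "\<beta> * \<alpha>"] show ?case by (simp add: algebra_simps)
qed (simp add: subm.zero)

lemma subm_mono: "subm c m w x \<Longrightarrow> m \<le> m' \<Longrightarrow> subm c m' w x"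
  by (induction rule: subm.induct) (auto intro: subm.intros)

lemma subm_shift: "subm c m w x \<Longrightarrow> subm c m (w + 2 * p + 3 * q) (shift p q x)"
proof (induction rule: subm.induct)
  case (zero w)
  show ?case by (simp only: shift_zero subm.zero)
next
  case (step w x j p' q' \<alpha>)
  have "j + 2 * (p + p') + 3 * (q + q') = w + 2 * p + 3 * q" using step.hyps(3) by simp
  from subm.step[OF step.IH step.hyps(2) this] show ?case
    by (simp only: shift_linear shift_shift)
qed

lemma subm_gen: "j < m \<Longrightarrow> subm c m j (c j)"
proof -
  assume "j < m"
  from subm.step[OF subm.zero[of c m j] this, of 0 0 1] show ?thesis by (simp add: shift_def)
qed

lemma subm_mons:
  assumes "subm c m w x" "\<And>j t. c j t \<noteq> 0 \<Longrightarrow> t \<in> mons I d (e + j)" "x t \<noteq> 0"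
  shows "t \<in> mons I d (e + w)"
  using assms(1,3)
proof (induction arbitrary: t rule: subm.induct)
  case (step w x j p q \<alpha>)
  have "shift p q (c j) t \<noteq> 0 \<or> x t \<noteq> 0" using step.prems by auto
  thus ?case
  proof
    assume "shift p q (c j) t \<noteq> 0"
    hence "t \<in> mons I d (e + j + 2 * p + 3 * q)" using assms(2) by (intro shift_mons) 
    thus ?thesis using step.hyps(3) by (simp add: add_ac)
  qed (rule step.IH)
qed simp

text \<open>Among all elements of \<open>c n\<close> plus the submodule
  generated by its predecessors choose one whose leading monomial is minimal; by Dickson's lemma
  one of these leading monomials divides a later one, which could then be reduced further.\<close>

lemma noetherian:
  fixes c :: "nat \<Rightarrow> 'i \<times> nat \<times> nat \<Rightarrow> complex"
  assumes I: "finite I" and c: "\<And>j t. c j t \<noteq> 0 \<Longrightarrow> t \<in> mons I d (e + j)"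
  shows "\<exists>n. subm c n n (c n)"
proof (rule ccontr)
  assume neg: "\<not> ?thesis"
  obtain r :: "'i \<Rightarrow> nat" where r: "inj_on r I" using finite_imp_inj_to_nat_seg[OF I] by blast
  \<comment> \<open>\<open>b\<close> is left out because in a fixed degree it is determined by i and
    a. The lexicographic order of the keys is compatible with shifts.\<close>
  define key where "key = (\<lambda>(i, a::nat, b::nat). (r i, a))"
  define R where "R = (less_than <*lex*> less_than :: ((nat \<times> nat) \<times> (nat \<times> nat)) set)"
  have wfR: "wf R" and transR: "trans R" and totR: "\<And>x y. x \<noteq> y \<Longrightarrow> (x, y) \<in> R \<or> (y, x) \<in> R"
    by (auto simp: R_def)
  have key_inj: "s = t" if "s \<in> mons I d w" "t \<in> mons I d w" "key s = key t" for s t w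
  proof -
    obtain i a b i' a' b' where st: "s = (i, a, b)" "t = (i', a', b')" by (cases s, cases t)
    have "i = i'" "a = a'" using that inj_onD[OF r, of i i'] by (simp_all add: st key_def mons_def)
    thus ?thesis using that by (simp add: st mons_def)
  qed
  define lead where "lead = (\<lambda>(x :: 'i \<times> nat \<times> nat \<Rightarrow> complex) t. x t \<noteq> 0 \<and> (\<forall>s. x s \<noteq> 0 \<longrightarrow> key s = key t \<or> (key s, key t) \<in> R))"
  have lead_exists: "\<exists>t. lead x t" if x: "\<And>t. x t \<noteq> 0 \<Longrightarrow> t \<in> mons I d w" "x \<noteq> (\<lambda>_. 0)" for x w
  proof -
    have fin: "finite {t. x t \<noteq> 0}" by (rule finite_subset[OF _ finite_mons[OF I]]) (use x(1) in blast)
    obtain t0 where "x t0 \<noteq> 0" using x(2) by (meson ext)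
    have "\<exists>t\<in>S. \<forall>s\<in>S. key s = key t \<or> (key s, key t) \<in> R" if "finite S" "S \<noteq> {}" for S
      using that
    proof (induction S rule: finite_ne_induct)
      case (insert y S)
      then obtain t where t: "t \<in> S" "\<forall>s\<in>S. key s = key t \<or> (key s, key t) \<in> R" by blast
      show ?case
      proof (cases "key y = key t \<or> (key y, key t) \<in> R")
        case True thus ?thesis using t by blast
      next
        case False
        hence "(key t, key y) \<in> R" using totR by blast
        hence "\<forall>s\<in>S. (key s, key y) \<in> R" using t transR by (metis transD)
        thus ?thesis by blast
      qed
    qed simp
    from this[OF fin] \<open>x t0 \<noteq> 0\<close> show ?thesis unfolding lead_def by blast
  qed
  define Q where "Q = (\<lambda>n. {x. subm c n n (\<lambda>t. x t - c n t)})"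
  have Q_mons: "t \<in> mons I d (e + n)" if "x \<in> Q n" "x t \<noteq> 0" for x n t
  proof (cases "c n t = 0")
    case True
    have "subm c n n (\<lambda>t. x t - c n t)" using that(1) by (simp add: Q_def)
    from subm_mons[OF this c] True that(2) show ?thesis by simp
  qed (use c in auto)
  \<comment> \<open>Zero in this coset would put \<open>c n\<close> into the submodule generated by
    its predecessors.\<close>
  have Q_nz: "x \<noteq> (\<lambda>_. 0)" if "x \<in> Q n" for x n
  proof
    assume "x = (\<lambda>_. 0)"
    hence "subm c n n (\<lambda>t. - c n t)" using that by (simp add: Q_def)
    from subm_scale[OF this, of "-1"] neg show False by simp
  qed
  have "\<exists>x t. x \<in> Q n \<and> lead x t \<and> (\<forall>x' t'. x' \<in> Q n \<longrightarrow> lead x' t' \<longrightarrow> (key t', key t) \<notin> R)" for n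
  proof -
    define K where "K = {key t |x t. x \<in> Q n \<and> lead x t}"
    have cQ: "c n \<in> Q n" by (simp add: Q_def subm.zero)
    obtain t where "lead (c n) t" using lead_exists[OF Q_mons[OF cQ] Q_nz[OF cQ]] by blast
    hence "key t \<in> K" using cQ unfolding K_def by blast
    then obtain k where "k \<in> K" "\<And>k'. (k', k) \<in> R \<Longrightarrow> k' \<notin> K" using wfE_min[OF wfR] by metis
    thus ?thesis unfolding K_def by blast
  qed
  then obtain X T where X: "\<And>n. X n \<in> Q n" "\<And>n. lead (X n) (T n)"
    and min: "\<And>n x' t'. x' \<in> Q n \<Longrightarrow> lead x' t' \<Longrightarrow> (key t', key (T n)) \<notin> R" by metis
  have T: "T n \<in> mons I d (e + n)" for n using X by (intro Q_mons) (auto simp: lead_def)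
  have TI: "fst (T n) \<in> I" for n using T[of n] by (auto simp: mons_def)
  obtain m n i a b a' b' where
    mn: "m < n" "T m = (i, a, b)" "T n = (i, a', b')" "a \<le> a'" "b \<le> b'"
    by (rule dickson[OF I TI])
  define p q where "p = a' - a" and "q = b' - b"
  \<comment> \<open>The basis indices agree, so the quotient of the two monomials accounts for the
    whole difference of degrees, and the shifted \<open>X m\<close> lands in degree n.\<close>
  have w: "m + 2 * p + 3 * q = n" using T[of m] T[of n] mn by (auto simp: mons_def p_def q_def)
  define y where "y = shift p q (X m)"
  have "subm c m m (\<lambda>t. X m t - c m t)" using X(1)[of m] by (simp add: Q_def)
  hence "subm c n m (\<lambda>t. X m t - c m t)" by (rule subm_mono) (use mn in simp)
  from subm_add[OF this subm_gen[OF mn(1)]] have "subm c n m (X m)" by simp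
  from subm_shift[OF this, of p q] have y: "subm c n n y" by (simp add: y_def w)
  have yT: "y (T n) \<noteq> 0" using X(2)[of m] mn by (simp add: y_def shift_def lead_def p_def q_def)
  have y_le: "key s = key (T n) \<or> (key s, key (T n)) \<in> R" if ys: "y s \<noteq> 0" for s
  proof -
    obtain i' a1 b1 where s: "s = (i', a1, b1)" by (cases s)
    have pq: "p \<le> a1" "q \<le> b1" "X m (i', a1 - p, b1 - q) \<noteq> 0"
      using ys by (auto simp: s y_def shift_def split: if_splits)
    hence "key (i', a1 - p, b1 - q) = key (T m) \<or> (key (i', a1 - p, b1 - q), key (T m)) \<in> R"
      using X(2)[of m] by (simp add: lead_def)
    thus ?thesis using pq(1,2) mn by (auto simp: s key_def R_def p_def)
  qed
  \<comment> \<open>This cancels the leading term of \<open>X n\<close> within its coset, against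
    the minimality of that term.\<close>
  define x' where "x' = (\<lambda>t. X n t + (- X n (T n) / y (T n)) * y t)"
  have "subm c n n (\<lambda>t. (X n t - c n t) + (- X n (T n) / y (T n)) * y t)"
    using X(1)[of n] by (intro subm_add subm_scale y) (simp add: Q_def)
  hence x'Q: "x' \<in> Q n" by (simp add: Q_def x'_def algebra_simps)
  obtain t' where t': "lead x' t'" using lead_exists[OF Q_mons[OF x'Q] Q_nz[OF x'Q]] by blast
  hence nz: "x' t' \<noteq> 0" by (simp add: lead_def)
  have ne: "t' \<noteq> T n" using nz yT by (auto simp: x'_def)
  have "X n t' \<noteq> 0 \<or> y t' \<noteq> 0" using nz by (auto simp: x'_def)
  hence "key t' = key (T n) \<or> (key t', key (T n)) \<in> R"
    using y_le[of t'] X(2)[of n] unfolding lead_def by blast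
  moreover have "key t' \<noteq> key (T n)" using key_inj[OF Q_mons[OF x'Q nz] T] ne by blast
  ultimately show False using min[OF x'Q t'] by blast
qed

section \<open>Evaluation of formal relations\<close>

definition emono :: "('i \<Rightarrow> complex \<Rightarrow> complex) \<Rightarrow> complex \<Rightarrow> 'i \<times> nat \<times> nat \<Rightarrow> complex" where
  "emono v z = (\<lambda>(i, a, b). E4 z ^ a * E6 z ^ b * v i z)"

text \<open>A lift of f to the free module. Any lift will do, as evaluation preserves relations
  between lifts.\<close>

lemma espan_coeffs:
  assumes "finite I" "espan I v d e f"
  shows "\<exists>c. (\<forall>t. c t \<noteq> 0 \<longrightarrow> t \<in> mons I d e) \<and> (\<forall>z\<in>uhp. f z = (\<Sum>t\<in>mons I d e. c t * emono v z t))"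
  using assms(2)
proof (induction rule: espan.induct)
  case (zero f) thus ?case by (intro exI[of _ "\<lambda>_. 0"]) simp
next
  case (step g i a b f c)
  then obtain x where x: "\<And>t. x t \<noteq> 0 \<Longrightarrow> t \<in> mons I d e" "\<And>z. z \<in> uhp \<Longrightarrow> g z = (\<Sum>t\<in>mons I d e. x t * emono v z t)"
    by blast
  have m: "(i, a, b) \<in> mons I d e" using step.hyps by (simp add: mons_def)
  show ?case
  proof (intro exI[of _ "\<lambda>t. (if t = (i, a, b) then c else 0) + x t"] conjI allI impI ballI)
    fix t assume "(if t = (i, a, b) then c else 0) + x t \<noteq> 0"
    thus "t \<in> mons I d e" using m x(1) by (auto split: if_splits)
  next
    fix z assume z: "z \<in> uhp"
    have "(\<Sum>t\<in>mons I d e. (if t = (i, a, b) then c else 0) * emono v z t) = c * emono v z (i, a, b)"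
      using m finite_mons[OF assms(1)] by (simp add: if_distrib[of "\<lambda>u. u * _"] sum.delta cong: if_cong)
    thus "f z = (\<Sum>t\<in>mons I d e. ((if t = (i, a, b) then c else 0) + x t) * emono v z t)"
      using step.hyps(4)[OF z] x(2)[OF z] by (simp add: distrib_right sum.distrib emono_def)
  qed
qed

lemma emono_shift_sum:
  assumes I: "finite I" and x: "\<And>t. x t \<noteq> 0 \<Longrightarrow> t \<in> mons I d e"
  shows "(\<Sum>t\<in>mons I d (e + 2 * p + 3 * q). shift p q x t * emono v z t) = 
     E4 z ^ p * E6 z ^ q * (\<Sum>t\<in>mons I d e. x t * emono v z t)"
proof -
  let ?s = "\<lambda>(i, a, b). (i, a + p, b + q)"
  have "(\<Sum>t\<in>mons I d (e + 2 * p + 3 * q). shift p q x t * emono v z t) = 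
      (\<Sum>t\<in>?s ` mons I d e. shift p q x t * emono v z t)"
  proof (rule sum.mono_neutral_right)
    show "finite (mons I d (e + 2 * p + 3 * q))" by (rule finite_mons[OF I])
    show "?s ` mons I d e \<subseteq> mons I d (e + 2 * p + 3 * q)" by (auto simp: mons_def)
    show "\<forall>t\<in>mons I d (e + 2 * p + 3 * q) - ?s ` mons I d e. shift p q x t * emono v z t = 0"
    proof
      fix t assume t: "t \<in> mons I d (e + 2 * p + 3 * q) - ?s ` mons I d e"
      obtain i a b where iab: "t = (i, a, b)" by (cases t)
      have "shift p q x t = 0"
      proof (rule ccontr)
        assume "shift p q x t \<noteq> 0"
        hence *: "p \<le> a" "q \<le> b" "x (i, a - p, b - q) \<noteq> 0" by (auto simp: shift_def iab split: if_splits)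
        hence "?s (i, a - p, b - q) \<in> ?s ` mons I d e" using x by blast
        thus False using t * by (simp add: iab)
      qed
      thus "shift p q x t * emono v z t = 0" by simp
    qed
  qed
  also have "\<dots> = (\<Sum>t\<in>mons I d e. shift p q x (?s t) * emono v z (?s t))"
    by (rule sum.reindex_cong[of ?s]) (auto simp: inj_on_def)
  also have "\<dots> = (\<Sum>t\<in>mons I d e. E4 z ^ p * E6 z ^ q * (x t * emono v z t))"
    by (rule sum.cong) (auto simp: shift_def emono_def power_add)
  finally show ?thesis by (simp add: sum_distrib_left)
qed

lemma subm_evaluate:
  assumes I: "finite I" and c: "\<And>j t. c j t \<noteq> 0 \<Longrightarrow> t \<in> mons I d (e + j)"
    and U: "\<And>j z. z \<in> uhp \<Longrightarrow> U j z = (\<Sum>t\<in>mons I d (e + j). c j t * emono v z t)"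
    and x: "subm c m w x" and mw: "m \<le> w"
  shows "\<exists>g. (\<forall>j<m. mf (w - j) (g j)) \<and> (\<forall>z\<in>uhp. (\<Sum>t\<in>mons I d (e + w). x t * emono v z t) = (\<Sum>j<m. g j z * U j z))"
  using x mw
proof (induction rule: subm.induct)
  case (zero w)
  show ?case by (rule exI[of _ "\<lambda>_ _. 0"]) (simp add: mf_zero)
next
  case (step w x j p q \<alpha>)
  then obtain g where g: "\<And>j. j < m \<Longrightarrow> mf (w - j) (g j)" 
    "\<And>z. z \<in> uhp \<Longrightarrow> (\<Sum>t\<in>mons I d (e + w). x t * emono v z t) = (\<Sum>j<m. g j z * U j z)" by blast
  define g' where "g' = g(j := \<lambda>z. \<alpha> * (E4 z ^ p * E6 z ^ q) + g j z)"
  have "2 * p + 3 * q = w - j" using step.hyps(3) by simp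
  hence mono: "mf (w - j) (\<lambda>z. \<alpha> * (E4 z ^ p * E6 z ^ q))"
    using mf_mult[OF mf_power[OF mf_E4, of p] mf_power[OF mf_E6, of q]] by (intro mf_cmult) (simp add: mult.commute)
  show ?case
  proof (intro exI[of _ g'] conjI allI impI ballI)
    fix j' assume "j' < m"
    thus "mf (w - j') (g' j')" unfolding g'_def using g(1) mf_add[OF mono g(1)[OF step.hyps(2)]] by auto
  next
    fix z assume z: "z \<in> uhp"
    have ew: "e + w = e + j + 2 * p + 3 * q" using step.hyps(3) by simp
    have "(\<Sum>t\<in>mons I d (e + w). (\<alpha> * shift p q (c j) t + x t) * emono v z t) = 
       \<alpha> * (\<Sum>t\<in>mons I d (e + w). shift p q (c j) t * emono v z t) + (\<Sum>t\<in>mons I d (e + w). x t * emono v z t)"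
      by (simp add: distrib_right sum.distrib sum_distrib_left mult.assoc)
    also have "(\<Sum>t\<in>mons I d (e + w). shift p q (c j) t * emono v z t) = E4 z ^ p * E6 z ^ q * U j z"
      unfolding ew U[OF z] by (rule emono_shift_sum[OF I c])
    also have "(\<Sum>t\<in>mons I d (e + w). x t * emono v z t) = (\<Sum>j<m. g j z * U j z)" by (rule g(2)[OF z])
    also have "\<alpha> * (E4 z ^ p * E6 z ^ q * U j z) + (\<Sum>j<m. g j z * U j z) = (\<Sum>j<m. g' j z * U j z)"
      using step.hyps(2) by (simp add: g'_def sum.remove[of "{..<m}" j] algebra_simps)
    finally show "(\<Sum>t\<in>mons I d (e + w). (\<alpha> * shift p q (c j) t + x t) * emono v z t) = (\<Sum>j<m. g' j z * U j z)" .
  qed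
qed

text \<open>The derivatives of F stay in the module, the j-th in degree e + j. For some n the lift
  of the n-th is generated by the lifts of the earlier ones, and comparing degrees gives the
  coefficient of the j-th the half-weight n - j.\<close>

theorem MLDE_of_finite_module:
  assumes I: "finite I" and v: "\<And>i. i \<in> I \<Longrightarrow> v i holomorphic_on uhp"
    and D: "\<And>i. i \<in> I \<Longrightarrow> espan I v d (d i + 1) (serre_D (k + 2 * real (d i)) (v i))"
    and F: "espan I v d e F"
  shows "satisfies_monic_MLDE F (k + 2 * real e)"
proof -
  define K where "K = k + 2 * real e"
  define U where "U = (\<lambda>j. serre_D_iter K j F)"
  have U: "espan I v d (e + j) (U j)" for j
  proof (induction j)
    case (Suc j)
    from espan_serre_D[OF v D Suc] show ?case by (simp add: U_def K_def algebra_simps)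
  qed (simp add: U_def F)
  have "\<forall>j. \<exists>c. (\<forall>t. c t \<noteq> 0 \<longrightarrow> t \<in> mons I d (e + j)) \<and> (\<forall>z\<in>uhp. U j z = (\<Sum>t\<in>mons I d (e + j). c t * emono v z t))"
    using espan_coeffs[OF I U] by blast
  then obtain c where c: "\<And>j t. c j t \<noteq> 0 \<Longrightarrow> t \<in> mons I d (e + j)"
    "\<And>j z. z \<in> uhp \<Longrightarrow> U j z = (\<Sum>t\<in>mons I d (e + j). c j t * emono v z t)" by metis
  obtain n where "subm c n n (c n)" using noetherian[OF I c(1)] by blast
  from subm_evaluate[OF I c this] obtain g where g: "\<And>j. j < n \<Longrightarrow> mf (n - j) (g j)"
    "\<And>z. z \<in> uhp \<Longrightarrow> (\<Sum>t\<in>mons I d (e + n). c n t * emono v z t) = (\<Sum>j<n. g j z * U j z)" by blast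
  show ?thesis unfolding satisfies_monic_MLDE_def K_def[symmetric]
  proof (intro exI[of _ n] exI[of _ "\<lambda>i z. (-1) * g (n - i) z"] conjI ballI)
    fix i assume i: "i \<in> {1..n}"
    hence "mf (n - (n - i)) (g (n - i))" by (intro g) auto
    hence "mf i (g (n - i))" using i by simp
    thus "modular_form (2 * i) (\<lambda>z. (-1) * g (n - i) z)" unfolding mf_def[symmetric] by (rule mf_cmult)
  next
    fix z assume z: "z \<in> uhp"
    have "U n z = (\<Sum>j<n. g j z * U j z)" using c(2)[OF z, of n] g(2)[OF z] by simp
    also have "\<dots> = (\<Sum>i=1..n. g (n - i) z * U (n - i) z)"
      by (rule sum.reindex_bij_witness[of _ "\<lambda>i. n - i" "\<lambda>i. n - i"]) auto
    finally show "serre_D_iter K n F z + (\<Sum>i=1..n. (-1) * g (n - i) z * serre_D_iter K (n - i) F z) = 0"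
      by (simp add: U_def sum_negf)
  qed
qed

section \<open>Sums and products of solutions\<close>

lemma serre_D_iter_holomorphic: "f holomorphic_on uhp \<Longrightarrow> serre_D_iter k j f holomorphic_on uhp"
  by (induction j) (auto intro: serre_D_holomorphic)

text \<open>The derivatives of order below n span a stable module, since the equation expresses the
  n-th one through them.\<close>

lemma module_of_MLDE:
  assumes f: "f holomorphic_on uhp" and sat: "satisfies_monic_MLDE f k"
  obtains n where
    "\<And>j. j < n \<Longrightarrow> espan {..<n} (\<lambda>j. serre_D_iter k j f) (\<lambda>j. j) (j + 1) (serre_D (k + 2 * real j) (serre_D_iter k j f))"
    "espan {..<n} (\<lambda>j. serre_D_iter k j f) (\<lambda>j. j) 0 f"
proof -
  define U where "U = (\<lambda>j. serre_D_iter k j f)"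
  obtain n g where g: "\<And>i. i \<in> {1..n} \<Longrightarrow> mf i (g i)"
    and eq: "\<And>z. z \<in> uhp \<Longrightarrow> U n z + (\<Sum>i=1..n. g i z * U (n - i) z) = 0"
    using sat unfolding satisfies_monic_MLDE_def mf_def U_def by blast
  have gen: "espan {..<n} U (\<lambda>j. j) j (U j)" if "j < n" for j
    using espan_gen[of j "{..<n}" U "\<lambda>j. j"] that by simp
  have top: "espan {..<n} U (\<lambda>j. j) n (U n)"
  proof (rule espan_cong)
    show "espan {..<n} U (\<lambda>j. j) n (\<lambda>z. (-1) * (\<Sum>i\<in>{1..n}. g i z * U (n - i) z))"
    proof (intro espan_cmult espan_sum)
      fix i assume i: "i \<in> {1..n}"
      hence "espan {..<n} U (\<lambda>j. j) (i + (n - i)) (\<lambda>z. g i z * U (n - i) z)"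
        by (intro espan_mf_mult g gen) auto
      thus "espan {..<n} U (\<lambda>j. j) n (\<lambda>z. g i z * U (n - i) z)" using i by simp
    qed simp
    show "(-1) * (\<Sum>i\<in>{1..n}. g i z * U (n - i) z) = U n z" if "z \<in> uhp" for z
      using eq[OF that] unfolding add_eq_0_iff by simp
  qed
  have "espan {..<n} U (\<lambda>j. j) (j + 1) (U (Suc j))" if "j < n" for j
    using gen[of "Suc j"] top that by (cases "Suc j < n") (auto simp: not_less less_Suc_eq dest!: le_antisym)
  \<comment> \<open>For n = 0 the equation says f = 0, which lies in the span of no
    generators.\<close>
  moreover have "espan {..<n} U (\<lambda>j. j) 0 (U 0)"
    using gen[of 0] top by (cases "n = 0") auto
  ultimately show ?thesis using that[of n] by (simp add: U_def)
qed

lemma MLDE_add: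
  assumes f: "f holomorphic_on uhp" "satisfies_monic_MLDE f k"
    and g: "g holomorphic_on uhp" "satisfies_monic_MLDE g k"
  shows "satisfies_monic_MLDE (\<lambda>z. f z + g z) k"
proof -
  obtain n where n:
    "\<And>j. j < n \<Longrightarrow> espan {..<n} (\<lambda>j. serre_D_iter k j f) (\<lambda>j. j) (j + 1) (serre_D (k + 2 * real j) (serre_D_iter k j f))"
    "espan {..<n} (\<lambda>j. serre_D_iter k j f) (\<lambda>j. j) 0 f" using module_of_MLDE[OF f] by blast
  obtain m where m:
    "\<And>j. j < m \<Longrightarrow> espan {..<m} (\<lambda>j. serre_D_iter k j g) (\<lambda>j. j) (j + 1) (serre_D (k + 2 * real j) (serre_D_iter k j g))"
    "espan {..<m} (\<lambda>j. serre_D_iter k j g) (\<lambda>j. j) 0 g" using module_of_MLDE[OF g] by blast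
  \<comment> \<open>The direct sum: both families of generators are kept apart even where functions
    coincide.\<close>
  define I :: "(nat + nat) set" where "I = {..<n} <+> {..<m}"
  define v where "v = case_sum (\<lambda>j. serre_D_iter k j f) (\<lambda>j. serre_D_iter k j g)"
  define d :: "nat + nat \<Rightarrow> nat" where "d = case_sum (\<lambda>j. j) (\<lambda>j. j)"
  have l: "espan I v d e x" if "espan {..<n} (\<lambda>j. serre_D_iter k j f) (\<lambda>j. j) e x" for e x
    using that by (rule espan_embed[where h = Inl]) (auto simp: I_def v_def d_def)
  have r: "espan I v d e x" if "espan {..<m} (\<lambda>j. serre_D_iter k j g) (\<lambda>j. j) e x" for e x
    using that by (rule espan_embed[where h = Inr]) (auto simp: I_def v_def d_def)
  have "satisfies_monic_MLDE (\<lambda>z. f z + g z) (k + 2 * real 0)"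
  proof (rule MLDE_of_finite_module)
    show "finite I" by (simp add: I_def)
    show "v i holomorphic_on uhp" if "i \<in> I" for i
      using f(1) g(1) by (auto simp: v_def serre_D_iter_holomorphic split: sum.splits)
    show "espan I v d (d i + 1) (serre_D (k + 2 * real (d i)) (v i))" if "i \<in> I" for i
      using that l[OF n(1)] r[OF m(1)] by (auto simp: I_def v_def d_def)
    show "espan I v d 0 (\<lambda>z. f z + g z)" by (intro espan_add l r n m)
  qed
  thus ?thesis by simp
qed

text \<open>Pairs of generators index the tensor product. The induction on g is done for one
  generator \<open>v i\<close> at a time, inside the induction on f.\<close>

lemma espan_product:
  assumes f: "espan I v d e f" and g: "espan J w d' e' g"
  shows "espan (I \<times> J) (\<lambda>(i, j) z. v i z * w j z) (\<lambda>(i, j). d i + d' j) (e + e') (\<lambda>z. f z * g z)"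
  using f
proof (induction rule: espan.induct)
  case (zero f) thus ?case by (intro espan.zero) simp
next
  case (step f' i a b f c)
  have "espan (I \<times> J) (\<lambda>(i, j) z. v i z * w j z) (\<lambda>(i, j). d i + d' j) (d i + e') (\<lambda>z. v i z * g z)"
    using g
  proof (induction rule: espan.induct)
    case (zero g) thus ?case by (intro espan.zero) simp
  next
    case (step g' j a' b' g c')
    show ?case
      by (rule espan.step[OF step.IH, of "(i, j)" a' b' _ c'])
         (use step.hyps \<open>i \<in> I\<close> in \<open>auto simp: algebra_simps\<close>)
  qed
  from espan_monom_mult[OF this, of a b c] step.hyps(3)
  have "espan (I \<times> J) (\<lambda>(i, j) z. v i z * w j z) (\<lambda>(i, j). d i + d' j) (e + e') (\<lambda>z. c * E4 z ^ a * E6 z ^ b * (v i z * g z))"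
    by (simp add: add_ac)
  from espan_add[OF this step.IH] show ?case
    by (rule espan_cong) (simp add: step.hyps(4) algebra_simps)
qed

lemma MLDE_mult:
  assumes f: "f holomorphic_on uhp" "satisfies_monic_MLDE f k"
    and g: "g holomorphic_on uhp" "satisfies_monic_MLDE g l"
  shows "satisfies_monic_MLDE (\<lambda>z. f z * g z) (k + l)"
proof -
  define V W where "V = (\<lambda>j. serre_D_iter k j f)" and "W = (\<lambda>j. serre_D_iter l j g)"
  obtain n where n:
    "\<And>j. j < n \<Longrightarrow> espan {..<n} V (\<lambda>j. j) (j + 1) (serre_D (k + 2 * real j) (V j))"
    "espan {..<n} V (\<lambda>j. j) 0 f" using module_of_MLDE[OF f] unfolding V_def by blast
  obtain m where m:
    "\<And>j. j < m \<Longrightarrow> espan {..<m} W (\<lambda>j. j) (j + 1) (serre_D (l + 2 * real j) (W j))"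
    "espan {..<m} W (\<lambda>j. j) 0 g" using module_of_MLDE[OF g] unfolding W_def by blast
  have hol: "V j holomorphic_on uhp" "W j holomorphic_on uhp" for j
    using f(1) g(1) by (auto simp: V_def W_def serre_D_iter_holomorphic)
  let ?I = "{..<n} \<times> {..<m}" and ?v = "\<lambda>(i, j) z. V i z * W j z" and ?d = "\<lambda>(i, j). i + j"
  have "satisfies_monic_MLDE (\<lambda>z. f z * g z) ((k + l) + 2 * real 0)"
  proof (rule MLDE_of_finite_module)
    show "finite ?I" by simp
    show "?v x holomorphic_on uhp" for x using hol by (cases x) (auto intro!: holomorphic_intros)
    show "espan ?I ?v ?d 0 (\<lambda>z. f z * g z)" using espan_product[OF n(2) m(2)] by simp
    fix x assume "x \<in> ?I"
    then obtain i j where x: "x = (i, j)" "i < n" "j < m" by auto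
    have gi: "espan {..<n} V (\<lambda>j. j) i (V i)" using x espan_gen[of i "{..<n}" V "\<lambda>j. j"] by simp
    have gj: "espan {..<m} W (\<lambda>j. j) j (W j)" using x espan_gen[of j "{..<m}" W "\<lambda>j. j"] by simp
    have "espan ?I ?v ?d (i + j + 1) (\<lambda>z. serre_D (k + 2 * real i) (V i) z * W j z)"
      using espan_product[OF n(1)[OF x(2)] gj] by (simp add: add_ac)
    moreover have "espan ?I ?v ?d (i + j + 1) (\<lambda>z. V i z * serre_D (l + 2 * real j) (W j) z)"
      using espan_product[OF gi m(1)[OF x(3)]] by (simp add: add_ac)
    ultimately have "espan ?I ?v ?d (i + j + 1)
       (\<lambda>z. serre_D (k + 2 * real i) (V i) z * W j z + V i z * serre_D (l + 2 * real j) (W j) z)"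
      by (rule espan_add)
    hence "espan ?I ?v ?d (i + j + 1) (serre_D (k + l + 2 * real (i + j)) (\<lambda>z. V i z * W j z))"
    proof (rule espan_cong)
      fix z assume z: "z \<in> uhp"
      have kl: "k + l + 2 * real (i + j) = (k + 2 * real i) + (l + 2 * real j)" by simp
      show "serre_D (k + 2 * real i) (V i) z * W j z + V i z * serre_D (l + 2 * real j) (W j) z = 
          serre_D (k + l + 2 * real (i + j)) (\<lambda>z. V i z * W j z) z"
        unfolding kl by (rule serre_D_mult[OF hol z, symmetric])
    qed
    thus "espan ?I ?v ?d (?d x + 1) (serre_D (k + l + 2 * real (?d x)) (?v x))" by (simp add: x)
  qed
  thus ?thesis by simp
qed

section \<open>Powers of \<open>E2\<close> and the solutions they provide\<close>

lemma serre_D_E2_power: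
  assumes z: "z \<in> uhp"
  shows "serre_D m (\<lambda>z. E2 z ^ j) z = of_real (real j - m) / 12 * E2 z ^ (j + 1) - of_nat j / 12 * E4 z * E2 z ^ (j - 1)"
proof -
  have "((\<lambda>z. E2 z ^ j) has_field_derivative of_nat j * deriv E2 z * E2 z ^ (j - 1)) (at z)"
    by (rule derivative_eq_intros uhp_derivI[OF E2_holomorphic z] refl | simp)+
  hence "nderiv (\<lambda>z. E2 z ^ j) z = of_nat j * nderiv E2 z * E2 z ^ (j - 1)"
    by (simp add: nderiv_def DERIV_imp_deriv)
  also have "\<dots> = of_nat j / 12 * (E2 z ^ 2 * E2 z ^ (j - 1)) - of_nat j / 12 * E4 z * E2 z ^ (j - 1)"
    unfolding ramanujan_E2[OF z] by (simp add: field_simps)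
  also have "of_nat j / 12 * (E2 z ^ 2 * E2 z ^ (j - 1)) = of_nat j / 12 * E2 z ^ (j + 1)"
    by (cases j) (simp_all add: power2_eq_square)
  finally show ?thesis by (simp add: serre_D_def algebra_simps diff_divide_distrib)
qed

text \<open>With \<open>E\<^sub>2\<^sup>j\<close> given weight \<open>2j - s\<close>, the span of \<open>1, E\<^sub>2, \<dots>, E\<^sub>2\<^sup>s\<close> is stable under
  the Serre derivative, because the coefficient \<open>(s - j)/12\<close> of \<open>E\<^sub>2\<^bsup>j+1\<^esup>\<close> vanishes for \<open>j = s\<close>.\<close>

lemma MLDE_quasimodular:
  assumes h: "\<And>j. j \<le> s \<Longrightarrow> j \<le> e \<Longrightarrow> mf (e - j) (h j)" "\<And>j z. j \<le> s \<Longrightarrow> j > e \<Longrightarrow> z \<in> uhp \<Longrightarrow> h j z = 0"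
    and f: "\<And>z. z \<in> uhp \<Longrightarrow> f z = (\<Sum>j\<le>s. h j z * E2 z ^ j)"
  shows "satisfies_monic_MLDE f (2 * real e - real s)"
proof -
  let ?v = "\<lambda>j z. E2 z ^ j"
  have "satisfies_monic_MLDE f (- real s + 2 * real e)"
  proof (rule MLDE_of_finite_module)
    show "finite {..s}" by simp
    show "?v j holomorphic_on uhp" for j by (intro holomorphic_intros E2_holomorphic)
    have gen: "espan {..s} ?v (\<lambda>j. j) j (?v j)" if "j \<le> s" for j
      using espan_gen[of j "{..s}" ?v "\<lambda>j. j"] that by simp
    show "espan {..s} ?v (\<lambda>j. j) (j + 1) (serre_D (- real s + 2 * real j) (?v j))" if "j \<in> {..s}" for j
    proof -
      have 1: "espan {..s} ?v (\<lambda>j. j) (j + 1) (\<lambda>z. of_real (real s - real j) / 12 * E2 z ^ (j + 1))"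
      proof (cases "j = s")
        case False
        hence "j + 1 \<le> s" using that by simp
        thus ?thesis by (intro espan_cmult gen)
      qed (auto intro: espan.zero)
      have 2: "espan {..s} ?v (\<lambda>j. j) (j + 1) (\<lambda>z. (- of_nat j / 12) * E4 z ^ 1 * E6 z ^ 0 * E2 z ^ (j - 1))"
      proof (cases "j = 0")
        case False
        thus ?thesis using that by (intro espan_monom) auto
      qed (auto intro: espan.zero)
      show ?thesis
        by (rule espan_cong[OF espan_add[OF 1 2]]) (simp add: serre_D_E2_power algebra_simps)
    qed
    show "espan {..s} ?v (\<lambda>j. j) e f"
    proof (rule espan_cong)
      show "espan {..s} ?v (\<lambda>j. j) e (\<lambda>z. \<Sum>j\<in>{..s}. h j z * E2 z ^ j)"
      proof (rule espan_sum)
        fix j assume j: "j \<in> {..s}"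
        show "espan {..s} ?v (\<lambda>j. j) e (\<lambda>z. h j z * E2 z ^ j)"
        proof (cases "j \<le> e")
          case True
          have "espan {..s} ?v (\<lambda>j. j) ((e - j) + j) (\<lambda>z. h j z * E2 z ^ j)"
            using j True by (intro espan_mf_mult h gen) auto
          thus ?thesis using True by simp
        next
          case False
          thus ?thesis using j h(2) by (intro espan.zero) auto
        qed
      qed simp
    qed (simp add: f)
  qed
  thus ?thesis by (simp add: algebra_simps)
qed

text \<open>The bound s on the depth need not be attained: a constant fits e = 0 with s = 0 and also
  with s = 1, which yields the weights 0 and -1.\<close>

lemma MLDE_const: "satisfies_monic_MLDE (\<lambda>_. c) 0" and MLDE_const_neg: "satisfies_monic_MLDE (\<lambda>_. c) (-1)"
  using MLDE_quasimodular[of 0 0 "\<lambda>_ _. c" "\<lambda>_. c"] MLDE_quasimodular[of 1 0 "\<lambda>j _. if j = 0 then c else 0" "\<lambda>_. c"]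
  by (simp_all add: mf_const)

lemma MLDE_downward:
  assumes f: "f holomorphic_on uhp" "satisfies_monic_MLDE f (real_of_int k)" and "l \<le> k"
  shows "satisfies_monic_MLDE f (real_of_int l)"
proof -
  have "satisfies_monic_MLDE f (real_of_int k - real n)" for n
  proof (induction n)
    case (Suc n)
    from MLDE_mult[OF f(1) Suc _ MLDE_const_neg[of 1]] show ?case by (simp add: algebra_simps)
  qed (simp add: f)
  from this[of "nat (k - l)"] assms(3) show ?thesis by (simp add: of_nat_nat)
qed

lemma MLDE_diff:
  assumes f: "f holomorphic_on uhp" "satisfies_monic_MLDE f k"
    and g: "g holomorphic_on uhp" "satisfies_monic_MLDE g k"
  shows "satisfies_monic_MLDE (\<lambda>z. f z - g z) k"
proof -
  have "satisfies_monic_MLDE (\<lambda>z. g z * (-1)) (k + 0)"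
    by (intro MLDE_mult g MLDE_const) auto
  hence "satisfies_monic_MLDE (\<lambda>z. - g z) k" by simp
  moreover have "(\<lambda>z. - g z) holomorphic_on uhp" by (intro holomorphic_intros g)
  ultimately show ?thesis using MLDE_add[OF f, of "\<lambda>z. - g z"] by simp
qed

text \<open>Applying \<open>z \<mapsto> -1/(z + n)\<close> to the relation yields, for fixed \<open>z\<close>, a polynomial with the roots \<open>E\<^sub>2(z) + 6/(\<pi>i(z + n))\<close>.\<close>

lemma E2_transcendental:
  assumes h: "\<And>j. j \<le> s \<Longrightarrow> j \<le> e \<Longrightarrow> mf (e - j) (h j)" "\<And>j z. j \<le> s \<Longrightarrow> j > e \<Longrightarrow> z \<in> uhp \<Longrightarrow> h j z = 0"
    and rel: "\<And>z. z \<in> uhp \<Longrightarrow> (\<Sum>j\<le>s. h j z * E2 z ^ j) = 0"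
    and z: "z \<in> uhp" and j: "j \<le> s"
  shows "h j z = 0"
proof (rule ccontr)
  assume nz: "h j z \<noteq> 0"
  define x where "x = (\<lambda>n::nat. E2 z + 6 / (of_real pi * \<i> * (z + of_nat n)))"
  have zn: "z + of_nat n \<in> uhp" "z + of_nat n \<noteq> 0" for n
    using z uhp_nonzero[of "z + of_nat n"] by (auto simp: uhp_def)
  have per: "f (z + of_nat n) = f z" if "\<And>z. z \<in> uhp \<Longrightarrow> f (z + 1) = f z" for f :: "complex \<Rightarrow> complex" and n
    using uhp_periodic_int[where f = f and n = "int n", OF _ z] that by simp
  have "(\<Sum>j\<le>s. h j z * x n ^ j) = 0" for n
  proof -
    define w where "w = z + of_nat n"
    have w: "w \<in> uhp" "w \<noteq> 0" using zn by (auto simp: w_def)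
    have E2w: "E2 w = E2 z" unfolding w_def by (rule per) (rule qexp_T[OF qexp_E2])
    have xw: "x n = E2 z + 6 / (of_real pi * \<i> * w)" by (simp add: x_def w_def)
    have "E2 (- 1 / w) = w ^ 2 * x n"
      unfolding E2_S[OF w(1)] E2w xw using w(2) by (simp add: field_simps power2_eq_square)
    \<comment> \<open>Every term carries the same power of w, which can be cancelled; what remains
      is one polynomial whose coefficients \<open>h j z\<close> do not depend on n.\<close>
    moreover have "h j (- 1 / w) * (w ^ 2 * x n) ^ j = w ^ (2 * e) * (h j z * x n ^ j)" if j: "j \<le> s" for j
    proof (cases "j \<le> e")
      case True
      have m: "mf (e - j) (h j)" by (rule h(1)[OF j True])
      have "h j (- 1 / w) = w ^ (2 * (e - j)) * h j w" by (rule mf_S[OF m w(1)])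
      also have "h j w = h j z" unfolding w_def by (rule per) (rule mf_T[OF m])
      finally have "h j (- 1 / w) * (w ^ 2 * x n) ^ j = (w ^ (2 * (e - j)) * w ^ (2 * j)) * (h j z * x n ^ j)"
        by (simp add: power_mult_distrib flip: power_mult)
      also have "w ^ (2 * (e - j)) * w ^ (2 * j) = w ^ (2 * (e - j) + 2 * j)" by (rule power_add[symmetric])
      also have "2 * (e - j) + 2 * j = 2 * e" using True by simp
      finally show ?thesis .
    next
      case False
      thus ?thesis using h(2)[OF j] uhp_inverse[OF w(1)] z by simp
    qed
    ultimately have "(\<Sum>j\<le>s. h j (- 1 / w) * E2 (- 1 / w) ^ j) = w ^ (2 * e) * (\<Sum>j\<le>s. h j z * x n ^ j)"
      by (simp add: sum_distrib_left)
    thus ?thesis using rel[OF uhp_inverse[OF w(1)]] w(2) by simp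
  qed
  hence "range x \<subseteq> {y. (\<Sum>j\<le>s. h j z * y ^ j) = 0}" by auto
  moreover have "finite {y. (\<Sum>j\<le>s. h j z * y ^ j) = 0}"
    using polyfun_finite_roots[of "\<lambda>j. h j z" s] nz j by auto
  ultimately have "finite (range x)" by (rule finite_subset)
  moreover have "inj x"
  proof (rule injI)
    fix m n assume "x m = x n"
    thus "m = n" using zn(2)[of m] zn(2)[of n] by (simp add: x_def frac_eq_eq)
  qed
  ultimately show False using range_inj_infinite by blast
qed

section \<open>Quasimodular forms\<close>

text \<open>Coefficients of a polynomial in \<open>E2\<close> of weight 2e and depth at most s. The
  case j > e is stated as vanishing, since the truncated difference \<open>e - j\<close> would admit
  forms of weight 0.\<close>

definition depth_coeffs :: "nat \<Rightarrow> nat \<Rightarrow> (nat \<Rightarrow> complex \<Rightarrow> complex) \<Rightarrow> bool" where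
  "depth_coeffs e s h \<longleftrightarrow> (\<forall>j\<le>e. mf (e - j) (h j)) \<and> (\<forall>j z. j > e \<longrightarrow> z \<in> uhp \<longrightarrow> h j z = 0) \<and>
     (\<forall>j z. j > s \<longrightarrow> z \<in> uhp \<longrightarrow> h j z = 0)"

text \<open>If \<open>f = \<Sum>\<^sub>j h\<^sub>j E\<^sub>2\<^sup>j\<close> has weight \<open>2e\<close>, these are the coefficients of \<open>D\<^sub>m f\<close>.\<close>

definition serre_coeffs :: "nat \<Rightarrow> real \<Rightarrow> (nat \<Rightarrow> complex \<Rightarrow> complex) \<Rightarrow> nat \<Rightarrow> complex \<Rightarrow> complex" where
  "serre_coeffs e m h j z = serre_D (2 * real (e - j)) (h j) z 
     + (if j = 0 then 0 else of_real (2 * real e - real (j - 1) - m) / 12 * h (j - 1) z)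
     - of_nat (j + 1) / 12 * (E4 z * h (j + 1) z)"

lemma depth_coeffs_holomorphic: "depth_coeffs e s h \<Longrightarrow> h j holomorphic_on uhp"
proof (cases "j \<le> e")
  case False
  assume "depth_coeffs e s h"
  thus ?thesis using False
    by (intro holomorphic_transform[of "\<lambda>_. 0" uhp "h j"]) (auto simp: depth_coeffs_def)
qed (auto simp: depth_coeffs_def intro: mf_holomorphic)

lemma depth_coeffs_serre:
  assumes h: "depth_coeffs e s h"
  shows "depth_coeffs (e + 1) (s + 1) (serre_coeffs e m h)"
proof -
  have z1: "h j z = 0" if "j > e" "z \<in> uhp" for j z using h that by (auto simp: depth_coeffs_def)
  have z2: "h j z = 0" if "j > s" "z \<in> uhp" for j z using h that by (auto simp: depth_coeffs_def)
  have hm: "mf (e - j) (h j)" if "j \<le> e" for j using h that by (auto simp: depth_coeffs_def)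
  have D0: "serre_D k (h j) z = 0" if "j > e \<or> j > s" "z \<in> uhp" for k j z
    using that z1 z2 by (intro serre_D_zero) auto
  have "mf (e + 1 - j) (serre_coeffs e m h j)" if j: "j \<le> e + 1" for j
  proof -
    have a: "mf (e + 1 - j) (serre_D (2 * real (e - j)) (h j))"
    proof (cases "j \<le> e")
      case True
      thus ?thesis using mf_serre_D[OF hm[OF True]] by (simp add: Suc_diff_le)
    next
      case False
      thus ?thesis using D0 by (intro mf_cong[OF mf_zero]) auto
    qed
    have b: "mf (e + 1 - j) (\<lambda>z. if j = 0 then 0 else of_real (2 * real e - real (j - 1) - m) / 12 * h (j - 1) z)"
    proof (cases "j = 0")
      case False
      hence ej: "e + 1 - j = e - (j - 1)" using j by simp
      show ?thesis unfolding if_not_P[OF False] ej by (intro mf_cmult hm) (use j in simp)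
    qed (simp add: mf_zero)
    have c: "mf (e + 1 - j) (\<lambda>z. of_nat (j + 1) / 12 * (E4 z * h (j + 1) z))"
    proof (cases "j + 1 \<le> e")
      case True
      hence "e + 1 - j = 2 + (e - (j + 1))" by simp
      thus ?thesis by (simp only:) (intro mf_cmult mf_mult mf_E4 hm True)
    next
      case False
      thus ?thesis using z1 by (intro mf_cong[OF mf_zero]) auto
    qed
    show ?thesis unfolding serre_coeffs_def[abs_def] by (intro mf_diff mf_add a b c)
  qed
  moreover have "serre_coeffs e m h j z = 0" if "j > e + 1 \<or> j > s + 1" "z \<in> uhp" for j z
    using that z1[of "j - 1" z] z1[of "j + 1" z] z2[of "j - 1" z] z2[of "j + 1" z] D0[of j z] by (auto simp: serre_coeffs_def)
  ultimately show ?thesis unfolding depth_coeffs_def by blast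
qed

text \<open>Leibniz rule in each term: \<open>h j\<close> gets its own weight 2(e - j), the power of
  \<open>E2\<close> the rest of m. Differentiating the power of \<open>E2\<close> moves the exponent
  up by one with a constant and down by one with E4.\<close>

lemma serre_D_depth_expansion:
  assumes h: "depth_coeffs e s h" and f: "\<And>z. z \<in> uhp \<Longrightarrow> f z = (\<Sum>j\<le>s. h j z * E2 z ^ j)" and z: "z \<in> uhp"
  shows "serre_D m f z = (\<Sum>j\<le>s + 1. serre_coeffs e m h j z * E2 z ^ j)"
proof -
  note hol = depth_coeffs_holomorphic[OF h]
  have z1: "h j z = 0" if "j > e" for j using h that z by (auto simp: depth_coeffs_def)
  have z2: "h j z = 0" if "j > s" for j using h that z by (auto simp: depth_coeffs_def)
  have D0: "serre_D k (h j) z = 0" if "j > e \<or> j > s" for k j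
    using that h z by (intro serre_D_zero) (auto simp: depth_coeffs_def)
  define c where "c = (\<lambda>j. of_real (2 * real e - real j - m) / 12 :: complex)"
  have sum: "serre_D m (\<lambda>z. \<Sum>j\<in>A. h j z * E2 z ^ j) z = (\<Sum>j\<in>A. serre_D m (\<lambda>z. h j z * E2 z ^ j) z)" if "finite A" for A
    using that
  proof (induction A rule: finite_induct)
    case empty
    show ?case by (simp add: serre_D_zero z)
  next
    case (insert j A)
    have "serre_D m (\<lambda>z. h j z * E2 z ^ j + (\<Sum>j\<in>A. h j z * E2 z ^ j)) z = 
        serre_D m (\<lambda>z. h j z * E2 z ^ j) z + serre_D m (\<lambda>z. \<Sum>j\<in>A. h j z * E2 z ^ j) z"
      by (intro serre_D_add holomorphic_intros hol E2_holomorphic z)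
    thus ?case using insert by simp
  qed
  have summand: "serre_D m (\<lambda>z. h j z * E2 z ^ j) z = 
     serre_D (2 * real (e - j)) (h j) z * E2 z ^ j + c j * h j z * E2 z ^ (j + 1) - of_nat j / 12 * (E4 z * h j z) * E2 z ^ (j - 1)" for j
  proof -
    have mk: "m = 2 * real (e - j) + (m - 2 * real (e - j))" by simp
    have "serre_D m (\<lambda>z. h j z * E2 z ^ j) z = serre_D (2 * real (e - j)) (h j) z * E2 z ^ j 
        + h j z * serre_D (m - 2 * real (e - j)) (\<lambda>z. E2 z ^ j) z"
      by (subst mk) (rule serre_D_mult[OF hol holomorphic_on_power[OF E2_holomorphic] z])
    also have "serre_D (m - 2 * real (e - j)) (\<lambda>z. E2 z ^ j) z = 
        of_real (real j - (m - 2 * real (e - j))) / 12 * E2 z ^ (j + 1) - of_nat j / 12 * E4 z * E2 z ^ (j - 1)"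
      by (rule serre_D_E2_power[OF z])
    also have "h j z * \<dots> = c j * h j z * E2 z ^ (j + 1) - of_nat j / 12 * (E4 z * h j z) * E2 z ^ (j - 1)"
    proof (cases "j \<le> e")
      case True
      hence "real j - (m - 2 * real (e - j)) = 2 * real e - real j - m" by simp
      thus ?thesis by (simp only: c_def) (simp add: algebra_simps)
    next
      case False
      thus ?thesis using z1[of j] by simp
    qed
    finally show ?thesis by simp
  qed
  have "serre_D m f z = serre_D m (\<lambda>z. \<Sum>j\<le>s. h j z * E2 z ^ j) z"
    by (rule serre_D_cong[OF f z])
  also have "\<dots> = (\<Sum>j\<le>s. serre_D m (\<lambda>z. h j z * E2 z ^ j) z)" by (rule sum) simp
  also have "\<dots> = (\<Sum>j\<le>s. serre_D (2 * real (e - j)) (h j) z * E2 z ^ j) + (\<Sum>j\<le>s. c j * h j z * E2 z ^ (j + 1))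
      - (\<Sum>j\<le>s. of_nat j / 12 * (E4 z * h j z) * E2 z ^ (j - 1))"
    unfolding summand by (simp add: sum.distrib sum_subtractf)
  also have "(\<Sum>j\<le>s. serre_D (2 * real (e - j)) (h j) z * E2 z ^ j) = (\<Sum>j\<le>s + 1. serre_D (2 * real (e - j)) (h j) z * E2 z ^ j)"
    using D0[of "Suc s"] by simp
  also have "(\<Sum>j\<le>s. c j * h j z * E2 z ^ (j + 1)) = (\<Sum>j\<le>s + 1. (if j = 0 then 0 else c (j - 1) * h (j - 1) z) * E2 z ^ j)"
    using sum.atMost_Suc_shift[of "\<lambda>j. (if j = 0 then 0 else c (j - 1) * h (j - 1) z) * E2 z ^ j" s] by simp
  also have "(\<Sum>j\<le>s. of_nat j / 12 * (E4 z * h j z) * E2 z ^ (j - 1)) = 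
      (\<Sum>j\<le>s + 1. of_nat (j + 1) / 12 * (E4 z * h (j + 1) z) * E2 z ^ j)"
  proof -
    \<comment> \<open>The range is extended past s, where h vanishes, so that lowering the index by
      one ends at s + 1.\<close>
    have "(\<Sum>j\<le>Suc (s + 1). of_nat j / 12 * (E4 z * h j z) * E2 z ^ (j - 1)) = 
      (\<Sum>j\<le>s + 1. of_nat (Suc j) / 12 * (E4 z * h (Suc j) z) * E2 z ^ (Suc j - 1))"
      by (subst sum.atMost_Suc_shift) simp
    thus ?thesis using z2[of "Suc s"] z2[of "Suc (Suc s)"] by simp
  qed
  also have "(\<Sum>j\<le>s + 1. serre_D (2 * real (e - j)) (h j) z * E2 z ^ j) 
      + (\<Sum>j\<le>s + 1. (if j = 0 then 0 else c (j - 1) * h (j - 1) z) * E2 z ^ j)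
      - (\<Sum>j\<le>s + 1. of_nat (j + 1) / 12 * (E4 z * h (j + 1) z) * E2 z ^ j) = 
      (\<Sum>j\<le>s + 1. serre_coeffs e m h j z * E2 z ^ j)"
    unfolding sum.distrib[symmetric] sum_subtractf[symmetric]
    by (rule sum.cong) (auto simp: serre_coeffs_def c_def algebra_simps)
  finally show ?thesis .
qed

text \<open>For \<open>m > 2e - s\<close> every application of the Serre derivative raises the depth by one, so no
  monic relation among the iterated derivatives is possible.\<close>

lemma MLDE_weight_bound:
  assumes h: "depth_coeffs e s h" and f: "\<And>z. z \<in> uhp \<Longrightarrow> f z = (\<Sum>j\<le>s. h j z * E2 z ^ j)"
    and nz: "z0 \<in> uhp" "h s z0 \<noteq> 0" and m: "m > 2 * real e - real s"
  shows "\<not> satisfies_monic_MLDE f m"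
proof
  assume "satisfies_monic_MLDE f m"
  then obtain n g where g: "\<And>i. i \<in> {1..n} \<Longrightarrow> mf i (g i)"
    and eq: "\<And>z. z \<in> uhp \<Longrightarrow> serre_D_iter m n f z + (\<Sum>i=1..n. g i z * serre_D_iter m (n - i) f z) = 0"
    unfolding satisfies_monic_MLDE_def mf_def by blast
  define H where "H = rec_nat h (\<lambda>l. serre_coeffs (e + l) (m + 2 * real l))"
  have H0: "H 0 = h" and HS: "H (Suc l) = serre_coeffs (e + l) (m + 2 * real l) (H l)" for l by (simp_all add: H_def)
  have HD: "depth_coeffs (e + l) (s + l) (H l)" for l
  proof (induction l)
    case (Suc l)
    show ?case using depth_coeffs_serre[OF Suc] by (simp add: HS)
  qed (simp add: H0 h)
  have HE: "serre_D_iter m l f z = (\<Sum>j\<le>s + l. H l j z * E2 z ^ j)" if "z \<in> uhp" for l z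
    using that
  proof (induction l arbitrary: z)
    case (Suc l)
    from serre_D_depth_expansion[OF HD[of l] Suc.IH Suc.prems] show ?case by (simp add: HS)
  qed (simp add: f H0)
  have top: "H l (s + l) z0 \<noteq> 0" for l
  proof (induction l)
    case (Suc l)
    have "serre_D k (H l (Suc (s + l))) z0 = 0" for k
      using HD[of l] nz(1) by (intro serre_D_zero) (auto simp: depth_coeffs_def)
    moreover have "H l (Suc (Suc (s + l))) z0 = 0" using HD[of l] nz(1) by (auto simp: depth_coeffs_def)
    ultimately have "H (Suc l) (s + Suc l) z0 = of_real (2 * real (e + l) - real (s + l) - (m + 2 * real l)) / 12 * H l (s + l) z0"
      by (simp add: HS serre_coeffs_def)
    \<comment> \<open>It equals 2e - s - m - l, which is negative and moves away from 0 as l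
      grows.\<close>
    moreover have "2 * real (e + l) - real (s + l) - (m + 2 * real l) \<noteq> 0" using m by simp
    ultimately show ?case using Suc by (simp only: of_real_eq_0_iff divide_eq_0_iff mult_eq_0_iff) simp
  qed (simp add: H0 nz)
  have ext: "(\<Sum>j\<le>s + l. H l j z * E2 z ^ j) = (\<Sum>j\<le>s + n. H l j z * E2 z ^ j)" if "l \<le> n" "z \<in> uhp" for l z
    using HD[of l] that by (intro sum.mono_neutral_left) (auto simp: depth_coeffs_def)
  define Q where "Q = (\<lambda>j z. H n j z + (\<Sum>i=1..n. g i z * H (n - i) j z))"
  have rel: "(\<Sum>j\<le>s + n. Q j z * E2 z ^ j) = 0" if z: "z \<in> uhp" for z
  proof -
    have "(\<Sum>j\<le>s + n. Q j z * E2 z ^ j) = (\<Sum>j\<le>s + n. H n j z * E2 z ^ j) + (\<Sum>i=1..n. g i z * (\<Sum>j\<le>s + n. H (n - i) j z * E2 z ^ j))"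
      by (simp add: Q_def distrib_right sum.distrib sum_distrib_left sum_distrib_right mult.assoc)
         (rule sum.swap)
    also have "\<dots> = serre_D_iter m n f z + (\<Sum>i=1..n. g i z * serre_D_iter m (n - i) f z)"
    proof -
      have "(\<Sum>j\<le>s + n. H (n - i) j z * E2 z ^ j) = serre_D_iter m (n - i) f z" for i
        using ext[of "n - i", OF _ z] HE[OF z, of "n - i"] by simp
      thus ?thesis unfolding HE[OF z, of n] by (simp only:)
    qed
    also have "\<dots> = 0" by (rule eq[OF z])
    finally show ?thesis .
  qed
  \<comment> \<open>The MLDE is a polynomial relation for \<open>E2\<close> over modular forms, so
    each coefficient vanishes, here that of the highest power.\<close>
  have "Q (s + n) z0 = 0"
  proof (rule E2_transcendental[of "s + n" "e + n" Q])
    fix j assume j: "j \<le> s + n" "j \<le> e + n"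
    have sum: "mf (e + n - j) (\<lambda>z. \<Sum>i\<in>A. g i z * H (n - i) j z)" if "finite A" "A \<subseteq> {1..n}" for A
      using that
    proof (induction A rule: finite_induct)
      case (insert i A)
      have "mf (e + n - j) (\<lambda>z. g i z * H (n - i) j z)"
      proof (cases "j \<le> e + (n - i)")
        case True
        hence "mf (i + (e + (n - i) - j)) (\<lambda>z. g i z * H (n - i) j z)"
          using insert.prems HD[of "n - i"] by (intro mf_mult g) (auto simp: depth_coeffs_def)
        moreover have "i + (e + (n - i) - j) = e + n - j" using True insert.prems by auto
        ultimately show ?thesis by (simp only:)
      next
        case False
        thus ?thesis using HD[of "n - i"] by (intro mf_cong[OF mf_zero]) (auto simp: depth_coeffs_def)
      qed
      from mf_add[OF this insert.IH] insert show ?case by simp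
    qed (simp add: mf_zero)
    show "mf (e + n - j) (Q j)" unfolding Q_def
      by (intro mf_add sum) (use HD[of n] j in \<open>auto simp: depth_coeffs_def\<close>)
  next
    fix j z assume j: "j > e + n" and z: "z \<in> uhp"
    have "H l j z = 0" if "l \<le> n" for l using HD[of l] j z that by (auto simp: depth_coeffs_def)
    thus "Q j z = 0" by (simp add: Q_def)
  qed (use rel nz in auto)
  \<comment> \<open>The derivative of order n - i has depth at most s + n - i and does not reach
    this power.\<close>
  moreover have "Q (s + n) z0 = H n (s + n) z0"
    using HD nz(1) unfolding Q_def depth_coeffs_def by (auto intro!: sum.neutral)
  ultimately show False using top[of n] by simp
qed

section \<open>Linear independence of the monomials in \<open>E4\<close> and
  \<open>E6\<close>\<close>

lemma E6_at_i: "E6 \<i> = 0" and E4_at_i: "E4 \<i> \<noteq> 0"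
proof -
  have i: "\<i> \<in> uhp" by (simp add: uhp_def)
  \<comment> \<open>\<i> is fixed by S, so E6(\<i>) = \<i>^6 E6(\<i>) = -E6(\<i>); a common zero of
    E4 and E6 would be a zero of \<open>Disc\<close>.\<close>
  have "\<i> ^ 6 = -1" by (simp add: eval_nat_numeral)
  thus "E6 \<i> = 0" using E6_S[OF i] by simp
  thus "E4 \<i> \<noteq> 0" using Disc_nonzero[OF i] by (auto simp: Disc_def)
qed

text \<open>f has no zero on a nonempty open set, so g vanishes there, and the identity theorem
  extends this.\<close>

lemma holomorphic_mult_eq_0:
  assumes f: "f holomorphic_on uhp" and g: "g holomorphic_on uhp"
    and fg: "\<And>z. z \<in> uhp \<Longrightarrow> f z * g z = 0" and nz: "z0 \<in> uhp" "f z0 \<noteq> 0" and z: "z \<in> uhp"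
  shows "g z = 0"
proof -
  have "continuous_on uhp f" using f by (rule holomorphic_on_imp_continuous_on)
  hence "open (f -` (- {0}) \<inter> uhp)" 
    using continuous_on_open_vimage[OF open_uhp] open_Compl[of "{0::complex}"] by blast
  moreover have "z0 \<in> f -` (- {0}) \<inter> uhp" using nz by simp
  ultimately show ?thesis
    using analytic_continuation_open[of "f -` (- {0}) \<inter> uhp" uhp g "\<lambda>_. 0" z]
      open_uhp convex_connected[OF convex_uhp] g fg z by (auto simp: uhp_def)
qed

text \<open>Divide by the lowest power of E6 that occurs and evaluate at \<i>, where E6 vanishes and
  E4 does not: only the monomial with this power survives.\<close>

lemma E4_E6_independent:
  assumes c: "c (b0, a0) \<noteq> 0" "2 * b0 + 3 * a0 = w"
    and rel: "\<And>z. z \<in> uhp \<Longrightarrow> (\<Sum>(b, a)\<in>{(b, a). 2 * b + 3 * a = w}. c (b, a) * E4 z ^ b * E6 z ^ a) = 0"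
  shows False
proof -
  define S where "S = {(b, a). 2 * b + 3 * a = w \<and> c (b, a) \<noteq> 0}"
  have fin: "finite {(b, a). 2 * b + 3 * a = (w::nat)}"
    by (rule finite_subset[of _ "{..w} \<times> {..w}"]) auto
  have finS: "finite S" by (rule finite_subset[OF _ fin]) (auto simp: S_def)
  have "(b0, a0) \<in> S" using c by (simp add: S_def)
  then obtain x1 where "x1 \<in> S" "\<And>x. x \<in> S \<Longrightarrow> snd x1 \<le> snd x"
    using ex_has_least_nat[of "\<lambda>x. x \<in> S" "(b0, a0)" snd] by blast
  then obtain b1 a1 where b1: "(b1, a1) \<in> S" and amin: "\<And>b a. (b, a) \<in> S \<Longrightarrow> a1 \<le> a"
    by (metis prod.collapse snd_conv)
  define R where "R = (\<lambda>z. \<Sum>(b, a)\<in>S. c (b, a) * E4 z ^ b * E6 z ^ (a - a1))"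
  have R: "E6 z ^ a1 * R z = 0" if "z \<in> uhp" for z
  proof -
    have "E6 z ^ a1 * R z = (\<Sum>(b, a)\<in>S. c (b, a) * E4 z ^ b * E6 z ^ a)"
      unfolding R_def sum_distrib_left
    proof (rule sum.cong)
      fix x assume "x \<in> S"
      then obtain b a where x: "x = (b, a)" "a1 \<le> a" using amin by (cases x) auto
      hence "E6 z ^ a = E6 z ^ a1 * E6 z ^ (a - a1)" by (simp flip: power_add)
      thus "E6 z ^ a1 * (case x of (b, a) \<Rightarrow> c (b, a) * E4 z ^ b * E6 z ^ (a - a1)) = (case x of (b, a) \<Rightarrow> c (b, a) * E4 z ^ b * E6 z ^ a)"
        by (simp add: x)
    qed simp
    also have "\<dots> = (\<Sum>(b, a)\<in>{(b, a). 2 * b + 3 * a = w}. c (b, a) * E4 z ^ b * E6 z ^ a)"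
      by (rule sum.mono_neutral_left[OF fin]) (auto simp: S_def)
    finally show ?thesis using rel[OF that] by simp
  qed
  have i: "\<i> \<in> uhp" by (simp add: uhp_def)
  \<comment> \<open>E6 is not identically zero, as its Serre derivative -E4^2/2 is nonzero at \<i>;
    hence the power of E6 can be cancelled.\<close>
  obtain z0 where z0: "z0 \<in> uhp" "E6 z0 \<noteq> 0"
  proof (rule ccontr)
    assume "\<not> thesis"
    hence 0: "E6 z = 0" if "z \<in> uhp" for z using that \<open>\<And>z0. z0 \<in> uhp \<Longrightarrow> E6 z0 \<noteq> 0 \<Longrightarrow> thesis\<close> by blast
    hence "serre_D 6 E6 \<i> = 0" by (intro serre_D_zero i)
    thus False using ramanujan_E6[OF i] E4_at_i by simp
  qed
  have "R \<i> = 0"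
  proof (rule holomorphic_mult_eq_0[of "\<lambda>z. E6 z ^ a1" R z0])
    show "R holomorphic_on uhp" unfolding R_def case_prod_unfold
      by (intro holomorphic_intros E4_holomorphic E6_holomorphic)
  qed (use R z0 i in \<open>auto intro!: holomorphic_intros E6_holomorphic\<close>)
  moreover have "R \<i> = (\<Sum>x\<in>{(b1, a1)}. c x * E4 \<i> ^ fst x * E6 \<i> ^ (snd x - a1))"
    unfolding R_def case_prod_unfold prod.collapse
  proof (rule sum.mono_neutral_right[OF finS])
    show "{(b1, a1)} \<subseteq> S" using b1 by simp
    show "\<forall>x\<in>S - {(b1, a1)}. c x * E4 \<i> ^ fst x * E6 \<i> ^ (snd x - a1) = 0"
    proof
      fix x assume x: "x \<in> S - {(b1, a1)}"
      obtain b a where ba: "x = (b, a)" by (cases x)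
      have "a \<noteq> a1" using x b1 by (auto simp: ba S_def)
      hence "a > a1" using amin[of b a] x by (simp add: ba)
      thus "c x * E4 \<i> ^ fst x * E6 \<i> ^ (snd x - a1) = 0" by (simp add: ba E6_at_i)
    qed
  qed
  ultimately show False using b1 E4_at_i by (simp add: S_def)
qed

section \<open>The differential weight\<close>

lemma dwt_ge: "satisfies_monic_MLDE f (real_of_int k) \<Longrightarrow> ereal (real_of_int k) \<le> dwt f"
  unfolding dwt_def by (rule Sup_upper) blast

lemma dwt_le: "(\<And>k. satisfies_monic_MLDE f (real_of_int k) \<Longrightarrow> ereal (real_of_int k) \<le> x) \<Longrightarrow> dwt f \<le> x"
  unfolding dwt_def by (rule Sup_least) blast

lemma dwt_infinity:
  assumes "\<And>k :: int. satisfies_monic_MLDE f (real_of_int k)"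
  shows "dwt f = \<infinity>"
proof (rule ereal_top)
  fix B :: real
  have "ereal B \<le> ereal (real_of_int \<lceil>B\<rceil>)" by simp
  also have "\<dots> \<le> dwt f" by (rule dwt_ge[OF assms])
  finally show "ereal B \<le> dwt f" .
qed

text \<open>The integral weights of f are closed downwards, so there are none, all, or those up to a
  largest one; in the last case the supremum in \<open>dwt\<close> is a maximum.\<close>

lemma dwt_cases:
  assumes f: "f holomorphic_on uhp"
  obtains (none) "dwt f = -\<infinity>" "\<And>k :: int. \<not> satisfies_monic_MLDE f (real_of_int k)"
    | (all) "dwt f = \<infinity>" "\<And>k :: int. satisfies_monic_MLDE f (real_of_int k)"
    | (fin) K :: int where "dwt f = ereal (real_of_int K)" "\<And>k :: int. satisfies_monic_MLDE f (real_of_int k) \<longleftrightarrow> k \<le> K"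
proof -
  define S where "S = {k :: int. satisfies_monic_MLDE f (real_of_int k)}"
  have down: "l \<in> S" if "k \<in> S" "l \<le> k" for k l
    using that MLDE_downward[OF f] by (auto simp: S_def)
  show ?thesis
  proof (cases "S = {}")
    case True
    hence no: "\<not> satisfies_monic_MLDE f (real_of_int k)" for k by (auto simp: S_def)
    hence "dwt f \<le> -\<infinity>" by (intro dwt_le) auto
    thus ?thesis using no by (intro none) auto
  next
    case nonempty: False
    show ?thesis
    proof (cases "bdd_above S")
      case True
      then obtain M where M: "\<And>k. k \<in> S \<Longrightarrow> k \<le> M" by (auto simp: bdd_above_def)
      obtain k0 where k0: "k0 \<in> S" using nonempty by blast
      have finS: "finite (S \<inter> {k0..})" by (rule finite_subset[of _ "{k0..M}"]) (use M in auto)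
      define K where "K = Max (S \<inter> {k0..})"
      have K: "K \<in> S" using Max_in[OF finS] k0 by (auto simp: K_def)
      have le: "k \<le> K" if "k \<in> S" for k
      proof (cases "k \<ge> k0")
        case True
        thus ?thesis unfolding K_def by (intro Max_ge[OF finS]) (use that in auto)
      next
        case False
        have "k0 \<le> K" unfolding K_def by (intro Max_ge[OF finS]) (use k0 in auto)
        thus ?thesis using False by simp
      qed
      have iff: "satisfies_monic_MLDE f (real_of_int k) \<longleftrightarrow> k \<le> K" for k
        using le[of k] down[OF K, of k] by (auto simp: S_def)
      have "dwt f = ereal (real_of_int K)"
        by (rule antisym[OF dwt_le dwt_ge]) (auto simp: iff)
      thus ?thesis using iff by (rule fin)
    next
      case False
      have "k \<in> S" for k
      proof -
        obtain l where "l \<in> S" "k < l" using False by (auto simp: bdd_above_def not_le)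
        thus ?thesis using down[of l k] by simp
      qed
      hence a: "satisfies_monic_MLDE f (real_of_int k)" for k by (simp add: S_def)
      show ?thesis by (rule all[OF dwt_infinity[OF a] a])
    qed
  qed
qed

text \<open>When one factor has all weights and the other has some, every integer is a sum of a
  weight of f and one of g, so the product has all weights.\<close>

lemma dwt_mult:
  assumes f: "f holomorphic_on uhp" and g: "g holomorphic_on uhp"
  shows "dwt_add (dwt f) (dwt g) \<le> dwt (\<lambda>z. f z * g z)"
proof -
  have mult: "satisfies_monic_MLDE (\<lambda>z. f z * g z) (real_of_int m)"
    if "satisfies_monic_MLDE f (real_of_int k)" "satisfies_monic_MLDE g (real_of_int l)" "k + l = m" for k l m :: int
    using MLDE_mult[OF f that(1) g that(2)] that(3) by (metis of_int_add)
  have inf: "dwt (\<lambda>z. f z * g z) = \<infinity>" if "\<And>m. \<exists>k l. satisfies_monic_MLDE f (real_of_int k) \<and> satisfies_monic_MLDE g (real_of_int l) \<and> k + l = m"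
    by (rule dwt_infinity) (use that mult in metis)
  from f show ?thesis
  proof (cases rule: dwt_cases)
    case none
    thus ?thesis by (simp add: dwt_add_def)
  next
    case allf: all
    from g show ?thesis
    proof (cases rule: dwt_cases)
      case none
      thus ?thesis by (simp add: dwt_add_def)
    next
      case all
      have "dwt (\<lambda>z. f z * g z) = \<infinity>" by (rule inf) (use all allf in \<open>metis add_0\<close>)
      thus ?thesis by simp
    next
      case (fin L)
      have "\<exists>k l. satisfies_monic_MLDE f (real_of_int k) \<and> satisfies_monic_MLDE g (real_of_int l) \<and> k + l = m" for m
        by (rule exI[of _ "m - L"], rule exI[of _ L]) (use allf(2)[of "m - L"] fin(2)[of L] in \<open>simp del: of_int_diff\<close>)
      from inf[OF this] show ?thesis by simp
    qed
  next
    case finf: (fin K)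
    from g show ?thesis
    proof (cases rule: dwt_cases)
      case none
      thus ?thesis by (simp add: dwt_add_def)
    next
      case all
      have "\<exists>k l. satisfies_monic_MLDE f (real_of_int k) \<and> satisfies_monic_MLDE g (real_of_int l) \<and> k + l = m" for m
        by (rule exI[of _ K], rule exI[of _ "m - K"]) (use all(2)[of "m - K"] finf(2)[of K] in \<open>simp del: of_int_diff\<close>)
      from inf[OF this] show ?thesis by simp
    next
      case (fin L)
      have "ereal (real_of_int (K + L)) \<le> dwt (\<lambda>z. f z * g z)"
        by (intro dwt_ge mult[of K L]) (simp_all add: fin finf)
      thus ?thesis by (simp add: dwt_add_def fin finf)
    qed
  qed
qed

text \<open>Every weight of g is also one of f by downward closure, so the two functions may be
  added in that weight. The hypothesis covers equal and unequal values of \<open>dwt\<close>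
  alike.\<close>

lemma dwt_sum:
  assumes f: "f holomorphic_on uhp" and g: "g holomorphic_on uhp" and le: "dwt g \<le> dwt f"
  shows "dwt g \<le> dwt (\<lambda>z. f z + g z)"
proof (rule dwt_le)
  fix k assume k: "satisfies_monic_MLDE g (real_of_int k)"
  have "satisfies_monic_MLDE f (real_of_int k)"
    using f
  proof (cases rule: dwt_cases)
    case none
    thus ?thesis using dwt_ge[OF k] le by simp
  next
    case (fin K)
    hence "ereal (real_of_int k) \<le> ereal (real_of_int K)" using order_trans[OF dwt_ge[OF k] le] by simp
    thus ?thesis using fin by simp
  qed auto
  thus "ereal (real_of_int k) \<le> dwt (\<lambda>z. f z + g z)" by (intro dwt_ge MLDE_add f g k)
qed

text \<open>For the upper bound write g = (f + g) - f and take a weight l of f above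
  \<open>dwt g\<close>. If k is a weight of f + g, then the minimum of k and l is one of g; so it is
  not l, and k is at most \<open>dwt g\<close>.\<close>

lemma dwt_sum_eq:
  assumes f: "f holomorphic_on uhp" and g: "g holomorphic_on uhp" and less: "dwt g < dwt f"
  shows "dwt (\<lambda>z. f z + g z) = dwt g"
proof (rule antisym[OF _ dwt_sum[OF f g less_imp_le[OF less]]])
  have fg: "(\<lambda>z. f z + g z) holomorphic_on uhp" by (intro holomorphic_intros f g)
  obtain l where l: "satisfies_monic_MLDE f (real_of_int l)" "dwt g < ereal (real_of_int l)"
    using less unfolding dwt_def[of f] less_Sup_iff by blast
  show "dwt (\<lambda>z. f z + g z) \<le> dwt g"
  proof (rule dwt_le)
    fix k assume k: "satisfies_monic_MLDE (\<lambda>z. f z + g z) (real_of_int k)"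
    have "satisfies_monic_MLDE (\<lambda>z. (f z + g z) - f z) (real_of_int (min k l))"
      by (intro MLDE_diff fg f MLDE_downward[OF fg k] MLDE_downward[OF f l(1)]) auto
    hence "ereal (real_of_int (min k l)) \<le> dwt g" by (intro dwt_ge) simp
    with l(2) show "ereal (real_of_int k) \<le> dwt g" by (auto simp: min_def split: if_splits)
  qed
qed

text \<open>Grouping the polynomial by powers of E2 gives the coefficients \<open>h j\<close>. The
  depth is read off the polynomial, so its top coefficient has to be shown nonzero as a function;
  this is the independence of E4 and E6.\<close>

lemma dwt_quasimodular:
  assumes "quasimodular f k s"
  shows "dwt f = ereal (real k - real s)"
proof -
  obtain c where fc: "\<And>z. z \<in> uhp \<Longrightarrow> f z = (\<Sum>(a, b, e) \<in> {(a, b, e). 2 * a + 4 * b + 6 * e = k}.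
                           c (a, b, e) * E2 z ^ a * E4 z ^ b * E6 z ^ e)"
    and cs: "\<And>a b e. 2 * a + 4 * b + 6 * e = k \<Longrightarrow> c (a, b, e) \<noteq> 0 \<Longrightarrow> a \<le> s"
    and ctop: "\<exists>b e. 2 * s + 4 * b + 6 * e = k \<and> c (s, b, e) \<noteq> 0"
    using assms unfolding quasimodular_def by blast
  obtain b0 a0 where top: "2 * s + 4 * b0 + 6 * a0 = k" "c (s, b0, a0) \<noteq> 0" using ctop by blast
  define w where "w = s + 2 * b0 + 3 * a0"
  have k: "k = 2 * w" using top by (simp add: w_def)
  define P where "P = (\<lambda>j. {(b, a). 2 * b + 3 * a = w - j})"
  have finP: "finite (P j)" for j
    by (rule finite_subset[of _ "{..w} \<times> {..w}"]) (auto simp: P_def)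
  define h where "h = (\<lambda>j z. if j \<le> s then \<Sum>(b, a)\<in>P j. c (j, b, a) * (E4 z ^ b * E6 z ^ a) else 0)"
  have sw: "s \<le> w" by (simp add: w_def)
  have "mf (w - j) (h j)" if "j \<le> w" for j
  proof (cases "j \<le> s")
    case True
    have "mf (w - j) (\<lambda>z. \<Sum>x\<in>A. c (j, fst x, snd x) * (E4 z ^ fst x * E6 z ^ snd x))" if "finite A" "A \<subseteq> P j" for A
      using that
    proof (induction A rule: finite_induct)
      case (insert x A)
      have "mf (fst x * 2 + snd x * 3) (\<lambda>z. E4 z ^ fst x * E6 z ^ snd x)"
        by (intro mf_mult mf_power mf_E4 mf_E6)
      moreover have "fst x * 2 + snd x * 3 = w - j" using insert.prems by (auto simp: P_def)
      ultimately have "mf (w - j) (\<lambda>z. c (j, fst x, snd x) * (E4 z ^ fst x * E6 z ^ snd x))"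
        by (simp only: mf_cmult)
      from mf_add[OF this insert.IH] insert show ?case by simp
    qed (simp add: mf_zero)
    from this[OF finP order_refl] show ?thesis using True by (simp add: h_def case_prod_unfold)
  next
    case False
    thus ?thesis by (simp add: h_def mf_zero)
  qed
  hence dc: "depth_coeffs w s h" using sw by (auto simp: depth_coeffs_def h_def)
  have fin3: "finite {(a, b, e). 2 * a + 4 * b + 6 * e = k}"
    by (rule finite_subset[of _ "{..k} \<times> {..k} \<times> {..k}"]) auto
  have fh: "f z = (\<Sum>j\<le>s. h j z * E2 z ^ j)" if z: "z \<in> uhp" for z
  proof -
    have "f z = (\<Sum>(a, b, e) \<in> {(a, b, e). 2 * a + 4 * b + 6 * e = k}. c (a, b, e) * E2 z ^ a * E4 z ^ b * E6 z ^ e)"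
      by (rule fc[OF z])
    also have "\<dots> = (\<Sum>(a, b, e) \<in> (SIGMA j:{..s}. P j). c (a, b, e) * E2 z ^ a * E4 z ^ b * E6 z ^ e)"
    proof (rule sum.mono_neutral_right[OF fin3])
      show "(SIGMA j:{..s}. P j) \<subseteq> {(a, b, e). 2 * a + 4 * b + 6 * e = k}"
        using sw by (auto simp: P_def k)
      show "\<forall>x\<in>{(a, b, e). 2 * a + 4 * b + 6 * e = k} - (SIGMA j:{..s}. P j).
          (case x of (a, b, e) \<Rightarrow> c (a, b, e) * E2 z ^ a * E4 z ^ b * E6 z ^ e) = 0"
      proof
        fix x assume x: "x \<in> {(a, b, e). 2 * a + 4 * b + 6 * e = k} - (SIGMA j:{..s}. P j)"
        obtain a b e where abe: "x = (a, b, e)" by (cases x)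
        have eq: "2 * a + 4 * b + 6 * e = k" using x by (simp add: abe)
        have "\<not> a \<le> s" using x eq by (auto simp: abe P_def k)
        hence "c (a, b, e) = 0" using cs[OF eq] by blast
        thus "(case x of (a, b, e) \<Rightarrow> c (a, b, e) * E2 z ^ a * E4 z ^ b * E6 z ^ e) = 0" by (simp add: abe)
      qed
    qed
    also have "\<dots> = (\<Sum>j\<le>s. \<Sum>(b, e)\<in>P j. c (j, b, e) * E2 z ^ j * E4 z ^ b * E6 z ^ e)"
      by (rule sum.Sigma[symmetric]) (use finP in auto)
    also have "\<dots> = (\<Sum>j\<le>s. h j z * E2 z ^ j)"
    proof (rule sum.cong[OF refl])
      fix j assume "j \<in> {..s}"
      hence "h j z * E2 z ^ j = (\<Sum>(b, e)\<in>P j. c (j, b, e) * (E4 z ^ b * E6 z ^ e) * E2 z ^ j)"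
        by (simp add: h_def sum_distrib_right case_prod_unfold)
      thus "(\<Sum>(b, e)\<in>P j. c (j, b, e) * E2 z ^ j * E4 z ^ b * E6 z ^ e) = h j z * E2 z ^ j"
        by (simp add: mult_ac)
    qed
    finally show ?thesis .
  qed
  have "\<exists>z\<in>uhp. h s z \<noteq> 0"
  proof (rule ccontr)
    assume no: "\<not> ?thesis"
    show False
    proof (rule E4_E6_independent[of "\<lambda>(b, a). c (s, b, a)" b0 a0 "w - s"])
      show "(case (b0, a0) of (b, a) \<Rightarrow> c (s, b, a)) \<noteq> 0" using top by simp
      show "2 * b0 + 3 * a0 = w - s" by (simp add: w_def)
      fix z assume "z \<in> uhp"
      hence "h s z = 0" using no by blast
      thus "(\<Sum>(b, a)\<in>{(b, a). 2 * b + 3 * a = w - s}. (case (b, a) of (b, a) \<Rightarrow> c (s, b, a)) * E4 z ^ b * E6 z ^ a) = 0"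
        by (simp add: h_def P_def case_prod_unfold mult.assoc)
    qed
  qed
  then obtain z0 where z0: "z0 \<in> uhp" "h s z0 \<noteq> 0" by blast
  have sat: "satisfies_monic_MLDE f (2 * real w - real s)"
    by (rule MLDE_quasimodular[of s w h f]) (use dc fh in \<open>auto simp: depth_coeffs_def\<close>)
  have ks: "real_of_int (int k - int s) = 2 * real w - real s" by (simp add: k)
  have "dwt f = ereal (real_of_int (int k - int s))"
  proof (rule antisym[OF dwt_le dwt_ge])
    show "satisfies_monic_MLDE f (real_of_int (int k - int s))" unfolding ks by (rule sat)
    fix m assume "satisfies_monic_MLDE f (real_of_int m)"
    hence "\<not> real_of_int m > 2 * real w - real s" using MLDE_weight_bound[OF dc fh z0] by blast
    thus "ereal (real_of_int m) \<le> ereal (real_of_int (int k - int s))" unfolding ks by simp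
  qed
  thus ?thesis by simp
qed

theorem theorem4p5:
  fixes f g :: "complex \<Rightarrow> complex"
  assumes "f holomorphic_on uhp" and "g holomorphic_on uhp"
  shows "dwt (\<lambda>z. f z * g z) \<ge> dwt_add (dwt f) (dwt g)
       \<and> (dwt f = dwt g \<longrightarrow> dwt (\<lambda>z. f z + g z) \<ge> dwt g)
       \<and> (dwt f > dwt g \<longrightarrow> dwt (\<lambda>z. f z + g z) = dwt g)
       \<and> (\<forall>k s. quasimodular f k s \<and> (\<exists>z\<in>uhp. f z \<noteq> 0)
             \<longrightarrow> dwt f = ereal (real k - real s))"
  using dwt_mult[OF assms] dwt_sum[OF assms] dwt_sum_eq[OF assms] dwt_quasimodular by simp

end
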